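(* Let $\lambda=1$. There exist positive constants $C_5,C_6$ such that for every integer $L\ge2$ $$C_5\,L^{\rho}\;\le\;T_{\mathrm{mix}}\;\le\;C_6\,L^{2+\rho}$$ and $$C_5\,L^{\rho}\;\le\;T_{\mathrm{rel}}\;\le\;C_6\,L^{1+\rho}.$$
   Context: Fix $\rho\in(0,1)$ and let $K(j)=\mathcal{C}_K\, j^{-(1+\rho)}$ for integers $j\ge 1$, where $\mathcal{C}_K>0$ is such that $\sum_{j\ge1}K(j)=1$. For an integer $L\ge2$ let $\Omega_L=\{\eta\in\{0,1\}^{\{0,1,\dots,L\}}:\eta_0=\eta_L=1\}$. For $\eta\in\Omega_L$ let $0=x_0<x_1<\dots<x_{n(\eta)+1}=L$ be the ordered list of sites $x$ with $\eta_x=1$ (particles), so $n(\eta)$ is the number of particles strictly between $0$ and $L$. For $\lambda>0$, $\pi_L^\lambda$ is the probability measure on $\Omega_L$ given by $\pi_L^\lambda(\eta)=\frac{\lambda^{n(\eta)}}{Z_L(\lambda)}\prod_{j=0}^{n(\eta)}K(x_{j+1}-x_j)$, with $Z_L(\lambda)$ the normalizing constant. Heat-bath dynamics: the continuous-time Markov chain on $\Omega_L$ with generator $\mathcal{L}f=\sum_{x=1}^{L-1}[\mathcal{Q}_xf-f]$, where $(\mathcal{Q}_xf)(\eta)=\pi_L^\lambda(f\mid \eta_y,\,y\neq x)$; i.e. each site $x\in\{1,\dots,L-1\}$ has an independent rate-1 Poisson clock and, when it rings, $\eta_x$ is resampled from $\pi_L^\lambda$ conditioned on the current configuration at all other sites.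 Let $\mu_t^\sigma$ be the law at time $t$ started from $\sigma\in\Omega_L$, and let $\|\cdot\|$ denote total variation distance, $\|\mu-\nu\|=\frac12\sum_{x}|\mu(x)-\nu(x)|$. The mixing time is $T_{\mathrm{mix}}=\inf\{t\ge0:\sup_{\sigma\in\Omega_L}\|\mu_t^\sigma-\pi_L^\lambda\|\le(2e)^{-1}\}$. The relaxation time is $T_{\mathrm{rel}}=1/\mathrm{gap}$, where $\mathrm{gap}=\inf_f \mathcal{E}_L(f;f)/\pi_L^\lambda(f;f)$, the infimum being over non-constant $f:\Omega_L\to\mathbb{R}$, with $\mathcal{E}_L(f;f)=-\pi_L^\lambda(f\mathcal{L}f)$ the Dirichlet form and $\pi_L^\lambda(f;f)$ the variance of $f$ under $\pi_L^\lambda$. Both times depend on $L,\lambda,\rho$. Here $\lambda=1$; $\rho$ is fixed and constants may depend on it. *)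

theory Defs
  imports "HOL-Analysis.Analysis"
begin

definition renewal_const :: "real \<Rightarrow> real" where
  "renewal_const \<rho> = 1 / (\<Sum>j. real (Suc j) powr - (1 + \<rho>))"

definition renewal_K :: "real \<Rightarrow> nat \<Rightarrow> real" where
  "renewal_K \<rho> j = renewal_const \<rho> * real j powr - (1 + \<rho>)"

text \<open>
  A configuration in \<open>{0,1}\<close>-valued functions on \<open>{0..L}\<close> is encoded by the set of its
  particles (the sites where it equals 1).
\<close>

definition configs :: "nat \<Rightarrow> nat set set" where
  "configs L = {\<eta>. \<eta> \<subseteq> {0..L} \<and> 0 \<in> \<eta> \<and> L \<in> \<eta>}"

definition inner_particles :: "nat \<Rightarrow> nat set \<Rightarrow> nat" where
  "inner_particles L \<eta> = card (\<eta> \<inter> {0<..<L})"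

definition weight :: "real \<Rightarrow> real \<Rightarrow> nat \<Rightarrow> nat set \<Rightarrow> real" where
  "weight \<rho> lam L \<eta> =
     (let x = sorted_list_of_set \<eta>; n = inner_particles L \<eta>
      in lam ^ n * (\<Prod>j=0..n. renewal_K \<rho> (x ! (j + 1) - x ! j)))"

definition partition_fn :: "real \<Rightarrow> real \<Rightarrow> nat \<Rightarrow> real" where
  "partition_fn \<rho> lam L = (\<Sum>\<eta>\<in>configs L. weight \<rho> lam L \<eta>)"

definition gibbs :: "real \<Rightarrow> real \<Rightarrow> nat \<Rightarrow> nat set \<Rightarrow> real" where
  "gibbs \<rho> lam L \<eta> = weight \<rho> lam L \<eta> / partition_fn \<rho> lam L"

definition gibbs_mean :: "real \<Rightarrow> real \<Rightarrow> nat \<Rightarrow> (nat set \<Rightarrow> real) \<Rightarrow> real" where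
  "gibbs_mean \<rho> lam L f = (\<Sum>\<eta>\<in>configs L. gibbs \<rho> lam L \<eta> * f \<eta>)"

definition gibbs_var :: "real \<Rightarrow> real \<Rightarrow> nat \<Rightarrow> (nat set \<Rightarrow> real) \<Rightarrow> real" where
  "gibbs_var \<rho> lam L f = gibbs_mean \<rho> lam L (\<lambda>\<eta>. (f \<eta> - gibbs_mean \<rho> lam L f)\<^sup>2)"

definition agree_off :: "nat \<Rightarrow> nat \<Rightarrow> nat set \<Rightarrow> nat set set" where
  "agree_off L x \<eta> = {\<xi> \<in> configs L. \<forall>y. y \<noteq> x \<longrightarrow> (y \<in> \<xi> \<longleftrightarrow> y \<in> \<eta>)}"

text \<open>
  The conditional expectation of \<open>f\<close> under \<open>gibbs\<close> given the configuration off \<open>x\<close>.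
  Positivity of the weights makes the denominator positive for \<open>\<eta>\<close> in \<open>configs L\<close>.
\<close>

definition heat_bath :: "real \<Rightarrow> real \<Rightarrow> nat \<Rightarrow> nat \<Rightarrow> (nat set \<Rightarrow> real) \<Rightarrow> nat set \<Rightarrow> real" where
  "heat_bath \<rho> lam L x f \<eta> =
     (\<Sum>\<xi>\<in>agree_off L x \<eta>. gibbs \<rho> lam L \<xi> * f \<xi>) / (\<Sum>\<xi>\<in>agree_off L x \<eta>. gibbs \<rho> lam L \<xi>)"

definition generator :: "real \<Rightarrow> real \<Rightarrow> nat \<Rightarrow> (nat set \<Rightarrow> real) \<Rightarrow> nat set \<Rightarrow> real" where
  "generator \<rho> lam L f \<eta> = (\<Sum>x\<in>{0<..<L}. heat_bath \<rho> lam L x f \<eta> - f \<eta>)"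

text \<open>
  The Markov semigroup of a finite chain is the exponential of \<open>t\<close> times its generator, and the
  law at time \<open>t\<close> gives the state \<open>\<eta>\<close> the mass obtained by applying the semigroup to the
  indicator of \<open>\<eta>\<close> and evaluating at the initial state.
\<close>

definition semigroup_op ::
  "real \<Rightarrow> real \<Rightarrow> nat \<Rightarrow> real \<Rightarrow> (nat set \<Rightarrow> real) \<Rightarrow> nat set \<Rightarrow> real" where
  "semigroup_op \<rho> lam L t f \<sigma> = (\<Sum>n. t ^ n / fact n * (generator \<rho> lam L ^^ n) f \<sigma>)"

definition chain_law :: "real \<Rightarrow> real \<Rightarrow> nat \<Rightarrow> real \<Rightarrow> nat set \<Rightarrow> nat set \<Rightarrow> real" where
  "chain_law \<rho> lam L t \<sigma> \<eta> = semigroup_op \<rho> lam L t (indicator {\<eta>}) \<sigma>"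

definition tv_dist :: "nat \<Rightarrow> (nat set \<Rightarrow> real) \<Rightarrow> (nat set \<Rightarrow> real) \<Rightarrow> real" where
  "tv_dist L \<mu> \<nu> = 1/2 * (\<Sum>\<eta>\<in>configs L. \<bar>\<mu> \<eta> - \<nu> \<eta>\<bar>)"

definition T_mix :: "real \<Rightarrow> real \<Rightarrow> nat \<Rightarrow> real" where
  "T_mix \<rho> lam L =
     Inf {t. t \<ge> 0 \<and>
             (SUP \<sigma>\<in>configs L. tv_dist L (chain_law \<rho> lam L t \<sigma>) (gibbs \<rho> lam L))
               \<le> 1 / (2 * exp 1)}"

definition dirichlet_form :: "real \<Rightarrow> real \<Rightarrow> nat \<Rightarrow> (nat set \<Rightarrow> real) \<Rightarrow> real" where
  "dirichlet_form \<rho> lam L f = - gibbs_mean \<rho> lam L (\<lambda>\<eta>. f \<eta> * generator \<rho> lam L f \<eta>)"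

definition spectral_gap :: "real \<Rightarrow> real \<Rightarrow> nat \<Rightarrow> real" where
  "spectral_gap \<rho> lam L =
     (INF f\<in>{f. \<not> f constant_on configs L}. dirichlet_form \<rho> lam L f / gibbs_var \<rho> lam L f)"

definition T_rel :: "real \<Rightarrow> real \<Rightarrow> nat \<Rightarrow> real" where
  "T_rel \<rho> lam L = 1 / spectral_gap \<rho> lam L"

lemma summable_renewal:
  assumes "\<rho> > 0"
  shows "summable (\<lambda>j. real (Suc j) powr - (1 + \<rho>))"
proof -
  have "summable (\<lambda>j. real j powr - (1 + \<rho>))"
    using assms by (subst summable_real_powr_iff) auto
  then show ?thesis by (subst summable_Suc_iff)
qed

lemma renewal_const_pos:
  assumes "\<rho> > 0"
  shows "renewal_const \<rho> > 0"
proof -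
  have "(\<Sum>j. real (Suc j) powr - (1 + \<rho>)) > 0"
    by (rule suminf_pos[OF summable_renewal[OF assms]]) auto
  then show ?thesis by (simp add: renewal_const_def)
qed

lemma renewal_K_sums:
  assumes "\<rho> > 0"
  shows "(\<lambda>j. renewal_K \<rho> (Suc j)) sums 1"
proof -
  have "(\<lambda>j. renewal_K \<rho> (Suc j)) sums
          (renewal_const \<rho> * (\<Sum>j. real (Suc j) powr - (1 + \<rho>)))"
    unfolding renewal_K_def by (intro sums_mult summable_sums summable_renewal assms)
  moreover have "renewal_const \<rho> * (\<Sum>j. real (Suc j) powr - (1 + \<rho>)) = 1"
    using renewal_const_pos[OF assms] by (auto simp: renewal_const_def)
  ultimately show ?thesis by simp
qed

lemma finite_configs: "finite (configs L)"
  by (rule finite_subset[of _ "Pow {0..L}"]) (auto simp: configs_def)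

lemma gibbs_nonneg:
  assumes "\<rho> > 0" "lam > 0"
  shows "gibbs \<rho> lam L \<eta> \<ge> 0"
proof -
  have K: "renewal_K \<rho> j \<ge> 0" for j
    using renewal_const_pos[OF assms(1)] by (simp add: renewal_K_def)
  have "weight \<rho> lam L \<eta> \<ge> 0" for \<eta>
    unfolding weight_def Let_def using assms(2) K
    by (intro mult_nonneg_nonneg prod_nonneg) auto
  then show ?thesis
    by (simp add: gibbs_def partition_fn_def sum_nonneg)
qed

lemma generator_bound:
  assumes "\<rho> > 0" "lam > 0" "B \<ge> 0" "\<And>\<xi>. \<xi> \<in> configs L \<Longrightarrow> \<bar>f \<xi>\<bar> \<le> B" "\<eta> \<in> configs L"
  shows "\<bar>generator \<rho> lam L f \<eta>\<bar> \<le> 2 * real L * B"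
proof -
  have hb: "\<bar>heat_bath \<rho> lam L x f \<eta>\<bar> \<le> B" for x
  proof -
    let ?D = "\<Sum>\<xi>\<in>agree_off L x \<eta>. gibbs \<rho> lam L \<xi>"
    have D: "?D \<ge> 0" by (intro sum_nonneg gibbs_nonneg assms)
    have "\<bar>\<Sum>\<xi>\<in>agree_off L x \<eta>. gibbs \<rho> lam L \<xi> * f \<xi>\<bar>
            \<le> (\<Sum>\<xi>\<in>agree_off L x \<eta>. gibbs \<rho> lam L \<xi> * B)"
    proof (rule sum_norm_le[where 'a=real, unfolded real_norm_def])
      fix \<xi> assume "\<xi> \<in> agree_off L x \<eta>"
      then have "\<bar>f \<xi>\<bar> \<le> B" using assms(4) by (auto simp: agree_off_def)
      then show "\<bar>gibbs \<rho> lam L \<xi> * f \<xi>\<bar> \<le> gibbs \<rho> lam L \<xi> * B"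
        using gibbs_nonneg[OF assms(1,2)] by (simp add: abs_mult mult_left_mono)
    qed
    then have "\<bar>\<Sum>\<xi>\<in>agree_off L x \<eta>. gibbs \<rho> lam L \<xi> * f \<xi>\<bar> \<le> B * ?D"
      by (simp add: sum_distrib_left mult.commute)
    then show ?thesis
      using D assms(3) by (cases "?D = 0") (auto simp: heat_bath_def abs_divide divide_le_eq)
  qed
  then have "\<bar>heat_bath \<rho> lam L x f \<eta> - f \<eta>\<bar> \<le> 2 * B" for x
    using hb[of x] assms(4)[OF assms(5)] by linarith
  then have "\<bar>generator \<rho> lam L f \<eta>\<bar> \<le> (\<Sum>x\<in>{0<..<L}. 2 * B)"
    unfolding generator_def
    by (intro sum_norm_le[where 'a=real, unfolded real_norm_def])
  also have "\<dots> = real (L - 1) * (2 * B)" by simp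
  also have "\<dots> \<le> real L * (2 * B)"
    using assms(3) by (intro mult_right_mono) auto
  finally show ?thesis by (simp add: mult_ac)
qed

lemma semigroup_op_summable:
  assumes "\<rho> > 0" "lam > 0" "\<sigma> \<in> configs L"
  shows "summable (\<lambda>n. t ^ n / fact n * (generator \<rho> lam L ^^ n) f \<sigma>)"
proof -
  define B where "B = (\<Sum>\<xi>\<in>configs L. \<bar>f \<xi>\<bar>)"
  have B: "B \<ge> 0" by (simp add: B_def sum_nonneg)
  have bound: "\<bar>(generator \<rho> lam L ^^ n) f \<eta>\<bar> \<le> (2 * real L) ^ n * B" if "\<eta> \<in> configs L" for n \<eta>
    using that
  proof (induction n arbitrary: \<eta>)
    case 0
    then show ?case
      using finite_configs by (auto simp: B_def intro: member_le_sum)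
  next
    case (Suc n)
    have "\<bar>generator \<rho> lam L ((generator \<rho> lam L ^^ n) f) \<eta>\<bar> \<le> 2 * real L * ((2 * real L) ^ n * B)"
      using assms Suc B by (intro generator_bound) auto
    then show ?case by (simp add: mult_ac)
  qed
  show ?thesis
  proof (rule summable_comparison_test')
    show "summable (\<lambda>n. B * ((\<bar>t\<bar> * (2 * real L)) ^ n / fact n))"
      using summable_exp[of "\<bar>t\<bar> * (2 * real L)"]
      by (intro summable_mult) (simp add: field_simps)
    fix n
    have "\<bar>t\<bar> ^ n / fact n * \<bar>(generator \<rho> lam L ^^ n) f \<sigma>\<bar>
            \<le> \<bar>t\<bar> ^ n / fact n * ((2 * real L) ^ n * B)"
      using bound[OF assms(3)] by (intro mult_left_mono) auto
    then show "norm (t ^ n / fact n * (generator \<rho> lam L ^^ n) f \<sigma>)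
                 \<le> B * ((\<bar>t\<bar> * (2 * real L)) ^ n / fact n)"
      by (simp add: abs_mult power_abs power_mult_distrib mult_ac)
  qed
qed

end

theory Submission
  imports Defs
begin

text \<open>
  Log-convexity of \<open>K\<close> makes the renewal mass function \<open>u\<close>, for which \<open>Z\<^sub>L = u L\<close>, decreasing.
  Together with \<open>(\<Sum>k\<le>n. u k * tail (n - k)) = 1\<close> this gives \<open>u n \<asymp> n\<^bsup>\<rho> - 1\<^esup>\<close> without a strong
  renewal theorem.

  Upper bounds: join two configurations by replacing one by the other site by site from left to
  right. A path has at most \<open>L\<close> steps, and averaging over the complementary configuration, rather
  than taking the worst case, bounds the congestion of each edge by \<open>L\<^sup>\<rho>\<close>. Hence the inverse gap
  is at most of order \<open>L\<^bsup>1 + \<rho>\<^esup>\<close>. The mixing time costs one more factor \<open>L\<close>, because every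
  configuration has probability at least \<open>exp (- c * L)\<close>.

  Lower bounds: the event that the middle half contains no particle has probability bounded away
  from 0 and 1, while its boundary, the event of exactly one particle there, has probability of
  order \<open>L\<^bsup>- \<rho>\<^esup>\<close>. The chain needs time of order \<open>L\<^sup>\<rho>\<close> to cross it.
\<close>

section \<open>The renewal mass function\<close>

text \<open>The step law \<open>K\<close> has infinite mean. For rho at most 1/2, tail asymptotics
  alone do not determine the pointwise size of the renewal mass, which is why its monotonicity is
  established before anything else: it turns bounds on partial sums into bounds on single terms.

  The exponent rho of the congestion arises where a long jump over the updated site costs about as
  much as the gap \<open>k\<close> already present, while the masses after its landing point still
  sum to order L^rho.

  The lower bound on the mixing time avoids spectral theory. The autocorrelation of an indicator has
  slope at least minus its Dirichlet energy, so it stays close to its initial value up to times of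
  the order of probability over energy, whereas a mixed chain has forgotten a fixed fraction of it.
  The same indicator, used as a test function, bounds the gap.\<close>

lemma powr_neg_diff_ge:
  fixes \<rho> :: real
  assumes "0 < \<rho>" "0 < x"
  shows "\<rho> * (x + 1) powr - (1 + \<rho>) \<le> x powr - \<rho> - (x + 1) powr - \<rho>"
proof -
  have "\<exists>z. x < z \<and> z < x + 1 \<and> (x + 1) powr - \<rho> - x powr - \<rho> = (x + 1 - x) * (- \<rho> * z powr (- \<rho> - 1))"
    by (rule MVT2) (use assms in \<open>auto intro!: derivative_eq_intros simp: powr_diff field_simps\<close>)
  then obtain z where z: "x < z" "z < x + 1"
      "(x + 1) powr - \<rho> - x powr - \<rho> = - \<rho> * z powr (- \<rho> - 1)" by auto
  have "(x + 1) powr (- \<rho> - 1) \<le> z powr (- \<rho> - 1)"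
    using z assms by (intro powr_mono2') auto
  then have "\<rho> * (x + 1) powr (- \<rho> - 1) \<le> \<rho> * z powr (- \<rho> - 1)"
    using assms by (intro mult_left_mono) auto
  moreover have "- (1 + \<rho>) = - \<rho> - 1" by simp
  ultimately show ?thesis using z(3) by (simp only: mult_minus_left)
qed

text \<open>Mean value theorem for the concave power x^(1 - rho). Its derivative blows up at 0, so
  \<open>x = 0\<close> is checked by hand; that case is the first term of the telescoping sum in
  \<open>sum_tail_le\<close>.\<close>

lemma powr_pos_diff_ge:
  fixes \<rho> :: real
  assumes "0 < \<rho>" "\<rho> < 1" "0 \<le> x"
  shows "(1 - \<rho>) * (x + 1) powr - \<rho> \<le> (x + 1) powr (1 - \<rho>) - x powr (1 - \<rho>)"
proof (cases "x = 0")
  case False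
  then have x: "x > 0" using assms by simp
  have "\<exists>z. x < z \<and> z < x + 1 \<and> (x + 1) powr (1 - \<rho>) - x powr (1 - \<rho>) = (x + 1 - x) * ((1 - \<rho>) * z powr (- \<rho>))"
  proof (rule MVT2)
    fix y assume "x \<le> y"
    then have "y > 0" using x by simp
    then show "((\<lambda>x. x powr (1 - \<rho>)) has_real_derivative (1 - \<rho>) * y powr - \<rho>) (at y)"
      using has_real_derivative_powr[of y "1 - \<rho>"] by simp
  qed simp
  then obtain z where z: "x < z" "z < x + 1"
      "(x + 1) powr (1 - \<rho>) - x powr (1 - \<rho>) = (1 - \<rho>) * z powr (- \<rho>)" by auto
  have "(x + 1) powr (- \<rho>) \<le> z powr (- \<rho>)"
    using z assms x by (intro powr_mono2') auto
  then have "(1 - \<rho>) * (x + 1) powr (- \<rho>) \<le> (1 - \<rho>) * z powr (- \<rho>)"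
    using assms by (intro mult_left_mono) auto
  then show ?thesis using z(3) by simp
qed (use assms in auto)

locale pinning =
  fixes \<rho> :: real
  assumes rho_pos: "0 < \<rho>" and rho_less_1: "\<rho> < 1"
begin

abbreviation "K \<equiv> renewal_K \<rho>"

abbreviation "cK \<equiv> renewal_const \<rho>"

definition tail :: "nat \<Rightarrow> real" where
  "tail n = (\<Sum>i. K (Suc n + i))"

text \<open>The probability that a renewal process started at 0 with step law \<open>K\<close>
  visits \<open>n\<close>. The recursion conditions on the last renewal before
  \<open>Suc n\<close>.\<close>

fun renewal_mass :: "nat \<Rightarrow> real" where
  "renewal_mass 0 = 1"
| "renewal_mass (Suc n) = (\<Sum>k\<le>n. renewal_mass k * K (Suc n - k))"

declare renewal_mass.simps(2) [simp del]

lemma cK_pos: "cK > 0"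
  using renewal_const_pos rho_pos by blast

lemma K_nonneg: "K j \<ge> 0"
  using cK_pos by (simp add: renewal_K_def)

lemma K_pos: "j > 0 \<Longrightarrow> K j > 0"
  using cK_pos by (simp add: renewal_K_def)

lemma K_antimono: "0 < i \<Longrightarrow> i \<le> j \<Longrightarrow> K j \<le> K i"
  using cK_pos rho_pos unfolding renewal_K_def
  by (intro mult_left_mono powr_mono2') auto

lemma summable_K: "summable (\<lambda>i. K (Suc n + i))"
  using summable_ignore_initial_segment[OF sums_summable[OF renewal_K_sums[OF rho_pos]], of n]
  by (simp add: add.commute)

lemma tail_0: "tail 0 = 1"
  using sums_unique[OF renewal_K_sums[OF rho_pos]] by (simp add: tail_def)

lemma tail_Suc: "tail n = K (Suc n) + tail (Suc n)"
  using suminf_split_head[OF summable_K[of n]] by (simp add: tail_def)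

lemma tail_pos: "tail n > 0"
  unfolding tail_def by (intro suminf_pos summable_K K_pos) auto

lemma tail_antimono: "m \<le> n \<Longrightarrow> tail n \<le> tail m"
proof (rule lift_Suc_antimono_le[of tail])
  fix k show "tail (Suc k) \<le> tail k"
    using tail_Suc[of k] K_nonneg[of "Suc k"] by linarith
qed

lemma sum_K_le_tail: "(\<Sum>j=Suc k..k + m. K j) \<le> tail k"
proof -
  have "(\<Sum>j=Suc k..k + m. K j) + tail (k + m) = tail k"
  proof (induction m)
    case (Suc m)
    then show ?case using tail_Suc[of "k + m"] by simp
  qed simp
  then show ?thesis using tail_pos[of "k + m"] by linarith
qed

text \<open>Both pairs of arguments have the same sum, and the pair \<open>n\<close>,
  \<open>Suc n + i\<close> lies at least as far apart, so its product is the smaller one. The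
  negative power reverses the inequality.\<close>

lemma K_log_convex:
  assumes "0 < n"
  shows "K (Suc n) * K (n + i) \<le> K n * K (Suc n + i)"
proof -
  have "real n * real (Suc n + i) \<le> real (Suc n) * real (n + i)"
    by (simp add: algebra_simps)
  then have "(real (Suc n) * real (n + i)) powr - (1 + \<rho>) \<le> (real n * real (Suc n + i)) powr - (1 + \<rho>)"
    using assms rho_pos by (intro powr_mono2') auto
  then have "real (Suc n) powr - (1 + \<rho>) * real (n + i) powr - (1 + \<rho>)
      \<le> real n powr - (1 + \<rho>) * real (Suc n + i) powr - (1 + \<rho>)"
    by (simp add: powr_mult)
  then have "(cK * cK) * (real (Suc n) powr - (1 + \<rho>) * real (n + i) powr - (1 + \<rho>))
      \<le> (cK * cK) * (real n powr - (1 + \<rho>) * real (Suc n + i) powr - (1 + \<rho>))"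
    using cK_pos by (intro mult_left_mono) auto
  then show ?thesis by (simp add: renewal_K_def mult_ac)
qed

text \<open>Summing log-convexity of \<open>K\<close> over \<open>i\<close> compares
  \<open>K (n+2) * tail (n+1)\<close> with \<open>K (n+1) * tail (n+2)\<close>. Adding
  \<open>tail (n+1) * tail (n+2)\<close> to both sides completes the products.\<close>

lemma tail_log_convex: "tail (Suc n) * tail (Suc n) \<le> tail n * tail (Suc (Suc n))"
proof -
  have "K (Suc (Suc n)) * tail (Suc n) = (\<Sum>i. K (Suc (Suc n)) * K (Suc (Suc n) + i))"
    unfolding tail_def using summable_K[of "Suc n"] by (rule suminf_mult[symmetric])
  also have "\<dots> \<le> (\<Sum>i. K (Suc n) * K (Suc (Suc (Suc n)) + i))"
  proof (rule suminf_le)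
    fix i
    show "K (Suc (Suc n)) * K (Suc (Suc n) + i) \<le> K (Suc n) * K (Suc (Suc (Suc n)) + i)"
      using K_log_convex[of "Suc n" "Suc i"] by simp
  qed (intro summable_mult summable_K)+
  also have "\<dots> = K (Suc n) * tail (Suc (Suc n))"
    unfolding tail_def using summable_K[of "Suc (Suc n)"] by (rule suminf_mult)
  finally have "K (Suc (Suc n)) * tail (Suc n) \<le> K (Suc n) * tail (Suc (Suc n))" .
  then show ?thesis using tail_Suc[of n] tail_Suc[of "Suc n"] by (simp add: algebra_simps)
qed

lemma tail_ratio_mono:
  assumes "m \<le> n"
  shows "tail (Suc m) / tail m \<le> tail (Suc n) / tail n"
  by (rule lift_Suc_mono_le[of "\<lambda>m. tail (Suc m) / tail m", OF _ assms])
     (use tail_log_convex tail_pos in \<open>simp add: divide_simps less_imp_neq[THEN not_sym] mult.commute\<close>)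

lemma renewal_mass_nonneg: "renewal_mass n \<ge> 0"
proof (induction n rule: less_induct)
  case (less n)
  then show ?case
    by (cases n) (auto simp: renewal_mass.simps(2) intro!: sum_nonneg mult_nonneg_nonneg K_nonneg)
qed

text \<open>The summands are the probabilities that \<open>k\<close> is the last renewal not
  exceeding \<open>n\<close>: the process visits \<open>k\<close> and its next step is longer than
  \<open>n - k\<close>.\<close>

lemma renewal_mass_convolution_tail: "(\<Sum>k\<le>n. renewal_mass k * tail (n - k)) = 1"
proof (induction n)
  case (Suc n)
  have "(\<Sum>k\<le>Suc n. renewal_mass k * tail (Suc n - k))
      = (\<Sum>k\<le>n. renewal_mass k * tail (Suc n - k)) + renewal_mass (Suc n)"
    by (simp add: tail_0)
  also have "(\<Sum>k\<le>n. renewal_mass k * tail (Suc n - k))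
      = (\<Sum>k\<le>n. renewal_mass k * tail (n - k) - renewal_mass k * K (Suc n - k))"
  proof (rule sum.cong)
    fix k assume "k \<in> {..n}"
    then have "Suc n - k = Suc (n - k)" by auto
    then show "renewal_mass k * tail (Suc n - k) = renewal_mass k * tail (n - k) - renewal_mass k * K (Suc n - k)"
      using tail_Suc[of "n - k"] by (simp add: algebra_simps)
  qed simp
  also have "\<dots> = 1 - renewal_mass (Suc n)"
    using Suc by (simp add: sum_subtractf renewal_mass.simps(2))
  finally show ?case by simp
qed (simp add: tail_0)

text \<open>
  Kaluza's argument: the decrements of the renewal mass function are the coefficients of the
  quotient of the shifted tail by the tail, and these are nonnegative because the tail is
  log-convex.
\<close>

lemma renewal_mass_Suc_le: "renewal_mass (Suc n) \<le> renewal_mass n"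
proof -
  define d where "d n = renewal_mass n - renewal_mass (Suc n)" for n
  have conv: "(\<Sum>k\<le>n. d k * tail (n - k)) = tail (Suc n)" for n
  proof -
    have "(\<Sum>k\<le>Suc n. renewal_mass k * tail (Suc n - k))
        = tail (Suc n) + (\<Sum>k\<le>n. renewal_mass (Suc k) * tail (n - k))"
      by (subst sum.atMost_Suc_shift) simp
    then show ?thesis
      unfolding d_def using renewal_mass_convolution_tail[of n] renewal_mass_convolution_tail[of "Suc n"]
      by (simp add: left_diff_distrib sum_subtractf)
  qed
  have "d n \<ge> 0"
  proof (induction n rule: less_induct)
    case (less n)
    show ?case
    proof (cases n)
      case 0
      then show ?thesis using conv[of 0] tail_pos[of 1] by (simp add: tail_0)
    next
      case (Suc m)
      have "d n = tail (Suc n) - (\<Sum>k\<le>m. d k * tail (n - k))"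
        using conv[of n] Suc by (simp add: tail_0)
      \<comment> \<open>The identity \<open>conv\<close> at \<open>m\<close> has value
        \<open>tail n\<close>. Rescaling it to \<open>tail (Suc n)\<close> allows a termwise
        subtraction from \<open>conv\<close> at \<open>n\<close>, after which the ratios of
        consecutive tails decide the sign.\<close>
      also have "tail (Suc n) = tail (Suc n) / tail n * (\<Sum>k\<le>m. d k * tail (m - k))"
        using conv[of m] Suc tail_pos[of n] by simp
      also have "\<dots> - (\<Sum>k\<le>m. d k * tail (n - k))
          = (\<Sum>k\<le>m. d k * (tail (Suc n) / tail n * tail (m - k) - tail (n - k)))"
        by (simp add: sum_distrib_left sum_subtractf algebra_simps)
      also have "\<dots> \<ge> 0"
      proof (intro sum_nonneg mult_nonneg_nonneg)
        fix k assume "k \<in> {..m}"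
        then have k: "n - k = Suc (m - k)" "k < n" using Suc by auto
        show "0 \<le> d k" using less k by simp
        have "tail (Suc (m - k)) / tail (m - k) \<le> tail (Suc n) / tail n"
          by (rule tail_ratio_mono) (use Suc in simp)
        then have "tail (Suc (m - k)) / tail (m - k) * tail (m - k) \<le> tail (Suc n) / tail n * tail (m - k)"
          using tail_pos[of "m - k"] by (intro mult_right_mono) auto
        then show "0 \<le> tail (Suc n) / tail n * tail (m - k) - tail (n - k)"
          using k(1) tail_pos[of "m - k"] by simp
      qed
      finally show ?thesis by simp
    qed
  qed
  then show ?thesis by (simp add: d_def)
qed

lemma renewal_mass_antimono: "m \<le> n \<Longrightarrow> renewal_mass n \<le> renewal_mass m"
  by (rule lift_Suc_antimono_le[of renewal_mass]) (simp add: renewal_mass_Suc_le)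

section \<open>Power bounds for the tail, the renewal function and the renewal mass\<close>

lemma tail_ge: "cK * 2 powr - (1 + \<rho>) * real (Suc n) powr - \<rho> \<le> tail n"
proof -
  have "cK * 2 powr - (1 + \<rho>) * real (Suc n) powr - \<rho>
      = real (Suc n) * K (2 * Suc n)"
  proof -
    have "real (Suc n) * real (Suc n) powr - (1 + \<rho>) = real (Suc n) powr - \<rho>"
      using powr_add[of "real (Suc n)" 1 "- (1 + \<rho>)"] by simp
    then show ?thesis
      unfolding renewal_K_def of_nat_mult by (subst powr_mult) auto
  qed
  also have "\<dots> = (\<Sum>j=Suc n..n + Suc n. K (2 * Suc n))" by simp
  also have "\<dots> \<le> (\<Sum>j=Suc n..n + Suc n. K j)"
    by (intro sum_mono K_antimono) auto
  also have "\<dots> \<le> tail n" by (rule sum_K_le_tail)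
  finally show ?thesis .
qed

text \<open>The power of 2 pays for replacing \<open>x\<close> by \<open>x + 1\<close>, which is at
  most \<open>2 * x\<close>; the factor \<open>1 / \<rho>\<close> comes from the telescoping
  comparison with x^(-rho).\<close>

definition "tail_upper = cK * 2 powr (1 + \<rho>) / \<rho>"

lemma tail_upper_pos: "tail_upper > 0"
  using cK_pos rho_pos by (simp add: tail_upper_def)

lemma tail_le: "tail n \<le> tail_upper * real (Suc n) powr - \<rho>"
proof -
  have lim: "(\<lambda>i. real (Suc n + i) powr - \<rho>) \<longlonglongrightarrow> 0"
  proof (rule tendsto_neg_powr)
    show "filterlim (\<lambda>i. real (Suc n + i)) at_top sequentially"
      by (rule filterlim_compose[OF filterlim_real_sequentially])
         (rule filterlim_subseq, simp add: strict_mono_def)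
  qed (use rho_pos in simp)
  have "tail n \<le> (\<Sum>i. tail_upper * (real (Suc n + i) powr - \<rho> - real (Suc n + Suc i) powr - \<rho>))"
    unfolding tail_def
  proof (rule suminf_le)
    fix i
    define x where "x = real (Suc n + i)"
    have x: "x \<ge> 1" by (simp add: x_def)
    have "x powr - (1 + \<rho>) = 2 powr (1 + \<rho>) * (2 * x) powr - (1 + \<rho>)"
      using x powr_add[of 2 "1 + \<rho>" "- (1 + \<rho>)"] by (simp add: powr_mult)
    also have "(2 * x) powr - (1 + \<rho>) \<le> (x + 1) powr - (1 + \<rho>)"
      using x rho_pos by (intro powr_mono2') auto
    also have "(x + 1) powr - (1 + \<rho>) \<le> (x powr - \<rho> - (x + 1) powr - \<rho>) / \<rho>"
      using powr_neg_diff_ge[of \<rho> x] x rho_pos by (simp add: pos_le_divide_eq mult.commute)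
    finally have "x powr - (1 + \<rho>) \<le> 2 powr (1 + \<rho>) * ((x powr - \<rho> - (x + 1) powr - \<rho>) / \<rho>)" by simp
    then have "cK * x powr - (1 + \<rho>) \<le> cK * (2 powr (1 + \<rho>) * ((x powr - \<rho> - (x + 1) powr - \<rho>) / \<rho>))"
      using cK_pos by (intro mult_left_mono) auto
    then show "K (Suc n + i) \<le> tail_upper * (real (Suc n + i) powr - \<rho> - real (Suc n + Suc i) powr - \<rho>)"
      unfolding x_def renewal_K_def tail_upper_def by (simp only: of_nat_Suc of_nat_add add_ac times_divide_eq_left times_divide_eq_right mult_ac add_Suc_right)
  next
    show "summable (\<lambda>i. K (Suc n + i))" by (rule summable_K)
    show "summable (\<lambda>i. tail_upper * (real (Suc n + i) powr - \<rho> - real (Suc n + Suc i) powr - \<rho>))"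
      by (intro summable_mult sums_summable[OF telescope_sums'[OF lim]])
  qed
  also have "\<dots> = tail_upper * (real (Suc n + 0) powr - \<rho> - 0)"
    by (intro sums_unique[symmetric] sums_mult telescope_sums'[OF lim])
  also have "\<dots> = tail_upper * real (Suc n) powr - \<rho>" by simp
  finally show ?thesis .
qed

definition renewal_fn :: "nat \<Rightarrow> real" where
  "renewal_fn n = (\<Sum>k\<le>n. renewal_mass k)"

text \<open>In the convolution identity every tail is at least \<open>tail n\<close>, hence
  \<open>renewal_fn n * tail n \<le> 1\<close>.\<close>

lemma renewal_fn_le: "\<exists>C>0. \<forall>n. renewal_fn n \<le> C * real (Suc n) powr \<rho>"
proof (intro exI conjI allI)
  let ?c = "cK * 2 powr - (1 + \<rho>)"
  show "0 < 1 / ?c" using cK_pos by simp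
  fix n
  have "renewal_fn n * tail n \<le> (\<Sum>k\<le>n. renewal_mass k * tail (n - k))"
    unfolding renewal_fn_def sum_distrib_right
    by (intro sum_mono mult_left_mono tail_antimono renewal_mass_nonneg) auto
  then have "renewal_fn n * tail n \<le> 1" by (simp add: renewal_mass_convolution_tail)
  moreover have "renewal_fn n * (?c * real (Suc n) powr - \<rho>) \<le> renewal_fn n * tail n"
    by (intro mult_left_mono tail_ge) (simp add: renewal_fn_def sum_nonneg renewal_mass_nonneg)
  ultimately have "renewal_fn n * (?c * real (Suc n) powr - \<rho>) \<le> 1" by linarith
  then have "renewal_fn n * ?c / real (Suc n) powr \<rho> \<le> 1"
    by (simp add: powr_minus field_simps)
  then have "renewal_fn n * ?c \<le> real (Suc n) powr \<rho>" by (simp add: divide_le_eq)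
  then show "renewal_fn n \<le> 1 / ?c * real (Suc n) powr \<rho>"
    using cK_pos by (simp add: field_simps)
qed

lemma sum_tail_le: "(\<Sum>i\<le>n. tail i) \<le> tail_upper / (1 - \<rho>) * real (Suc n) powr (1 - \<rho>)"
proof -
  have "(\<Sum>i\<le>n. tail i) \<le> (\<Sum>i\<le>n. tail_upper / (1 - \<rho>) * (real (Suc i) powr (1 - \<rho>) - real i powr (1 - \<rho>)))"
  proof (rule sum_mono)
    fix i
    have "real (Suc i) powr - \<rho> \<le> (real (Suc i) powr (1 - \<rho>) - real i powr (1 - \<rho>)) / (1 - \<rho>)"
      using powr_pos_diff_ge[of \<rho> "real i"] rho_pos rho_less_1 by (simp add: field_simps)
    then have "tail_upper * real (Suc i) powr - \<rho>
        \<le> tail_upper * ((real (Suc i) powr (1 - \<rho>) - real i powr (1 - \<rho>)) / (1 - \<rho>))"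
      using tail_upper_pos by (intro mult_left_mono) auto
    then show "tail i \<le> tail_upper / (1 - \<rho>) * (real (Suc i) powr (1 - \<rho>) - real i powr (1 - \<rho>))"
      using tail_le[of i] by simp
  qed
  also have "\<dots> = tail_upper / (1 - \<rho>) * (\<Sum>i\<le>n. real (Suc i) powr (1 - \<rho>) - real i powr (1 - \<rho>))"
    by (simp add: sum_distrib_left)
  also have "(\<Sum>i\<le>n. real (Suc i) powr (1 - \<rho>) - real i powr (1 - \<rho>)) = real (Suc n) powr (1 - \<rho>)"
    by (induction n) auto
  finally show ?thesis .
qed

text \<open>The convolution identities up to \<open>n\<close> are added. Enlarging the triangle of
  index pairs to a square makes the double sum factor into \<open>renewal_fn n\<close> and a sum of
  tails of order n^(1 - rho).\<close>

lemma renewal_fn_ge: "\<exists>c>0. \<forall>n. c * real (Suc n) powr \<rho> \<le> renewal_fn n"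
proof (intro exI conjI allI)
  let ?c = "tail_upper / (1 - \<rho>)"
  have c: "?c > 0" using tail_upper_pos rho_less_1 by simp
  then show "0 < 1 / ?c" by (rule divide_pos_pos[OF zero_less_one])
  fix n
  have "real (Suc n) = (\<Sum>m\<le>n. \<Sum>k\<le>m. renewal_mass k * tail (m - k))"
    by (simp add: renewal_mass_convolution_tail)
  also have "\<dots> = (\<Sum>(k, i)\<in>{(k, i). k + i \<le> n}. renewal_mass k * tail i)"
    by (rule sum.triangle_reindex_eq[symmetric])
  also have "\<dots> \<le> (\<Sum>(k, i)\<in>{..n} \<times> {..n}. renewal_mass k * tail i)"
    by (intro sum_mono2) (auto intro!: mult_nonneg_nonneg renewal_mass_nonneg less_imp_le[OF tail_pos])
  also have "\<dots> = renewal_fn n * (\<Sum>i\<le>n. tail i)"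
    by (simp add: renewal_fn_def sum_product sum.cartesian_product)
  also have "\<dots> \<le> renewal_fn n * (?c * real (Suc n) powr (1 - \<rho>))"
    by (intro mult_left_mono sum_tail_le) (simp add: renewal_fn_def sum_nonneg renewal_mass_nonneg)
  finally have "real (Suc n) \<le> renewal_fn n * ?c * real (Suc n) powr (1 - \<rho>)" by (simp add: mult_ac)
  then have "real (Suc n) powr \<rho> * real (Suc n) powr (1 - \<rho>) \<le> renewal_fn n * ?c * real (Suc n) powr (1 - \<rho>)"
    by (simp flip: powr_add)
  then have "real (Suc n) powr \<rho> \<le> renewal_fn n * ?c"
    by (rule mult_right_le_imp_le) simp
  then show "1 / ?c * real (Suc n) powr \<rho> \<le> renewal_fn n"
    using c by (metis mult.commute mult_1 pos_divide_le_eq times_divide_eq_left)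
qed

lemma renewal_mass_le: "\<exists>C>0. \<forall>n. renewal_mass n \<le> C * real (Suc n) powr (\<rho> - 1)"
proof -
  obtain C where C: "C > 0" "\<And>n. renewal_fn n \<le> C * real (Suc n) powr \<rho>"
    using renewal_fn_le by blast
  have "renewal_mass n \<le> C * real (Suc n) powr (\<rho> - 1)" for n
  proof -
    have "real (Suc n) * renewal_mass n = (\<Sum>k\<le>n. renewal_mass n)" by simp
    also have "\<dots> \<le> renewal_fn n"
      unfolding renewal_fn_def by (intro sum_mono renewal_mass_antimono) auto
    also have "\<dots> \<le> C * real (Suc n) powr \<rho>" by (rule C)
    finally show ?thesis by (simp add: powr_diff field_simps)
  qed
  then show ?thesis using C(1) by blast
qed

text \<open>A monotone density argument: between \<open>n\<close> and a fixed multiple of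
  \<open>Suc n\<close> the renewal function must grow, and by monotonicity each increment there is
  at most \<open>renewal_mass n\<close>.\<close>

lemma renewal_mass_ge: "\<exists>c>0. \<forall>n. c * real (Suc n) powr (\<rho> - 1) \<le> renewal_mass n"
proof -
  obtain C where C: "C > 0" "\<And>n. renewal_fn n \<le> C * real (Suc n) powr \<rho>"
    using renewal_fn_le by blast
  obtain c where c: "c > 0" "\<And>n. c * real (Suc n) powr \<rho> \<le> renewal_fn n"
    using renewal_fn_ge by blast
  \<comment> \<open>Chosen so that \<open>c * M powr \<rho>\<close> is at least
    \<open>C + 1\<close>. The lower bound at \<open>M * Suc n\<close> then exceeds the upper bound
    at \<open>n\<close> by \<open>real (Suc n) powr \<rho>\<close>.\<close>
  define M where "M = Suc (nat \<lceil>((C + 1) / c) powr (1 / \<rho>)\<rceil>)"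
  have "((C + 1) / c) powr (1 / \<rho>) \<le> real M"
    unfolding M_def by linarith
  then have "(((C + 1) / c) powr (1 / \<rho>)) powr \<rho> \<le> real M powr \<rho>"
    using rho_pos by (intro powr_mono2) auto
  then have "(C + 1) / c \<le> real M powr \<rho>"
    using rho_pos C c by (simp add: powr_powr)
  then have M: "C + 1 \<le> c * real M powr \<rho>" "M > 0"
    using c by (auto simp: field_simps M_def)
  have "1 / real M * real (Suc n) powr (\<rho> - 1) \<le> renewal_mass n" for n
  proof -
    define N where "N = M * Suc n"
    have N: "n < N" unfolding N_def using M(2) by (cases M) auto
    have "(C + 1) * real (Suc n) powr \<rho> \<le> c * real M powr \<rho> * real (Suc n) powr \<rho>"
      using M by (intro mult_right_mono) auto
    also have "\<dots> = c * real N powr \<rho>" unfolding N_def of_nat_mult by (subst powr_mult) simp_all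
    also have "\<dots> \<le> c * real (Suc N) powr \<rho>"
      using c rho_pos by (intro mult_left_mono powr_mono2) auto
    also have "\<dots> \<le> renewal_fn N" by (rule c)
    also have "renewal_fn N = renewal_fn n + (\<Sum>k\<in>{n<..N}. renewal_mass k)"
      unfolding renewal_fn_def using N
      by (subst sum.union_disjoint[symmetric]) (auto intro!: sum.cong)
    also have "(\<Sum>k\<in>{n<..N}. renewal_mass k) \<le> (\<Sum>k\<in>{n<..N}. renewal_mass n)"
      by (intro sum_mono renewal_mass_antimono) auto
    also have "\<dots> = real (N - n) * renewal_mass n" by simp
    also have "\<dots> \<le> real N * renewal_mass n"
      by (intro mult_right_mono renewal_mass_nonneg) auto
    finally have "(C + 1) * real (Suc n) powr \<rho> \<le> C * real (Suc n) powr \<rho> + real N * renewal_mass n"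
      using C(2)[of n] by linarith
    then have "real (Suc n) powr \<rho> \<le> real M * real (Suc n) * renewal_mass n"
      by (simp add: algebra_simps N_def)
    then show ?thesis
      using M(2) by (simp add: powr_diff pos_divide_le_eq mult_ac)
  qed
  then show ?thesis using M(2) by (intro exI[of _ "1 / real M"]) auto
qed

lemma renewal_mass_pos: "renewal_mass n > 0"
proof -
  obtain c where "c > 0" "c * real (Suc n) powr (\<rho> - 1) \<le> renewal_mass n"
    using renewal_mass_ge by blast
  moreover have "c * real (Suc n) powr (\<rho> - 1) > 0" using \<open>c > 0\<close> by simp
  ultimately show ?thesis by linarith
qed

end

section \<open>Weights of configurations\<close>

definition span_sets :: "nat \<Rightarrow> nat \<Rightarrow> nat set set" where
  "span_sets a b = {S. S \<subseteq> {a..b} \<and> a \<in> S \<and> b \<in> S}"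

definition left_parts :: "nat \<Rightarrow> nat set set" where
  "left_parts x = {A. A \<subseteq> {..<x} \<and> 0 \<in> A}"

definition right_parts :: "nat \<Rightarrow> nat \<Rightarrow> nat set set" where
  "right_parts x L = {B. B \<subseteq> {x<..L} \<and> L \<in> B}"

lemma configs_eq_span_sets: "configs L = span_sets 0 L"
  by (auto simp: configs_def span_sets_def)

lemma finite_span_sets [simp]: "finite (span_sets a b)"
  by (rule finite_subset[of _ "Pow {a..b}"]) (auto simp: span_sets_def)

lemma finite_left_parts [simp]: "finite (left_parts x)"
  by (rule finite_subset[of _ "Pow {..<x}"]) (auto simp: left_parts_def)

lemma finite_right_parts [simp]: "finite (right_parts x L)"
  by (rule finite_subset[of _ "Pow {x<..L}"]) (auto simp: right_parts_def)

lemma left_partsD: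
  assumes "A \<in> left_parts x"
  shows "finite A" "A \<noteq> {}" "0 \<in> A" "Max A < x" "\<And>a. a \<in> A \<Longrightarrow> a < x" "x \<notin> A"
proof -
  show *: "finite A" "A \<noteq> {}" "0 \<in> A" "\<And>a. a \<in> A \<Longrightarrow> a < x" "x \<notin> A"
    using assms by (auto simp: left_parts_def intro: finite_subset)
  show "Max A < x" using * by simp
qed

lemma right_partsD:
  assumes "B \<in> right_parts x L"
  shows "finite B" "B \<noteq> {}" "L \<in> B" "x < Min B" "Min B \<le> L" "\<And>b. b \<in> B \<Longrightarrow> x < b"
    "\<And>b. b \<in> B \<Longrightarrow> b \<le> L" "x \<notin> B" "x < L"
proof -
  show *: "finite B" "B \<noteq> {}" "L \<in> B" "\<And>b. b \<in> B \<Longrightarrow> x < b" "\<And>b. b \<in> B \<Longrightarrow> b \<le> L" "x \<notin> B"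
    using assms by (auto simp: right_parts_def intro: finite_subset)
  show "x < Min B" "Min B \<le> L" "x < L" using * by auto
qed

lemma left_parts_eq: "left_parts x = (\<Union>a\<in>{..<x}. span_sets 0 a)"
proof (intro equalityI subsetI)
  fix A assume A: "A \<in> left_parts x"
  note left_partsD[OF A]
  then show "A \<in> (\<Union>a\<in>{..<x}. span_sets 0 a)"
    by (intro UN_I[of "Max A"]) (auto simp: span_sets_def)
qed (auto simp: left_parts_def span_sets_def)

lemma right_parts_eq: "right_parts x L = (\<Union>c\<in>{x<..L}. span_sets c L)"
proof (intro equalityI subsetI)
  fix B assume B: "B \<in> right_parts x L"
  note right_partsD[OF B]
  then show "B \<in> (\<Union>c\<in>{x<..L}. span_sets c L)"
    by (intro UN_I[of "Min B"]) (auto simp: span_sets_def)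
qed (auto simp: right_parts_def span_sets_def)

lemma span_setsD:
  assumes "S \<in> span_sets a b"
  shows "finite S" "S \<noteq> {}" "Min S = a" "Max S = b"
proof -
  show *: "finite S" "S \<noteq> {}" using assms by (auto simp: span_sets_def intro: finite_subset)
  show "Min S = a" "Max S = b"
    using assms * by (auto simp: span_sets_def intro!: Min_eqI Max_eqI)
qed

lemma sum_left_parts: "(\<Sum>A\<in>left_parts x. F A) = (\<Sum>a<x. \<Sum>S\<in>span_sets 0 a. F S)"
  unfolding left_parts_eq by (rule sum.UNION_disjoint) (auto dest!: span_setsD(4))

lemma sum_right_parts: "(\<Sum>B\<in>right_parts x L. F B) = (\<Sum>c\<in>{x<..L}. \<Sum>S\<in>span_sets c L. F S)"
  unfolding right_parts_eq by (rule sum.UNION_disjoint) (auto dest!: span_setsD(3))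

text \<open>Configurations are grouped into pairs that differ only at \<open>x\<close>. These pairs
  are the edges of the chain at site \<open>x\<close>, so the same decomposition enumerates states
  and transitions.\<close>

lemma sum_configs_split:
  fixes F :: "nat set \<Rightarrow> 'a::comm_monoid_add"
  assumes "0 < x" "x < L"
  shows "(\<Sum>\<eta>\<in>configs L. F \<eta>)
    = (\<Sum>A\<in>left_parts x. \<Sum>B\<in>right_parts x L. F (A \<union> B) + F (insert x (A \<union> B)))"
proof -
  have "(\<Sum>\<eta>\<in>configs L. F \<eta>) = (\<Sum>\<eta>\<in>{\<eta>\<in>configs L. x \<notin> \<eta>}. F \<eta>) + (\<Sum>\<eta>\<in>{\<eta>\<in>configs L. x \<in> \<eta>}. F \<eta>)"
    by (subst sum.union_disjoint[symmetric]) (auto intro!: sum.cong finite_subset[OF _ finite_configs])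
  also have "(\<Sum>\<eta>\<in>{\<eta>\<in>configs L. x \<notin> \<eta>}. F \<eta>) = (\<Sum>(A, B)\<in>left_parts x \<times> right_parts x L. F (A \<union> B))"
  proof (rule sum.reindex_bij_witness[of _ "\<lambda>(A, B). A \<union> B" "\<lambda>\<eta>. (\<eta> \<inter> {..<x}, \<eta> \<inter> {x<..L})"])
    fix \<eta> assume "\<eta> \<in> {\<eta>\<in>configs L. x \<notin> \<eta>}"
    then have *: "\<eta> \<inter> {..<x} \<union> \<eta> \<inter> {x<..L} = \<eta>"
      by (force simp: configs_def intro: linorder_neqE_nat)
    then show "(case (\<eta> \<inter> {..<x}, \<eta> \<inter> {x<..L}) of (A, B) \<Rightarrow> A \<union> B) = \<eta>"
      "(case (\<eta> \<inter> {..<x}, \<eta> \<inter> {x<..L}) of (A, B) \<Rightarrow> F (A \<union> B)) = F \<eta>" by simp_all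
  qed (use assms in \<open>auto simp: left_parts_def right_parts_def configs_def dest: subsetD\<close>)
  also have "(\<Sum>\<eta>\<in>{\<eta>\<in>configs L. x \<in> \<eta>}. F \<eta>) = (\<Sum>(A, B)\<in>left_parts x \<times> right_parts x L. F (insert x (A \<union> B)))"
  proof (rule sum.reindex_bij_witness[of _ "\<lambda>(A, B). insert x (A \<union> B)" "\<lambda>\<eta>. (\<eta> \<inter> {..<x}, \<eta> \<inter> {x<..L})"])
    fix \<eta> assume "\<eta> \<in> {\<eta>\<in>configs L. x \<in> \<eta>}"
    then have *: "insert x (\<eta> \<inter> {..<x} \<union> \<eta> \<inter> {x<..L}) = \<eta>"
      by (force simp: configs_def intro: linorder_neqE_nat)
    then show "(case (\<eta> \<inter> {..<x}, \<eta> \<inter> {x<..L}) of (A, B) \<Rightarrow> insert x (A \<union> B)) = \<eta>"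
      "(case (\<eta> \<inter> {..<x}, \<eta> \<inter> {x<..L}) of (A, B) \<Rightarrow> F (insert x (A \<union> B))) = F \<eta>" by simp_all
  qed (use assms in \<open>auto simp: left_parts_def right_parts_def configs_def dest: subsetD\<close>)
  finally show ?thesis by (simp add: sum.cartesian_product sum.distrib split_def)
qed

lemma sorted_list_of_set_Un:
  fixes A B :: "nat set"
  assumes "finite A" "finite B" "\<And>a b. a \<in> A \<Longrightarrow> b \<in> B \<Longrightarrow> a < b"
  shows "sorted_list_of_set (A \<union> B) = sorted_list_of_set A @ sorted_list_of_set B"
proof (rule sorted_distinct_set_unique)
  show "sorted (sorted_list_of_set A @ sorted_list_of_set B)"
    using assms by (auto simp: sorted_append intro: less_imp_le)
  show "distinct (sorted_list_of_set A @ sorted_list_of_set B)"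
    using assms by fastforce
qed (use assms in auto)

lemma hd_sorted_list_of_set: "finite A \<Longrightarrow> A \<noteq> {} \<Longrightarrow> hd (sorted_list_of_set A) = Min A"
  by (simp add: sorted_list_of_set_nonempty)

lemma last_sorted_list_of_set:
  fixes A :: "nat set"
  assumes "finite A" "A \<noteq> {}"
  shows "last (sorted_list_of_set A) = Max A"
proof -
  have "A = (A - {Max A}) \<union> {Max A}" using Max_in[OF assms] by auto
  then have "sorted_list_of_set A = sorted_list_of_set ((A - {Max A}) \<union> {Max A})" by simp
  also have "\<dots> = sorted_list_of_set (A - {Max A}) @ sorted_list_of_set {Max A}"
    using assms by (intro sorted_list_of_set_Un) (auto simp: le_less dest: Max_ge)
  finally show ?thesis by simp
qed

context pinning
begin

section \<open>Weights as products over gaps, and their sums over blocks\<close>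

fun gap_product :: "nat list \<Rightarrow> real" where
  "gap_product (x # y # zs) = K (y - x) * gap_product (y # zs)"
| "gap_product zs = 1"

text \<open>Unlike the indexed product in \<open>weight\<close>, the recursive one splits under
  concatenation of lists and makes sense for any finite block of sites. There is no power of
  \<open>lam\<close>, since \<open>lam = 1\<close>.\<close>

definition set_weight :: "nat set \<Rightarrow> real" where
  "set_weight S = gap_product (sorted_list_of_set S)"

lemma gap_product_append:
  "xs \<noteq> [] \<Longrightarrow> ys \<noteq> [] \<Longrightarrow> gap_product (xs @ ys) = gap_product xs * K (hd ys - last xs) * gap_product ys"
proof (induction xs rule: gap_product.induct)
  case ("2_2" v)
  then show ?case by (cases ys) auto
qed auto

lemma gap_product_eq_prod:
  "zs \<noteq> [] \<Longrightarrow> gap_product zs = (\<Prod>j<length zs - 1. K (zs ! Suc j - zs ! j))"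
proof (induction zs rule: gap_product.induct)
  case (1 x y zs)
  then show ?case by (simp add: prod.lessThan_Suc_shift del: prod.lessThan_Suc)
qed auto

lemma gap_product_nonneg: "gap_product zs \<ge> 0"
  by (induction zs rule: gap_product.induct) (auto intro!: mult_nonneg_nonneg K_nonneg)

lemma set_weight_nonneg: "set_weight S \<ge> 0"
  by (simp add: set_weight_def gap_product_nonneg)

lemma set_weight_singleton [simp]: "set_weight {x} = 1"
  by (simp add: set_weight_def)

lemma set_weight_Un:
  assumes "finite A" "finite B" "A \<noteq> {}" "B \<noteq> {}" "\<And>a b. a \<in> A \<Longrightarrow> b \<in> B \<Longrightarrow> a < b"
  shows "set_weight (A \<union> B) = set_weight A * K (Min B - Max A) * set_weight B"
  unfolding set_weight_def using assms
  by (simp add: sorted_list_of_set_Un gap_product_append hd_sorted_list_of_set last_sorted_list_of_set)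

lemma weight_eq_set_weight:
  assumes "\<eta> \<in> configs L" "0 < L"
  shows "weight \<rho> 1 L \<eta> = set_weight \<eta>"
proof -
  have fin: "finite \<eta>" and sub: "\<eta> \<subseteq> {0..L}" "0 \<in> \<eta>" "L \<in> \<eta>"
    using assms by (auto simp: configs_def intro: finite_subset)
  have "\<eta> = insert 0 (insert L (\<eta> \<inter> {0<..<L}))"
    using sub by auto
  then have "card \<eta> = card (insert 0 (insert L (\<eta> \<inter> {0<..<L})))" by simp
  also have "\<dots> = inner_particles L \<eta> + 2"
    using fin assms(2) by (simp add: inner_particles_def)
  finally have card: "card \<eta> = inner_particles L \<eta> + 2" .
  have "set_weight \<eta> = (\<Prod>j<length (sorted_list_of_set \<eta>) - 1.
      K (sorted_list_of_set \<eta> ! Suc j - sorted_list_of_set \<eta> ! j))"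
    unfolding set_weight_def using fin sub by (intro gap_product_eq_prod) auto
  also have "{..<length (sorted_list_of_set \<eta>) - 1} = {0..inner_particles L \<eta>}"
    using card by auto
  finally show ?thesis by (simp add: weight_def Let_def)
qed

lemma set_weight_empty_site:
  assumes "A \<in> left_parts x" "B \<in> right_parts x L"
  shows "set_weight (A \<union> B) = set_weight A * K (Min B - Max A) * set_weight B"
  using left_partsD[OF assms(1)] right_partsD[OF assms(2)] less_trans by (intro set_weight_Un) blast+

lemma set_weight_right:
  assumes "B \<in> right_parts x L"
  shows "set_weight (insert x B) = K (Min B - x) * set_weight B"
  using set_weight_Un[of "{x}" B] right_partsD[OF assms] by simp

text \<open>Together with \<open>set_weight_empty_site\<close> this is the renewal property: the two
  ends of an edge share the weights of \<open>A\<close> and \<open>B\<close> and differ only in one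
  bridging gap against two gaps meeting at \<open>x\<close>.\<close>

lemma set_weight_filled_site:
  assumes "A \<in> left_parts x" "B \<in> right_parts x L"
  shows "set_weight (insert x (A \<union> B)) = set_weight A * K (x - Max A) * K (Min B - x) * set_weight B"
proof -
  note A = left_partsD[OF assms(1)] and B = right_partsD[OF assms(2)]
  have "set_weight (A \<union> insert x B) = set_weight A * K (Min (insert x B) - Max A) * set_weight (insert x B)"
    using A B by (intro set_weight_Un) (auto dest: less_trans)
  moreover have "Min (insert x B) = x" using B by (intro Min_eqI) (auto intro: less_imp_le)
  ultimately show ?thesis using set_weight_right[OF assms(2)] by (simp add: mult_ac)
qed

lemma span_sets_refl: "span_sets a a = {{a}}"
  by (auto simp: span_sets_def)

lemma sum_span_sets_first_jump:
  assumes "a < b"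
  shows "(\<Sum>S\<in>span_sets a b. set_weight S) = (\<Sum>B\<in>right_parts a b. K (Min B - a) * set_weight B)"
proof (rule sum.reindex_bij_witness[of _ "insert a" "\<lambda>S. S - {a}"])
  fix S assume S: "S \<in> span_sets a b"
  then show "insert a (S - {a}) = S" and R: "S - {a} \<in> right_parts a b"
    using assms by (auto simp: span_sets_def right_parts_def le_less)
  then show "K (Min (S - {a}) - a) * set_weight (S - {a}) = set_weight S"
    using set_weight_right[OF R] by simp
qed (use assms in \<open>auto simp: right_parts_def span_sets_def\<close>)

text \<open>The defining recursion read from the other end: the substitution
  \<open>k = L - c\<close> turns the last step into the first one.\<close>

lemma renewal_mass_first_jump:
  assumes "x < L"
  shows "renewal_mass (L - x) = (\<Sum>c\<in>{x<..L}. K (c - x) * renewal_mass (L - c))"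
proof -
  define n where "n = L - x - 1"
  have n: "L - x = Suc n" using assms by (simp add: n_def)
  have "(\<Sum>k\<le>n. renewal_mass k * K (Suc n - k)) = (\<Sum>c\<in>{x<..L}. K (c - x) * renewal_mass (L - c))"
    by (rule sum.reindex_bij_witness[of _ "\<lambda>c. L - c" "\<lambda>k. L - k"])
       (use n in \<open>auto simp: mult.commute intro!: arg_cong2[of _ _ _ _ "(*)"] arg_cong[of _ _ K]\<close>)
  then show ?thesis by (simp add: n renewal_mass.simps(2))
qed

text \<open>Induction on the length of the block by its first gap, matching
  \<open>renewal_mass_first_jump\<close>. The case \<open>a = 0\<close> identifies the partition
  function.\<close>

lemma sum_span_sets: "a \<le> b \<Longrightarrow> (\<Sum>S\<in>span_sets a b. set_weight S) = renewal_mass (b - a)"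
proof (induction "b - a" arbitrary: a rule: less_induct)
  case less
  show ?case
  proof (cases "a = b")
    case False
    then have ab: "a < b" using less.prems by simp
    have "(\<Sum>S\<in>span_sets a b. set_weight S)
        = (\<Sum>c\<in>{a<..b}. \<Sum>S\<in>span_sets c b. K (Min S - a) * set_weight S)"
      by (simp add: sum_span_sets_first_jump[OF ab] sum_right_parts)
    also have "\<dots> = (\<Sum>c\<in>{a<..b}. K (c - a) * renewal_mass (b - c))"
    proof (rule sum.cong)
      fix c assume c: "c \<in> {a<..b}"
      have "(\<Sum>S\<in>span_sets c b. K (Min S - a) * set_weight S) = (\<Sum>S\<in>span_sets c b. K (c - a) * set_weight S)"
        by (intro sum.cong) (auto dest: span_setsD(3))
      also have "\<dots> = K (c - a) * renewal_mass (b - c)"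
        using c less.hyps[of c] diff_less_mono2[of a c b] by (auto simp flip: sum_distrib_left)
      finally show "(\<Sum>S\<in>span_sets c b. K (Min S - a) * set_weight S) = K (c - a) * renewal_mass (b - c)" .
    qed simp
    finally show ?thesis using renewal_mass_first_jump[OF ab] by simp
  qed (simp add: span_sets_refl)
qed

text \<open>A left part interacts with the rest only through its last particle \<open>a\<close>; all
  arrangements before \<open>a\<close> sum to \<open>renewal_mass a\<close>.\<close>

lemma sum_left_parts_weight:
  "(\<Sum>A\<in>left_parts x. set_weight A * F (Max A)) = (\<Sum>a<x. renewal_mass a * F a)"
  unfolding sum_left_parts
proof (rule sum.cong)
  fix a
  have "(\<Sum>S\<in>span_sets 0 a. set_weight S * F (Max S)) = (\<Sum>S\<in>span_sets 0 a. set_weight S * F a)"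
    by (intro sum.cong) (auto dest: span_setsD(4))
  then show "(\<Sum>S\<in>span_sets 0 a. set_weight S * F (Max S)) = renewal_mass a * F a"
    using sum_span_sets[of 0 a] by (simp flip: sum_distrib_right)
qed simp

lemma sum_right_parts_weight:
  "(\<Sum>B\<in>right_parts x L. F (Min B) * set_weight B) = (\<Sum>c\<in>{x<..L}. F c * renewal_mass (L - c))"
  unfolding sum_right_parts
proof (rule sum.cong)
  fix c assume c: "c \<in> {x<..L}"
  have "(\<Sum>S\<in>span_sets c L. F (Min S) * set_weight S) = (\<Sum>S\<in>span_sets c L. F c * set_weight S)"
    by (intro sum.cong) (auto dest: span_setsD(3))
  then show "(\<Sum>S\<in>span_sets c L. F (Min S) * set_weight S) = F c * renewal_mass (L - c)"
    using sum_span_sets[of c L] c by (simp flip: sum_distrib_left)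
qed simp

lemma renewal_mass_last_jump:
  assumes "0 < x"
  shows "renewal_mass x = (\<Sum>a<x. renewal_mass a * K (x - a))"
  using assms by (cases x) (auto simp: renewal_mass.simps(2) lessThan_Suc_atMost)

lemma partition_fn_eq:
  assumes "0 < L"
  shows "partition_fn \<rho> 1 L = renewal_mass L"
  using sum_span_sets[of 0 L] assms
  by (simp add: partition_fn_def configs_eq_span_sets weight_eq_set_weight cong: sum.cong)

lemma gibbs_eq:
  assumes "\<eta> \<in> configs L" "0 < L"
  shows "gibbs \<rho> 1 L \<eta> = set_weight \<eta> / renewal_mass L"
  using assms by (simp add: gibbs_def weight_eq_set_weight partition_fn_eq)

text \<open>From \<open>ln j \<le> j\<close>, the power j^-(1 + rho) is at least
  \<open>exp (- (1 + \<rho>) * j)\<close>, and \<open>cK \<le> 1\<close> lets \<open>cK\<close> be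
  replaced by \<open>cK ^ j\<close>.\<close>

definition "weight_base = cK * exp (- (1 + \<rho>))"

lemma renewal_const_le_1: "cK \<le> 1"
proof -
  have "K 1 \<le> (\<Sum>j=Suc 0..0 + 1. K j)" by simp
  also have "\<dots> \<le> tail 0" by (rule sum_K_le_tail)
  finally show ?thesis by (simp add: renewal_K_def tail_0)
qed

lemma weight_base: "0 < weight_base" "weight_base \<le> 1"
  using cK_pos renewal_const_le_1 rho_pos mult_mono[of cK 1 "exp (- (1 + \<rho>))" 1] by (auto simp: weight_base_def)

lemma K_ge_power:
  assumes "0 < j"
  shows "weight_base ^ j \<le> K j"
proof -
  have "weight_base ^ j = cK ^ j * exp (- (1 + \<rho>) * real j)"
    by (simp add: weight_base_def power_mult_distrib mult.commute flip: exp_of_nat_mult)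
  also have "cK ^ j \<le> cK ^ 1"
    using assms cK_pos renewal_const_le_1 by (intro power_decreasing) auto
  also have "exp (- (1 + \<rho>) * real j) \<le> exp (- (1 + \<rho>) * ln (real j))"
    using assms rho_pos ln_le_minus_one[of "real j"] by (auto intro!: mult_left_mono)
  also have "\<dots> = real j powr - (1 + \<rho>)" using assms by (simp add: powr_def)
  finally show ?thesis using cK_pos by (simp add: renewal_K_def mult_right_mono mult_left_mono)
qed

text \<open>The gaps of any configuration add up to \<open>b - a\<close>, so the exponents do as
  well, however many particles there are. This bounds the least likely configuration.\<close>

lemma set_weight_ge_power: "S \<in> span_sets a b \<Longrightarrow> weight_base ^ (b - a) \<le> set_weight S"
proof (induction "b - a" arbitrary: a S rule: less_induct)
  case less
  show ?case
  proof (cases "a = b")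
    case True
    then show ?thesis using less.prems by (simp add: span_sets_refl)
  next
    case False
    have sub: "S \<subseteq> {a..b}" "a \<in> S" "b \<in> S" using less.prems by (auto simp: span_sets_def)
    then have R: "S - {a} \<in> right_parts a b" using False by (auto simp: right_parts_def le_less)
    define c where "c = Min (S - {a})"
    have c: "a < c" "c \<le> b" using right_partsD[OF R] by (auto simp: c_def)
    have "S - {a} \<in> span_sets c b"
      using right_partsD(3,7)[OF R] Min_in[OF right_partsD(1,2)[OF R]] Min_le[OF right_partsD(1)[OF R]]
      unfolding span_sets_def c_def by (simp only: mem_Collect_eq subset_iff atLeastAtMost_iff) blast
    then have IH: "weight_base ^ (b - c) \<le> set_weight (S - {a})"
      using less.hyps[of c] c by simp
    have "weight_base ^ (b - a) = weight_base ^ (c - a) * weight_base ^ (b - c)"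
      using c by (simp flip: power_add)
    also have "\<dots> \<le> K (c - a) * set_weight (S - {a})"
      using IH K_ge_power[of "c - a"] c weight_base by (intro mult_mono K_nonneg) auto
    also have "\<dots> = set_weight S"
      using set_weight_right[OF R] sub by (simp add: c_def insert_absorb)
    finally show ?thesis .
  qed
qed

lemma set_weight_pos: "S \<in> span_sets a b \<Longrightarrow> 0 < set_weight S"
  using set_weight_ge_power[of S a b] weight_base(1) by (meson less_le_trans zero_less_power)

end

section \<open>The Dirichlet form and the congestion estimate\<close>

text \<open>Exchanges the first and third summation. It is used to make the configuration visited by
  a path the outer pair, leaving the complementary one inside.\<close>

lemma sum_swap_outer:
  "(\<Sum>a\<in>I. \<Sum>b\<in>J. \<Sum>c\<in>M. \<Sum>d\<in>N. F a b c d) = (\<Sum>c\<in>M. \<Sum>b\<in>J. \<Sum>a\<in>I. \<Sum>d\<in>N. F a b c d)"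
proof -
  have "(\<Sum>a\<in>I. \<Sum>b\<in>J. \<Sum>c\<in>M. \<Sum>d\<in>N. F a b c d) = (\<Sum>a\<in>I. \<Sum>c\<in>M. \<Sum>b\<in>J. \<Sum>d\<in>N. F a b c d)"
    by (intro sum.cong refl sum.swap)
  also have "\<dots> = (\<Sum>c\<in>M. \<Sum>a\<in>I. \<Sum>b\<in>J. \<Sum>d\<in>N. F a b c d)"
    by (rule sum.swap)
  also have "\<dots> = (\<Sum>c\<in>M. \<Sum>b\<in>J. \<Sum>a\<in>I. \<Sum>d\<in>N. F a b c d)"
    by (intro sum.cong refl sum.swap)
  finally show ?thesis .
qed

lemma sum_squared_diff:
  fixes w f :: "'a \<Rightarrow> real"
  shows "(\<Sum>a\<in>I. \<Sum>b\<in>I. w a * w b * (f b - f a)\<^sup>2)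
    = 2 * (\<Sum>a\<in>I. w a) * (\<Sum>a\<in>I. w a * (f a)\<^sup>2) - 2 * (\<Sum>a\<in>I. w a * f a)\<^sup>2"
proof -
  have "(\<Sum>a\<in>I. \<Sum>b\<in>I. w a * w b * (f b - f a)\<^sup>2)
      = (\<Sum>a\<in>I. \<Sum>b\<in>I. w a * (w b * (f b)\<^sup>2) + (w a * (f a)\<^sup>2) * w b - 2 * ((w a * f a) * (w b * f b)))"
    by (intro sum.cong refl) (simp add: power2_eq_square algebra_simps)
  also have "\<dots> = 2 * (\<Sum>a\<in>I. w a) * (\<Sum>a\<in>I. w a * (f a)\<^sup>2) - 2 * (\<Sum>a\<in>I. w a * f a)\<^sup>2"
    by (simp add: sum_subtractf sum.distrib power2_eq_square flip: sum_distrib_left sum_distrib_right)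
  finally show ?thesis .
qed

lemma configs_union_parts:
  assumes "A \<in> left_parts x" "B \<in> right_parts x L"
  shows "A \<union> B \<in> configs L" "insert x (A \<union> B) \<in> configs L"
  using assms less_imp_le[OF right_partsD(9)[OF assms(2)]]
  by (auto simp: configs_def left_parts_def right_parts_def)

lemma agree_off_parts:
  assumes "A \<in> left_parts x" "B \<in> right_parts x L" "\<eta> = A \<union> B \<or> \<eta> = insert x (A \<union> B)"
  shows "agree_off L x \<eta> = {A \<union> B, insert x (A \<union> B)}"
proof (intro equalityI subsetI)
  fix \<xi> assume "\<xi> \<in> agree_off L x \<eta>"
  then have "\<And>y. y \<noteq> x \<Longrightarrow> y \<in> \<xi> \<longleftrightarrow> y \<in> A \<union> B"
    using assms by (auto simp: agree_off_def)
  moreover have "x \<notin> A \<union> B" using left_partsD(6)[OF assms(1)] right_partsD(8)[OF assms(2)] by auto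
  ultimately have "\<xi> = (if x \<in> \<xi> then insert x (A \<union> B) else A \<union> B)"
    by (intro set_eqI) (metis insert_iff)
  then have "\<xi> = A \<union> B \<or> \<xi> = insert x (A \<union> B)" by (auto split: if_splits)
  then show "\<xi> \<in> {A \<union> B, insert x (A \<union> B)}" by blast
qed (use configs_union_parts[OF assms(1,2)] assms(3) in \<open>auto simp: agree_off_def\<close>)

context pinning
begin

lemma gibbs_mean_eq:
  assumes "0 < L"
  shows "gibbs_mean \<rho> 1 L f = (\<Sum>\<eta>\<in>configs L. set_weight \<eta> * f \<eta>) / renewal_mass L"
  using assms by (simp add: gibbs_mean_def gibbs_eq sum_divide_distrib cong: sum.cong)

lemma sum_set_weight_configs: "(\<Sum>\<eta>\<in>configs L. set_weight \<eta>) = renewal_mass L"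
  using sum_span_sets[of 0 L] by (simp add: configs_eq_span_sets)

lemma set_weight_configs_pos: "\<eta> \<in> configs L \<Longrightarrow> 0 < set_weight \<eta>"
  unfolding configs_eq_span_sets by (rule set_weight_pos)

lemma heat_bath_parts:
  assumes "A \<in> left_parts x" "B \<in> right_parts x L" "\<eta> = A \<union> B \<or> \<eta> = insert x (A \<union> B)"
  shows "heat_bath \<rho> 1 L x g \<eta> =
    (set_weight (A \<union> B) * g (A \<union> B) + set_weight (insert x (A \<union> B)) * g (insert x (A \<union> B)))
      / (set_weight (A \<union> B) + set_weight (insert x (A \<union> B)))"
proof -
  have ne: "A \<union> B \<noteq> insert x (A \<union> B)"
    using left_partsD(6)[OF assms(1)] right_partsD(8)[OF assms(2)] by auto
  have L: "0 < L" using right_partsD[OF assms(2)] by auto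
  define a b where "a = A \<union> B" and "b = insert x (A \<union> B)"
  have ab: "a \<noteq> b" "a \<in> configs L" "b \<in> configs L"
    using ne configs_union_parts[OF assms(1,2)] by (auto simp: a_def b_def)
  have "heat_bath \<rho> 1 L x g \<eta> = (\<Sum>\<xi>\<in>{a, b}. gibbs \<rho> 1 L \<xi> * g \<xi>) / (\<Sum>\<xi>\<in>{a, b}. gibbs \<rho> 1 L \<xi>)"
    unfolding heat_bath_def agree_off_parts[OF assms] a_def b_def ..
  also have "\<dots> = ((set_weight a * g a + set_weight b * g b) / renewal_mass L)
      / ((set_weight a + set_weight b) / renewal_mass L)"
    using ab L by (simp add: gibbs_eq add_divide_distrib)
  also have "\<dots> = (set_weight a * g a + set_weight b * g b) / (set_weight a + set_weight b)"
    using renewal_mass_pos[of L] by simp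
  finally show ?thesis by (simp add: a_def b_def)
qed

text \<open>Up to the factor \<open>renewal_mass L\<close>, the equilibrium flow across an edge: the
  weight \<open>p\<close> of the empty state times the heat-bath rate \<open>q / (p + q)\<close> of
  filling \<open>x\<close>.\<close>

definition conductance :: "nat \<Rightarrow> nat set \<Rightarrow> nat set \<Rightarrow> real" where
  "conductance x A B = set_weight (A \<union> B) * set_weight (insert x (A \<union> B))
     / (set_weight (A \<union> B) + set_weight (insert x (A \<union> B)))"

text \<open>The Dirichlet form as a bilinear form, with every edge counted once and so without the
  usual factor 1/2. The mixed form is needed for derivatives along the semigroup.\<close>

definition energy :: "nat \<Rightarrow> (nat set \<Rightarrow> real) \<Rightarrow> (nat set \<Rightarrow> real) \<Rightarrow> real" where
  "energy L f g = (\<Sum>x\<in>{0<..<L}. \<Sum>A\<in>left_parts x. \<Sum>B\<in>right_parts x L. conductance x A B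
      * (f (A \<union> B) - f (insert x (A \<union> B))) * (g (A \<union> B) - g (insert x (A \<union> B)))) / renewal_mass L"

lemma conductance_nonneg: "conductance x A B \<ge> 0"
  by (simp add: conductance_def set_weight_nonneg)

lemma two_point_energy:
  fixes p q :: real
  assumes "0 < p" "0 < q"
  shows "p * (a * ((p * b + q * d) / (p + q) - b)) + q * (c * ((p * b + q * d) / (p + q) - d))
    = - (p * q / (p + q) * (a - c) * (b - d))"
proof -
  have "(p * b + q * d) / (p + q) - b = q * (d - b) * inverse (p + q)"
    "(p * b + q * d) / (p + q) - d = p * (b - d) * inverse (p + q)"
    using assms by (simp_all add: field_simps)
  then show ?thesis
    by (simp only: divide_inverse) (simp add: algebra_simps)
qed

text \<open>Summation by parts on each two-point fibre. A constant \<open>f\<close> gives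
  stationarity, and the symmetry of \<open>energy\<close> gives reversibility.\<close>

lemma gibbs_mean_generator:
  assumes "0 < L"
  shows "gibbs_mean \<rho> 1 L (\<lambda>\<eta>. f \<eta> * generator \<rho> 1 L g \<eta>) = - energy L f g"
proof -
  have "(\<Sum>\<eta>\<in>configs L. set_weight \<eta> * (f \<eta> * generator \<rho> 1 L g \<eta>))
      = (\<Sum>x\<in>{0<..<L}. \<Sum>\<eta>\<in>configs L. set_weight \<eta> * (f \<eta> * (heat_bath \<rho> 1 L x g \<eta> - g \<eta>)))"
    unfolding generator_def sum_distrib_left by (rule sum.swap)
  also have "\<dots> = (\<Sum>x\<in>{0<..<L}. - (\<Sum>A\<in>left_parts x. \<Sum>B\<in>right_parts x L. conductance x A B
      * (f (A \<union> B) - f (insert x (A \<union> B))) * (g (A \<union> B) - g (insert x (A \<union> B)))))"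
  proof (rule sum.cong)
    fix x assume "x \<in> {0<..<L}"
    then have x0: "0 < x" and xL: "x < L" by simp_all
    show "(\<Sum>\<eta>\<in>configs L. set_weight \<eta> * (f \<eta> * (heat_bath \<rho> 1 L x g \<eta> - g \<eta>)))
        = - (\<Sum>A\<in>left_parts x. \<Sum>B\<in>right_parts x L. conductance x A B
          * (f (A \<union> B) - f (insert x (A \<union> B))) * (g (A \<union> B) - g (insert x (A \<union> B))))"
      unfolding sum_negf[symmetric] sum_configs_split[OF x0 xL]
    proof (intro sum.cong refl)
        fix A B assume AB: "A \<in> left_parts x" "B \<in> right_parts x L"
        have "0 < set_weight (A \<union> B)" "0 < set_weight (insert x (A \<union> B))"
          using configs_union_parts[OF AB] by (auto intro: set_weight_configs_pos)
        from two_point_energy[OF this]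
        show "set_weight (A \<union> B) * (f (A \<union> B) * (heat_bath \<rho> 1 L x g (A \<union> B) - g (A \<union> B)))
          + set_weight (insert x (A \<union> B)) * (f (insert x (A \<union> B))
            * (heat_bath \<rho> 1 L x g (insert x (A \<union> B)) - g (insert x (A \<union> B))))
          = - (conductance x A B * (f (A \<union> B) - f (insert x (A \<union> B))) * (g (A \<union> B) - g (insert x (A \<union> B))))"
          unfolding heat_bath_parts[OF AB disjI1[OF refl]] heat_bath_parts[OF AB disjI2[OF refl]]
            conductance_def .
    qed
  qed simp
  finally show ?thesis
    using assms by (simp add: gibbs_mean_eq energy_def sum_negf)
qed

lemma dirichlet_form_eq: "0 < L \<Longrightarrow> dirichlet_form \<rho> 1 L f = energy L f f"
  by (simp add: dirichlet_form_def gibbs_mean_generator)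

text \<open>The total weight of continuing from a particle at distance \<open>k\<close> before a
  site by a jump over that site, landing \<open>j\<close> beyond it, and renewing from there up to
  distance \<open>m\<close>.\<close>

definition jump_over :: "nat \<Rightarrow> nat \<Rightarrow> real" where
  "jump_over k m = (\<Sum>j\<in>{0<..m}. K (k + j) * renewal_mass (m - j))"

lemma renewal_mass_le': "\<exists>C>0. \<forall>n>0. renewal_mass n \<le> C * real n powr (\<rho> - 1)"
proof -
  obtain C where C: "C > 0" "\<And>n. renewal_mass n \<le> C * real (Suc n) powr (\<rho> - 1)"
    using renewal_mass_le by blast
  have "renewal_mass n \<le> C * real n powr (\<rho> - 1)" if "n > 0" for n
  proof -
    have "real (Suc n) powr (\<rho> - 1) \<le> real n powr (\<rho> - 1)"
      using that rho_less_1 by (intro powr_mono2') auto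
    then show ?thesis using C(2)[of n] C(1) by (meson less_imp_le mult_left_mono order_trans)
  qed
  then show ?thesis using C(1) by blast
qed

lemma renewal_mass_ge': "\<exists>c>0. \<forall>n>0. c * real n powr (\<rho> - 1) \<le> renewal_mass n"
proof -
  obtain c where c: "c > 0" "\<And>n. c * real (Suc n) powr (\<rho> - 1) \<le> renewal_mass n"
    using renewal_mass_ge by blast
  have "c * 2 powr (\<rho> - 1) * real n powr (\<rho> - 1) \<le> renewal_mass n" if "n > 0" for n
  proof -
    have "(2 * real n) powr (\<rho> - 1) \<le> real (Suc n) powr (\<rho> - 1)"
      using that rho_less_1 by (intro powr_mono2') auto
    then have "c * (2 * real n) powr (\<rho> - 1) \<le> c * real (Suc n) powr (\<rho> - 1)"
      using c(1) by (intro mult_left_mono) auto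
    then show ?thesis using c(2)[of n] by (simp add: powr_mult mult.assoc)
  qed
  moreover have "c * 2 powr (\<rho> - 1) > 0" using c(1) by simp
  ultimately show ?thesis by blast
qed

lemma sum_renewal_mass_le: "\<exists>C>0. \<forall>m. (\<Sum>j\<in>{0<..m}. renewal_mass (m - j)) \<le> C * real m powr \<rho>"
proof -
  obtain C where C: "C > 0" "\<And>n. renewal_fn n \<le> C * real (Suc n) powr \<rho>"
    using renewal_fn_le by blast
  have "(\<Sum>j\<in>{0<..m}. renewal_mass (m - j)) \<le> C * real m powr \<rho>" for m
  proof (cases m)
    case (Suc n)
    have "(\<Sum>j\<in>{0<..m}. renewal_mass (m - j)) = renewal_fn n"
      unfolding renewal_fn_def
      by (rule sum.reindex_bij_witness[of _ "\<lambda>j. m - j" "\<lambda>j. m - j"]) (auto simp: Suc)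
    then show ?thesis using C(2)[of n] Suc by simp
  qed simp
  then show ?thesis using C(1) by blast
qed

text \<open>Both sides have the same power order. The factor 4 covers the points
  \<open>m - j\<close> with \<open>m\<close> at least half of \<open>L\<close> and \<open>j\<close>
  at most half of \<open>m\<close>.\<close>

lemma renewal_mass_comparable:
  "\<exists>D>0. \<forall>y L. 0 < y \<longrightarrow> 0 < L \<longrightarrow> L \<le> 4 * y \<longrightarrow> renewal_mass y \<le> D * renewal_mass L"
proof -
  obtain a where a: "a > 0" "\<And>n. n > 0 \<Longrightarrow> renewal_mass n \<le> a * real n powr (\<rho> - 1)"
    using renewal_mass_le' by blast
  obtain b where b: "b > 0" "\<And>n. n > 0 \<Longrightarrow> b * real n powr (\<rho> - 1) \<le> renewal_mass n"
    using renewal_mass_ge' by blast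
  define D where "D = a * (1 / 4) powr (\<rho> - 1) / b"
  have "renewal_mass y \<le> D * renewal_mass L" if "0 < y" "0 < L" "L \<le> 4 * y" for y L
  proof -
    have "renewal_mass y \<le> a * real y powr (\<rho> - 1)" by (rule a(2)[OF that(1)])
    also have "\<dots> \<le> a * (1 / 4 * real L) powr (\<rho> - 1)"
      using a(1) that rho_less_1 by (intro mult_left_mono powr_mono2') auto
    also have "\<dots> = D * (b * real L powr (\<rho> - 1))"
      unfolding D_def using b(1) by (subst powr_mult) auto
    also have "\<dots> \<le> D * renewal_mass L"
      using a(1) b that by (intro mult_left_mono) (auto simp: D_def)
    finally show ?thesis .
  qed
  moreover have "D > 0" using a(1) b(1) by (simp add: D_def)
  ultimately show ?thesis by blast
qed

text \<open>For positive integers \<open>p + q \<le> 2 * p * q\<close>. The resulting factor 2^(1 +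
  rho) is at most 4, and the surplus \<open>cK\<close> is at most 1.\<close>

lemma K_mult_le:
  assumes "0 < p" "0 < q"
  shows "K p * K q \<le> 4 * K (p + q)"
proof -
  have "real p * 1 \<le> real p * real q" "1 * real q \<le> real p * real q"
    using assms by (intro mult_mono; simp)+
  then have le: "real (p + q) \<le> 2 * (real p * real q)" by simp
  then have "(2 * (real p * real q)) powr - (1 + \<rho>) \<le> real (p + q) powr - (1 + \<rho>)"
    using assms rho_pos by (intro powr_mono2') auto
  then have 1: "2 powr - (1 + \<rho>) * (real p * real q) powr - (1 + \<rho>) \<le> real (p + q) powr - (1 + \<rho>)"
    by (subst (asm) powr_mult) auto
  have "2 powr (- 2) \<le> 2 powr - (1 + \<rho>)" using rho_less_1 by (intro powr_mono) auto
  then have "1 / 4 \<le> 2 powr - (1 + \<rho>)" by (simp add: powr_minus)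
  then have "1 / 4 * (real p * real q) powr - (1 + \<rho>) \<le> 2 powr - (1 + \<rho>) * (real p * real q) powr - (1 + \<rho>)"
    by (intro mult_right_mono) auto
  with 1 have 2: "(real p * real q) powr - (1 + \<rho>) \<le> 4 * real (p + q) powr - (1 + \<rho>)" by linarith
  have "K p * K q = cK * (cK * (real p * real q) powr - (1 + \<rho>))"
    by (simp add: renewal_K_def powr_mult mult_ac)
  also have "\<dots> \<le> 1 * (cK * (real p * real q) powr - (1 + \<rho>))"
    using renewal_const_le_1 cK_pos by (intro mult_right_mono) auto
  also have "\<dots> \<le> cK * (4 * real (p + q) powr - (1 + \<rho>))"
    using 2 cK_pos by simp
  finally show ?thesis by (simp add: renewal_K_def)
qed

text \<open>
  The configuration with the particle is, up to a constant, the less likely of the two, so its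
  weight alone controls the conductance.
\<close>

lemma set_weight_filled_le_conductance:
  assumes "A \<in> left_parts x" "B \<in> right_parts x L"
  shows "set_weight (insert x (A \<union> B)) \<le> 5 * conductance x A B"
proof -
  define p q where "p = set_weight (A \<union> B)" and "q = set_weight (insert x (A \<union> B))"
  have pq: "p > 0" "q > 0"
    using configs_union_parts[OF assms] by (auto intro: set_weight_configs_pos simp: p_def q_def)
  note A = left_partsD[OF assms(1)] and B = right_partsD[OF assms(2)]
  have "K (x - Max A) * K (Min B - x) \<le> 4 * K ((x - Max A) + (Min B - x))"
    using A(4) B(4) by (intro K_mult_le) simp_all
  also have "(x - Max A) + (Min B - x) = Min B - Max A" using A(4) B(4) by linarith
  finally have "set_weight A * (K (x - Max A) * K (Min B - x)) * set_weight B
      \<le> set_weight A * (4 * K (Min B - Max A)) * set_weight B"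
    by (intro mult_left_mono mult_right_mono set_weight_nonneg)
  then have "q \<le> 4 * p"
    unfolding p_def q_def set_weight_empty_site[OF assms] set_weight_filled_site[OF assms] by (simp add: mult_ac)
  then have "q * (p + q) \<le> q * (5 * p)" using pq by (intro mult_left_mono) auto
  then have "q \<le> 5 * (p * q / (p + q))" using pq by (simp add: field_simps)
  then show ?thesis by (simp add: conductance_def p_def q_def)
qed

text \<open>If \<open>x\<close> is at least half of \<open>L\<close>, then
  \<open>renewal_mass x\<close> is comparable to \<open>renewal_mass L\<close>, all jumps cost at
  most \<open>K k\<close>, and the masses after landing sum to L^rho. Otherwise the landing distance
  is split at half of \<open>m = L - x\<close>. For short jumps the remaining mass is comparable to
  \<open>renewal_mass L\<close>, the jump weights sum to \<open>tail k\<close> of order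
  \<open>k * K k\<close>, and \<open>k \<le> x\<close> absorbs the factor \<open>k\<close>. Long
  jumps each cost at most order L^-(1 + rho).\<close>

lemma congestion_bound:
  "\<exists>C>0. \<forall>x L k. 0 < x \<longrightarrow> x < L \<longrightarrow> 0 < k \<longrightarrow> k \<le> x \<longrightarrow>
     renewal_mass x * jump_over k (L - x) \<le> C * real L powr \<rho> * renewal_mass L * K k"
proof -
  obtain a where a: "a > 0" "\<And>n. n > 0 \<Longrightarrow> renewal_mass n \<le> a * real n powr (\<rho> - 1)"
    using renewal_mass_le' by blast
  obtain b where b: "b > 0" "\<And>n. n > 0 \<Longrightarrow> b * real n powr (\<rho> - 1) \<le> renewal_mass n"
    using renewal_mass_ge' by blast
  obtain s where s: "s > 0" "\<And>m. (\<Sum>j\<in>{0<..m}. renewal_mass (m - j)) \<le> s * real m powr \<rho>"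
    using sum_renewal_mass_le by blast
  obtain D where D: "D > 0" "\<And>y L. 0 < y \<Longrightarrow> 0 < L \<Longrightarrow> L \<le> 4 * y \<Longrightarrow> renewal_mass y \<le> D * renewal_mass L"
    using renewal_mass_comparable by blast
  define C1 where "C1 = a * D * tail_upper / cK"
  define C2 where "C2 = a * (1 / 4) powr - (1 + \<rho>) * s / b"
  define C where "C = D * s + C1 + C2"
  have pos: "C1 > 0" "C2 > 0" using a(1) b(1) s(1) D(1) tail_upper_pos cK_pos by (auto simp: C1_def C2_def)
  have "renewal_mass x * jump_over k (L - x) \<le> C * real L powr \<rho> * renewal_mass L * K k"
    if xk: "0 < x" "x < L" "0 < k" "k \<le> x" for x L k
  proof -
    define m where "m = L - x"
    define T where "T = real L powr \<rho> * renewal_mass L * K k"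
    have T: "T \<ge> 0" by (auto simp: T_def intro!: mult_nonneg_nonneg renewal_mass_nonneg K_nonneg)
    have m: "0 < m" "m \<le> L" using xk by (auto simp: m_def)
    have sm: "(\<Sum>j\<in>{0<..m}. renewal_mass (m - j)) \<le> s * real L powr \<rho>"
    proof -
      have "s * real m powr \<rho> \<le> s * real L powr \<rho>"
        using m s(1) rho_pos by (intro mult_left_mono powr_mono2) auto
      then show ?thesis using s(2)[of m] by linarith
    qed
    have "renewal_mass x * jump_over k m \<le> C * T"
    proof (cases "L \<le> 2 * x")
      case True
      have "jump_over k m \<le> (\<Sum>j\<in>{0<..m}. K k * renewal_mass (m - j))"
        unfolding jump_over_def using xk by (intro sum_mono mult_right_mono K_antimono renewal_mass_nonneg) auto
      also have "\<dots> \<le> K k * (s * real L powr \<rho>)"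
        unfolding sum_distrib_left[symmetric] by (intro mult_left_mono sm K_nonneg)
      finally have "renewal_mass x * jump_over k m \<le> (D * renewal_mass L) * (K k * (s * real L powr \<rho>))"
        using True xk D by (intro mult_mono D) (auto simp: jump_over_def
            intro!: mult_nonneg_nonneg sum_nonneg K_nonneg renewal_mass_nonneg)
      also have "\<dots> = D * s * T" by (simp add: T_def mult_ac)
      also have "\<dots> \<le> C * T" using T pos by (intro mult_right_mono) (auto simp: C_def)
      finally show ?thesis .
    next
      case False
      then have mL: "L \<le> 2 * m" using xk by (simp add: m_def)
      define h where "h = m div 2"
      have split: "{0<..m} = {0<..h} \<union> {h<..m}" "{0<..h} \<inter> {h<..m} = {}" by (auto simp: h_def)
      have X: "real x > 0" "real x \<le> real L" using xk by auto
      define J1 where "J1 = (\<Sum>j\<in>{0<..h}. K (k + j) * renewal_mass (m - j))"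
      define J2 where "J2 = (\<Sum>j\<in>{h<..m}. K (k + j) * renewal_mass (m - j))"
      have J: "jump_over k m = J1 + J2"
        unfolding jump_over_def J1_def J2_def split(1) by (rule sum.union_disjoint) (use split(2) in auto)
      have nn: "J1 \<ge> 0" "J2 \<ge> 0"
        by (auto simp: J1_def J2_def intro!: mult_nonneg_nonneg sum_nonneg K_nonneg renewal_mass_nonneg)
      have "J1 \<le> (\<Sum>j\<in>{0<..h}. K (k + j) * (D * renewal_mass L))"
        unfolding J1_def using m mL xk
        by (intro sum_mono mult_left_mono K_nonneg D) (auto simp: h_def)
      also have "\<dots> = (\<Sum>j\<in>{0<..h}. K (k + j)) * (D * renewal_mass L)" by (simp add: sum_distrib_right)
      also have "(\<Sum>j\<in>{0<..h}. K (k + j)) = (\<Sum>j=Suc k..k + h. K j)"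
        by (rule sum.reindex_bij_witness[of _ "\<lambda>j. j - k" "\<lambda>j. k + j"]) auto
      also have "\<dots> \<le> tail k" by (rule sum_K_le_tail)
      also have "tail k \<le> tail_upper * real k powr - \<rho>"
      proof -
        have "real (Suc k) powr - \<rho> \<le> real k powr - \<rho>" using xk rho_pos by (intro powr_mono2') auto
        then show ?thesis using tail_le[of k] tail_upper_pos by (meson less_imp_le mult_left_mono order_trans)
      qed
      also have "real k powr - \<rho> = real k * K k / cK"
        using cK_pos xk powr_add[of "real k" 1 "- (1 + \<rho>)"] by (simp add: renewal_K_def)
      finally have J1: "J1 \<le> tail_upper * (real k * K k / cK) * (D * renewal_mass L)"
        using D(1) renewal_mass_nonneg by (simp add: mult_right_mono)
      have "renewal_mass x * J1 \<le> (a * real x powr (\<rho> - 1)) * (tail_upper * (real k * K k / cK) * (D * renewal_mass L))"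
        using a xk nn J1 by (intro mult_mono) auto
      also have "\<dots> = C1 * (real x powr (\<rho> - 1) * real k) * (renewal_mass L * K k)"
        by (simp add: C1_def)
      also have "real x powr (\<rho> - 1) * real k \<le> real L powr \<rho>"
      proof -
        have "real x powr (\<rho> - 1) * real k \<le> real x powr (\<rho> - 1) * real x"
          using xk by (intro mult_left_mono) auto
        also have "\<dots> = real x powr \<rho>" using xk by (simp add: powr_diff)
        also have "\<dots> \<le> real L powr \<rho>" using xk rho_pos by (intro powr_mono2) auto
        finally show ?thesis .
      qed
      finally have R1: "renewal_mass x * J1 \<le> C1 * T"
        using pos renewal_mass_nonneg K_nonneg by (simp add: T_def mult_ac mult_left_mono mult_right_mono)
      have "J2 \<le> (\<Sum>j\<in>{h<..m}. (cK * (1 / 4 * real L) powr - (1 + \<rho>)) * renewal_mass (m - j))"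
        unfolding J2_def
      proof (intro sum_mono mult_right_mono renewal_mass_nonneg)
        fix j assume j: "j \<in> {h<..m}"
        then have "L \<le> 4 * (k + j)" using mL by (auto simp: h_def)
        then show "K (k + j) \<le> cK * (1 / 4 * real L) powr - (1 + \<rho>)"
          unfolding renewal_K_def using cK_pos rho_pos xk by (intro mult_left_mono powr_mono2') auto
      qed
      also have "\<dots> \<le> (cK * (1 / 4 * real L) powr - (1 + \<rho>)) * (\<Sum>j\<in>{0<..m}. renewal_mass (m - j))"
        unfolding sum_distrib_left[symmetric] using cK_pos
        by (intro mult_left_mono sum_mono2) (auto simp: renewal_mass_nonneg)
      also have "\<dots> \<le> (cK * (1 / 4 * real L) powr - (1 + \<rho>)) * (s * real L powr \<rho>)"
        using cK_pos by (intro mult_left_mono sm) auto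
      also have "\<dots> = cK * (1 / 4) powr - (1 + \<rho>) * s * (real L powr - (1 + \<rho>) * real L powr \<rho>)"
        by (subst powr_mult) auto
      also have "real L powr - (1 + \<rho>) * real L powr \<rho> = real L powr - 1"
        by (simp flip: powr_add)
      finally have J2: "J2 \<le> cK * (1 / 4) powr - (1 + \<rho>) * s * real L powr - 1" .
      have "renewal_mass x * J2 \<le> (a * real x powr (\<rho> - 1)) * (cK * (1 / 4) powr - (1 + \<rho>) * s * real L powr - 1)"
        using a xk nn J2 by (intro mult_mono) auto
      also have "\<dots> = C2 * b * cK * (real x powr (\<rho> - 1) * real L powr - 1)"
        using b(1) by (simp add: C2_def)
      \<comment> \<open>The factor x^(rho - 1) is written as x^(2 rho) times x^-(1 + rho), so that
        \<open>x \<le> L\<close> bounds the increasing power and \<open>k \<le> x\<close> the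
        decreasing one.\<close>
      also have "real x powr (\<rho> - 1) * real L powr - 1
          \<le> real L powr \<rho> * real L powr (\<rho> - 1) * real k powr - (1 + \<rho>)"
      proof -
        have "real x powr (\<rho> - 1) * real L powr - 1 = real x powr (2 * \<rho>) * real x powr - (1 + \<rho>) * real L powr - 1"
          by (simp flip: powr_add)
        also have "\<dots> \<le> real L powr (2 * \<rho>) * real k powr - (1 + \<rho>) * real L powr - 1"
          using xk rho_pos by (intro mult_mono powr_mono2 powr_mono2') auto
        also have "\<dots> = (real L powr (2 * \<rho>) * real L powr - 1) * real k powr - (1 + \<rho>)" by simp
        also have "real L powr (2 * \<rho>) * real L powr - 1 = real L powr \<rho> * real L powr (\<rho> - 1)"
        proof -
          have "2 * \<rho> + - 1 = \<rho> + (\<rho> - 1)" by simp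
          then show ?thesis by (simp only: powr_add[symmetric])
        qed
        finally show ?thesis .
      qed
      finally have "renewal_mass x * J2
          \<le> C2 * b * cK * (real L powr \<rho> * real L powr (\<rho> - 1) * real k powr - (1 + \<rho>))"
        using pos b(1) cK_pos by (simp add: mult_left_mono)
      also have "\<dots> = C2 * (real L powr \<rho> * (b * real L powr (\<rho> - 1)) * K k)"
        by (simp add: renewal_K_def)
      also have "\<dots> \<le> C2 * T"
        unfolding T_def using pos b xk by (intro mult_left_mono mult_right_mono K_nonneg) auto
      finally have R2: "renewal_mass x * J2 \<le> C2 * T" .
      have "renewal_mass x * jump_over k m = renewal_mass x * J1 + renewal_mass x * J2"
        by (simp add: J distrib_left)
      also have "\<dots> \<le> C1 * T + C2 * T" using R1 R2 by linarith
      also have "\<dots> = (C1 + C2) * T" by (simp add: distrib_right)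
      also have "\<dots> \<le> C * T" using T D(1) s(1) by (intro mult_right_mono) (auto simp: C_def)
      finally show ?thesis .
    qed
    then show ?thesis by (simp add: T_def m_def mult_ac)
  qed
  moreover have "C > 0" using pos D(1) s(1) by (simp add: C_def add_pos_pos)
  ultimately show ?thesis by blast
qed

end

section \<open>The Poincare inequality\<close>

definition left_right_path :: "nat set \<Rightarrow> nat set \<Rightarrow> nat \<Rightarrow> nat set" where
  "left_right_path \<sigma> \<eta> x = \<eta> \<inter> {..x} \<union> \<sigma> \<inter> {x<..}"

text \<open>Both configurations contain 0 and \<open>L\<close>. The path is therefore already at
  \<sigma> for index 0 and has reached \<eta> at index \<open>L - 1\<close>.\<close>

lemma left_right_path_telescope:
  fixes f :: "nat set \<Rightarrow> real"
  assumes "\<sigma> \<in> configs L" "\<eta> \<in> configs L" "0 < L"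
  shows "f \<eta> - f \<sigma> = (\<Sum>x\<in>{0<..<L}. f (left_right_path \<sigma> \<eta> x) - f (left_right_path \<sigma> \<eta> (x - 1)))"
proof -
  have sub: "\<eta> \<subseteq> {0..L}" "\<sigma> \<subseteq> {0..L}" "0 \<in> \<eta>" "0 \<in> \<sigma>" "L \<in> \<eta>" "L \<in> \<sigma>"
    using assms by (auto simp: configs_def)
  have start: "left_right_path \<sigma> \<eta> 0 = \<sigma>"
    using sub by (auto simp: left_right_path_def)
  have stop: "left_right_path \<sigma> \<eta> (L - 1) = \<eta>"
  proof (rule set_eqI)
    fix y
    have "y \<le> L" if "y \<in> \<eta> \<or> y \<in> \<sigma>" using sub that by auto
    then have "y \<le> L - 1 \<or> y = L" if "y \<in> \<eta> \<or> y \<in> \<sigma>" using that by linarith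
    then show "y \<in> left_right_path \<sigma> \<eta> (L - 1) \<longleftrightarrow> y \<in> \<eta>"
      using sub(5,6) assms(3) unfolding left_right_path_def
      by (cases "y \<le> L - 1") (auto simp: not_le)
  qed
  have "(\<Sum>x\<in>{0<..<L}. f (left_right_path \<sigma> \<eta> x) - f (left_right_path \<sigma> \<eta> (x - 1)))
      = (\<Sum>i<L - 1. f (left_right_path \<sigma> \<eta> (Suc i)) - f (left_right_path \<sigma> \<eta> i))"
    by (rule sum.reindex_bij_witness[of _ Suc "\<lambda>x. x - 1"]) auto
  also have "\<dots> = f \<eta> - f \<sigma>"
    using sum_lessThan_telescope[of "\<lambda>i. f (left_right_path \<sigma> \<eta> i)" "L - 1"] start stop by simp
  finally show ?thesis ..
qed

text \<open>The step at \<open>x\<close> sees only the left part of \<eta> and the right part of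
  \<sigma>. The parts \<open>A\<close> and \<open>B'\<close> enter through weights alone, which
  makes averaging over them possible.\<close>

lemma left_right_path_parts:
  assumes "A \<in> left_parts x" "B \<in> right_parts x L" "A' \<in> left_parts x" "B' \<in> right_parts x L"
    and "\<sigma> = A \<union> B \<or> \<sigma> = insert x (A \<union> B)" and "\<eta> = A' \<union> B' \<or> \<eta> = insert x (A' \<union> B')" and "0 < x"
  shows "left_right_path \<sigma> \<eta> x = (if x \<in> \<eta> then insert x (A' \<union> B) else A' \<union> B)"
    and "left_right_path \<sigma> \<eta> (x - 1) = (if x \<in> \<sigma> then insert x (A' \<union> B) else A' \<union> B)"
proof -
  have A: "A' \<inter> {..x} = A'" "A' \<inter> {..<x} = A'" "A \<inter> {x<..} = {}" "A \<inter> {x..} = {}" "x \<notin> A" "x \<notin> A'"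
    using left_partsD(5)[OF assms(1)] left_partsD(5)[OF assms(3)] by force+
  have B: "B' \<inter> {..x} = {}" "B' \<inter> {..<x} = {}" "B \<inter> {x<..} = B" "B \<inter> {x..} = B" "x \<notin> B" "x \<notin> B'"
    using right_partsD(6)[OF assms(2)] right_partsD(6)[OF assms(4)] by force+
  show "left_right_path \<sigma> \<eta> x = (if x \<in> \<eta> then insert x (A' \<union> B) else A' \<union> B)"
    using assms(5,6) A B by (auto simp: left_right_path_def Int_Un_distrib2)
  have "{..x - 1} = {..<x}" "{x - 1<..} = {x..}" using assms(7) by auto
  then show "left_right_path \<sigma> \<eta> (x - 1) = (if x \<in> \<sigma> then insert x (A' \<union> B) else A' \<union> B)"
    using assms(5,6) A B by (auto simp: left_right_path_def Int_Un_distrib2)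
qed

context pinning
begin

text \<open>Half the mean squared difference of two independent samples, the form in which the two
  configurations can be joined by a path.\<close>

lemma gibbs_var_eq:
  assumes "0 < L"
  shows "gibbs_var \<rho> 1 L f = (\<Sum>\<sigma>\<in>configs L. \<Sum>\<eta>\<in>configs L. set_weight \<sigma> * set_weight \<eta> * (f \<eta> - f \<sigma>)\<^sup>2)
    / (2 * (renewal_mass L)\<^sup>2)"
proof -
  define u where "u = renewal_mass L"
  define S1 where "S1 = (\<Sum>\<eta>\<in>configs L. set_weight \<eta> * f \<eta>)"
  define S2 where "S2 = (\<Sum>\<eta>\<in>configs L. set_weight \<eta> * (f \<eta>)\<^sup>2)"
  define m where "m = S1 / u"
  have u: "u > 0" by (simp add: u_def renewal_mass_pos)
  have "gibbs_var \<rho> 1 L f = (\<Sum>\<eta>\<in>configs L. set_weight \<eta> * (f \<eta> - m)\<^sup>2) / u"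
    using assms by (simp add: gibbs_var_def gibbs_mean_eq m_def S1_def u_def)
  also have "(\<Sum>\<eta>\<in>configs L. set_weight \<eta> * (f \<eta> - m)\<^sup>2)
      = (\<Sum>\<eta>\<in>configs L. set_weight \<eta> * (f \<eta>)\<^sup>2 - 2 * m * (set_weight \<eta> * f \<eta>) + m\<^sup>2 * set_weight \<eta>)"
    by (intro sum.cong refl) (simp add: power2_eq_square algebra_simps)
  also have "\<dots> = S2 - 2 * m * S1 + m\<^sup>2 * u"
    by (simp add: sum.distrib sum_subtractf S1_def S2_def u_def sum_set_weight_configs flip: sum_distrib_left)
  also have "\<dots> / u = (2 * u * S2 - 2 * S1\<^sup>2) / (2 * u\<^sup>2)"
    using u by (simp add: m_def field_simps power2_eq_square)
  also have "2 * u * S2 - 2 * S1\<^sup>2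
      = (\<Sum>\<sigma>\<in>configs L. \<Sum>\<eta>\<in>configs L. set_weight \<sigma> * set_weight \<eta> * (f \<eta> - f \<sigma>)\<^sup>2)"
    unfolding sum_squared_diff by (simp add: S1_def S2_def u_def sum_set_weight_configs)
  finally show ?thesis by (simp add: u_def)
qed

text \<open>The mirror image of \<open>sum_right_jump_over\<close>: seen from \<open>b\<close>, the
  bridging gap leads backwards over \<open>x\<close>, followed by a renewal down to 0.\<close>

lemma sum_left_jump_over:
  assumes "x < b"
  shows "(\<Sum>A\<in>left_parts x. set_weight A * K (b - Max A)) = jump_over (b - x) x"
proof -
  have "(\<Sum>A\<in>left_parts x. set_weight A * K (b - Max A)) = (\<Sum>a<x. renewal_mass a * K (b - a))"
    by (rule sum_left_parts_weight)
  also have "\<dots> = jump_over (b - x) x"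
    unfolding jump_over_def
    by (rule sum.reindex_bij_witness[of _ "\<lambda>j. x - j" "\<lambda>a. x - a"]) (use assms in \<open>auto simp: mult.commute\<close>)
  finally show ?thesis .
qed

lemma sum_right_jump_over:
  assumes "a < x" "x < L"
  shows "(\<Sum>B\<in>right_parts x L. K (Min B - a) * set_weight B) = jump_over (x - a) (L - x)"
proof -
  have "(\<Sum>B\<in>right_parts x L. K (Min B - a) * set_weight B) = (\<Sum>c\<in>{x<..L}. K (c - a) * renewal_mass (L - c))"
    by (rule sum_right_parts_weight)
  also have "\<dots> = jump_over (x - a) (L - x)"
    unfolding jump_over_def
    by (rule sum.reindex_bij_witness[of _ "\<lambda>j. x + j" "\<lambda>c. c - x"]) (use assms in auto)
  finally show ?thesis .
qed

lemma sum_left_renewal_mass: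
  "0 < x \<Longrightarrow> (\<Sum>A\<in>left_parts x. set_weight A * K (x - Max A)) = renewal_mass x"
  using sum_left_parts_weight[of "\<lambda>a. K (x - a)" x] renewal_mass_last_jump[of x] by simp

lemma sum_right_renewal_mass:
  "x < L \<Longrightarrow> (\<Sum>B\<in>right_parts x L. K (Min B - x) * set_weight B) = renewal_mass (L - x)"
  using sum_right_parts_weight[of "\<lambda>c. K (c - x)" x L] renewal_mass_first_jump[of x L] by simp

definition path_step_energy :: "nat \<Rightarrow> (nat set \<Rightarrow> real) \<Rightarrow> nat \<Rightarrow> real" where
  "path_step_energy L f x = (\<Sum>\<sigma>\<in>configs L. \<Sum>\<eta>\<in>configs L. set_weight \<sigma> * set_weight \<eta>
     * (f (left_right_path \<sigma> \<eta> x) - f (left_right_path \<sigma> \<eta> (x - 1)))\<^sup>2)"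

text \<open>Cauchy-Schwarz over the fewer than \<open>L\<close> steps of the path. This is the
  factor \<open>L\<close> in the inverse gap that does not come from congestion.\<close>

lemma sum_path_step_energy:
  assumes "0 < L"
  shows "(\<Sum>\<sigma>\<in>configs L. \<Sum>\<eta>\<in>configs L. set_weight \<sigma> * set_weight \<eta> * (f \<eta> - f \<sigma>)\<^sup>2)
    \<le> real L * (\<Sum>x\<in>{0<..<L}. path_step_energy L f x)"
proof -
  define d where "d \<sigma> \<eta> x = f (left_right_path \<sigma> \<eta> x) - f (left_right_path \<sigma> \<eta> (x - 1))" for \<sigma> \<eta> x
  have sq: "(f \<eta> - f \<sigma>)\<^sup>2 \<le> real L * (\<Sum>x\<in>{0<..<L}. (d \<sigma> \<eta> x)\<^sup>2)"
    if "\<sigma> \<in> configs L" "\<eta> \<in> configs L" for \<sigma> \<eta>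
  proof -
    have "(f \<eta> - f \<sigma>)\<^sup>2 = (\<Sum>x\<in>{0<..<L}. d \<sigma> \<eta> x)\<^sup>2"
      using left_right_path_telescope[OF that assms] by (simp add: d_def)
    also have "\<dots> \<le> (\<Sum>x\<in>{0<..<L}. (d \<sigma> \<eta> x)\<^sup>2) * real (card {0<..<L})"
      by (rule sum_squared_le_sum_of_squares)
    also have "\<dots> \<le> (\<Sum>x\<in>{0<..<L}. (d \<sigma> \<eta> x)\<^sup>2) * real L"
      by (intro mult_left_mono sum_nonneg) auto
    finally show ?thesis by (simp add: mult.commute)
  qed
  have "(\<Sum>\<sigma>\<in>configs L. \<Sum>\<eta>\<in>configs L. set_weight \<sigma> * set_weight \<eta> * (f \<eta> - f \<sigma>)\<^sup>2)
      \<le> (\<Sum>\<sigma>\<in>configs L. \<Sum>\<eta>\<in>configs L. set_weight \<sigma> * set_weight \<eta> * (real L * (\<Sum>x\<in>{0<..<L}. (d \<sigma> \<eta> x)\<^sup>2)))"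
    using sq by (intro sum_mono mult_left_mono mult_nonneg_nonneg set_weight_nonneg)
  also have "\<dots> = real L * (\<Sum>\<sigma>\<in>configs L. \<Sum>\<eta>\<in>configs L. \<Sum>x\<in>{0<..<L}. set_weight \<sigma> * set_weight \<eta> * (d \<sigma> \<eta> x)\<^sup>2)"
    by (simp add: sum_distrib_left mult_ac)
  also have "(\<Sum>\<sigma>\<in>configs L. \<Sum>\<eta>\<in>configs L. \<Sum>x\<in>{0<..<L}. set_weight \<sigma> * set_weight \<eta> * (d \<sigma> \<eta> x)\<^sup>2)
      = (\<Sum>\<sigma>\<in>configs L. \<Sum>x\<in>{0<..<L}. \<Sum>\<eta>\<in>configs L. set_weight \<sigma> * set_weight \<eta> * (d \<sigma> \<eta> x)\<^sup>2)"
    by (intro sum.cong refl sum.swap)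
  also have "\<dots> = (\<Sum>x\<in>{0<..<L}. path_step_energy L f x)"
    unfolding path_step_energy_def d_def by (rule sum.swap)
  finally show ?thesis .
qed

text \<open>
  For the step at \<open>x\<close>, the pair of endpoints \<open>A, B\<close> and \<open>A', B'\<close> is encoded by the visited
  configuration \<open>A', B\<close> and the complementary one \<open>A, B'\<close>; summing over the latter factorizes
  into renewal masses.
\<close>

lemma path_step_energy_parts:
  assumes "0 < x" "x < L"
  shows "path_step_energy L f x = (\<Sum>A'\<in>left_parts x. \<Sum>B\<in>right_parts x L.
    (f (insert x (A' \<union> B)) - f (A' \<union> B))\<^sup>2 * set_weight A' * set_weight B *
      (K (x - Max A') * renewal_mass (L - x) * jump_over (Min B - x) x
       + K (Min B - x) * renewal_mass x * jump_over (x - Max A') (L - x)))"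
proof -
  define g where "g A' B = (f (insert x (A' \<union> B)) - f (A' \<union> B))\<^sup>2" for A' B
  \<comment> \<open>The letter \<open>p\<close> marks a gap bridging \<open>x\<close> and
    \<open>q\<close> a gap between \<open>x\<close> and its neighbour; index 1 carries the weight of
    the left part, index 2 that of the right part.\<close>
  define p1 where "p1 A B = set_weight A * K (Min B - Max A)" for A B
  define p2 where "p2 A B' = K (Min B' - Max A) * set_weight B'" for A B'
  define q1 where "q1 A = set_weight A * K (x - Max A)" for A
  define q2 where "q2 B = K (Min B - x) * set_weight B" for B
  have "path_step_energy L f x
      = (\<Sum>A\<in>left_parts x. \<Sum>B\<in>right_parts x L. \<Sum>A'\<in>left_parts x. \<Sum>B'\<in>right_parts x L.
          g A' B * (set_weight A' * K (x - Max A') * set_weight B * (p1 A B * q2 B')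
            + set_weight A' * q2 B * (q1 A * p2 A' B')))"
    unfolding path_step_energy_def sum_configs_split[OF assms] sum.distrib[symmetric]
  proof (intro sum.cong refl)
    fix A B A' B'
    assume AB: "A \<in> left_parts x" "B \<in> right_parts x L" "A' \<in> left_parts x" "B' \<in> right_parts x L"
    have x: "x \<notin> A \<union> B" "x \<notin> A' \<union> B'"
      using AB by (auto dest: left_partsD(6) right_partsD(8))
    have w: "set_weight (A \<union> B) = p1 A B * set_weight B"
      "set_weight (insert x (A \<union> B)) = q1 A * q2 B"
      "set_weight (A' \<union> B') = set_weight A' * p2 A' B'"
      "set_weight (insert x (A' \<union> B')) = set_weight A' * K (x - Max A') * q2 B'"
      unfolding set_weight_empty_site[OF AB(1,2)] set_weight_filled_site[OF AB(1,2)]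
        set_weight_empty_site[OF AB(3,4)] set_weight_filled_site[OF AB(3,4)] p1_def p2_def q1_def q2_def
      by (simp_all add: mult_ac)
    note path = left_right_path_parts[OF AB _ _ assms(1)]
    have g: "(f (A' \<union> B) - f (insert x (A' \<union> B)))\<^sup>2 = g A' B"
      by (simp add: g_def power2_commute)
    \<comment> \<open>When both endpoints have the same value at \<open>x\<close>, the path does not
      move and the term vanishes. The two mixed combinations are the two summands on the
      right.\<close>
    show "set_weight (A \<union> B) * set_weight (A' \<union> B')
          * (f (left_right_path (A \<union> B) (A' \<union> B') x) - f (left_right_path (A \<union> B) (A' \<union> B') (x - 1)))\<^sup>2
        + set_weight (A \<union> B) * set_weight (insert x (A' \<union> B'))
          * (f (left_right_path (A \<union> B) (insert x (A' \<union> B')) x)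
             - f (left_right_path (A \<union> B) (insert x (A' \<union> B')) (x - 1)))\<^sup>2
        + (set_weight (insert x (A \<union> B)) * set_weight (A' \<union> B')
          * (f (left_right_path (insert x (A \<union> B)) (A' \<union> B') x)
             - f (left_right_path (insert x (A \<union> B)) (A' \<union> B') (x - 1)))\<^sup>2
        + set_weight (insert x (A \<union> B)) * set_weight (insert x (A' \<union> B'))
          * (f (left_right_path (insert x (A \<union> B)) (insert x (A' \<union> B')) x)
             - f (left_right_path (insert x (A \<union> B)) (insert x (A' \<union> B')) (x - 1)))\<^sup>2)
        = g A' B * (set_weight A' * K (x - Max A') * set_weight B * (p1 A B * q2 B')
            + set_weight A' * q2 B * (q1 A * p2 A' B'))"
      using x unfolding w
        path[OF disjI1[OF refl] disjI1[OF refl]] path[OF disjI1[OF refl] disjI2[OF refl]]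
        path[OF disjI2[OF refl] disjI1[OF refl]] path[OF disjI2[OF refl] disjI2[OF refl]]
      by (simp add: g g_def[symmetric] algebra_simps)
  qed
  also have "\<dots> = (\<Sum>A'\<in>left_parts x. \<Sum>B\<in>right_parts x L. \<Sum>A\<in>left_parts x. \<Sum>B'\<in>right_parts x L.
          g A' B * (set_weight A' * K (x - Max A') * set_weight B * (p1 A B * q2 B')
            + set_weight A' * q2 B * (q1 A * p2 A' B')))"
    by (rule sum_swap_outer)
  also have "\<dots> = (\<Sum>A'\<in>left_parts x. \<Sum>B\<in>right_parts x L. g A' B
      * (set_weight A' * K (x - Max A') * set_weight B
          * ((\<Sum>A\<in>left_parts x. p1 A B) * (\<Sum>B'\<in>right_parts x L. q2 B'))
        + set_weight A' * q2 B * ((\<Sum>A\<in>left_parts x. q1 A) * (\<Sum>B'\<in>right_parts x L. p2 A' B'))))"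
    by (simp add: sum_product sum.distrib flip: sum_distrib_left)
  also have "\<dots> = (\<Sum>A'\<in>left_parts x. \<Sum>B\<in>right_parts x L.
    g A' B * set_weight A' * set_weight B *
      (K (x - Max A') * renewal_mass (L - x) * jump_over (Min B - x) x
       + K (Min B - x) * renewal_mass x * jump_over (x - Max A') (L - x)))"
  proof (intro sum.cong refl)
    fix A' B assume AB: "A' \<in> left_parts x" "B \<in> right_parts x L"
    have sums: "(\<Sum>A\<in>left_parts x. p1 A B) = jump_over (Min B - x) x"
      "(\<Sum>B'\<in>right_parts x L. q2 B') = renewal_mass (L - x)"
      "(\<Sum>A\<in>left_parts x. q1 A) = renewal_mass x"
      "(\<Sum>B'\<in>right_parts x L. p2 A' B') = jump_over (x - Max A') (L - x)"
      unfolding p1_def q2_def q1_def p2_def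
      using left_partsD(4)[OF AB(1)] right_partsD(4)[OF AB(2)] assms
      by (simp_all add: sum_left_jump_over sum_right_renewal_mass sum_left_renewal_mass sum_right_jump_over)
    show "g A' B
      * (set_weight A' * K (x - Max A') * set_weight B
          * ((\<Sum>A\<in>left_parts x. p1 A B) * (\<Sum>B'\<in>right_parts x L. q2 B'))
        + set_weight A' * q2 B * ((\<Sum>A\<in>left_parts x. q1 A) * (\<Sum>B'\<in>right_parts x L. p2 A' B')))
      = g A' B * set_weight A' * set_weight B *
      (K (x - Max A') * renewal_mass (L - x) * jump_over (Min B - x) x
       + K (Min B - x) * renewal_mass x * jump_over (x - Max A') (L - x))"
      unfolding sums by (simp add: q2_def algebra_simps)
  qed
  finally show ?thesis by (simp add: g_def)
qed

text \<open>The congestion bound is applied at \<open>x\<close> with the left gap and, reflected, at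
  \<open>L - x\<close> with the right gap. Both give \<open>M * K * K\<close> over the two gaps at
  \<open>x\<close>, that is, the weight of the filled configuration. The factor 10 is two such terms
  times the 5 of \<open>set_weight_filled_le_conductance\<close>; the variance formula halves
  it.\<close>

lemma poincare: "\<exists>C>0. \<forall>L>0. \<forall>f. gibbs_var \<rho> 1 L f \<le> C * real L powr (1 + \<rho>) * energy L f f"
proof -
  obtain C where C: "C > 0" "\<And>x L k. 0 < x \<Longrightarrow> x < L \<Longrightarrow> 0 < k \<Longrightarrow> k \<le> x \<Longrightarrow>
     renewal_mass x * jump_over k (L - x) \<le> C * real L powr \<rho> * renewal_mass L * K k"
    using congestion_bound by blast
  have "gibbs_var \<rho> 1 L f \<le> 5 * C * real L powr (1 + \<rho>) * energy L f f" if L: "L > 0" for L f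
  proof -
    define u where "u = renewal_mass L"
    have u: "u > 0" by (simp add: u_def renewal_mass_pos)
    define M where "M = C * real L powr \<rho> * u"
    have M: "M \<ge> 0" using C(1) u by (simp add: M_def)
    have step: "path_step_energy L f x \<le> (\<Sum>A\<in>left_parts x. \<Sum>B\<in>right_parts x L. 10 * M * (conductance x A B
      * (f (A \<union> B) - f (insert x (A \<union> B))) * (f (A \<union> B) - f (insert x (A \<union> B)))))" if x: "0 < x" "x < L" for x
      unfolding path_step_energy_parts[OF x]
    proof (intro sum_mono)
      fix A B assume AB: "A \<in> left_parts x" "B \<in> right_parts x L"
      note A = left_partsD[OF AB(1)] and B = right_partsD[OF AB(2)]
      have 1: "renewal_mass (L - x) * jump_over (Min B - x) x \<le> M * K (Min B - x)"
        using C(2)[of "L - x" L "Min B - x"] x B(4,5) by (simp add: M_def u_def)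
      have 2: "renewal_mass x * jump_over (x - Max A) (L - x) \<le> M * K (x - Max A)"
        using C(2)[of x L "x - Max A"] x A(4) by (simp add: M_def u_def)
      have "K (x - Max A) * (renewal_mass (L - x) * jump_over (Min B - x) x)
          + K (Min B - x) * (renewal_mass x * jump_over (x - Max A) (L - x))
          \<le> K (x - Max A) * (M * K (Min B - x)) + K (Min B - x) * (M * K (x - Max A))"
        by (intro add_mono mult_left_mono 1 2 K_nonneg)
      also have "\<dots> = 2 * M * (K (x - Max A) * K (Min B - x))" by simp
      finally have "set_weight A * set_weight B * (K (x - Max A) * renewal_mass (L - x) * jump_over (Min B - x) x
       + K (Min B - x) * renewal_mass x * jump_over (x - Max A) (L - x))
       \<le> set_weight A * set_weight B * (2 * M * (K (x - Max A) * K (Min B - x)))"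
        by (intro mult_left_mono mult_nonneg_nonneg set_weight_nonneg) (simp add: mult.assoc)
      also have "\<dots> = 2 * M * set_weight (insert x (A \<union> B))"
        by (simp add: set_weight_filled_site[OF AB])
      also have "\<dots> \<le> 2 * M * (5 * conductance x A B)"
        using M set_weight_filled_le_conductance[OF AB] by (intro mult_left_mono) auto
      finally have "(f (insert x (A \<union> B)) - f (A \<union> B))\<^sup>2 * (set_weight A * set_weight B * (K (x - Max A) * renewal_mass (L - x) * jump_over (Min B - x) x
       + K (Min B - x) * renewal_mass x * jump_over (x - Max A) (L - x)))
        \<le> (f (insert x (A \<union> B)) - f (A \<union> B))\<^sup>2 * (2 * M * (5 * conductance x A B))"
        by (intro mult_left_mono) auto
      also have "\<dots> = 10 * M * (conductance x A B * (f (A \<union> B) - f (insert x (A \<union> B))) * (f (A \<union> B) - f (insert x (A \<union> B))))"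
        by (simp add: power2_eq_square algebra_simps)
      finally show "(f (insert x (A \<union> B)) - f (A \<union> B))\<^sup>2 * set_weight A * set_weight B * (K (x - Max A) * renewal_mass (L - x) * jump_over (Min B - x) x
       + K (Min B - x) * renewal_mass x * jump_over (x - Max A) (L - x))
        \<le> 10 * M * (conductance x A B * (f (A \<union> B) - f (insert x (A \<union> B))) * (f (A \<union> B) - f (insert x (A \<union> B))))"
        by (simp add: mult.assoc)
    qed
    have "(\<Sum>x\<in>{0<..<L}. path_step_energy L f x) \<le> (\<Sum>x\<in>{0<..<L}. \<Sum>A\<in>left_parts x. \<Sum>B\<in>right_parts x L.
      10 * M * (conductance x A B
      * (f (A \<union> B) - f (insert x (A \<union> B))) * (f (A \<union> B) - f (insert x (A \<union> B)))))"
      by (intro sum_mono step) auto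
    also have "\<dots> = 10 * M * (energy L f f * u)"
      using u by (simp add: energy_def u_def flip: sum_distrib_left)
    finally have "real L * (\<Sum>x\<in>{0<..<L}. path_step_energy L f x) \<le> real L * (10 * M * (energy L f f * u))"
      by (intro mult_left_mono) auto
    with sum_path_step_energy[OF L, of f]
    have "(\<Sum>\<sigma>\<in>configs L. \<Sum>\<eta>\<in>configs L. set_weight \<sigma> * set_weight \<eta> * (f \<eta> - f \<sigma>)\<^sup>2)
      \<le> real L * (10 * M * (energy L f f * u))" by linarith
    then have "gibbs_var \<rho> 1 L f \<le> real L * (10 * M * (energy L f f * u)) / (2 * u\<^sup>2)"
      unfolding gibbs_var_eq[OF L] u_def by (intro divide_right_mono) auto
    also have "\<dots> = 5 * C * (real L * real L powr \<rho>) * energy L f f"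
      using u by (simp add: M_def power2_eq_square)
    also have "real L * real L powr \<rho> = real L powr (1 + \<rho>)"
      using L by (simp add: powr_add)
    finally show ?thesis .
  qed
  moreover have "5 * C > 0" using C(1) by simp
  ultimately show ?thesis by blast
qed

end

section \<open>Semigroup and mixing times\<close>

lemma heat_bath_sum:
  "heat_bath \<rho> lam L x (\<lambda>\<eta>. \<Sum>i\<in>I. c i * h i \<eta>) \<sigma> = (\<Sum>i\<in>I. c i * heat_bath \<rho> lam L x (h i) \<sigma>)"
proof -
  have "(\<Sum>\<xi>\<in>agree_off L x \<sigma>. gibbs \<rho> lam L \<xi> * (\<Sum>i\<in>I. c i * h i \<xi>))
      = (\<Sum>\<xi>\<in>agree_off L x \<sigma>. \<Sum>i\<in>I. c i * (gibbs \<rho> lam L \<xi> * h i \<xi>))"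
    by (simp add: sum_distrib_left mult_ac)
  also have "\<dots> = (\<Sum>i\<in>I. c i * (\<Sum>\<xi>\<in>agree_off L x \<sigma>. gibbs \<rho> lam L \<xi> * h i \<xi>))"
    unfolding sum_distrib_left by (rule sum.swap)
  finally show ?thesis unfolding heat_bath_def by (simp only: sum_divide_distrib[of _ I] times_divide_eq_right)
qed

lemma generator_sum:
  "generator \<rho> lam L (\<lambda>\<eta>. \<Sum>i\<in>I. c i * h i \<eta>) = (\<lambda>\<sigma>. \<Sum>i\<in>I. c i * generator \<rho> lam L (h i) \<sigma>)"
proof
  fix \<sigma>
  have "generator \<rho> lam L (\<lambda>\<eta>. \<Sum>i\<in>I. c i * h i \<eta>) \<sigma>
      = (\<Sum>x\<in>{0<..<L}. \<Sum>i\<in>I. c i * (heat_bath \<rho> lam L x (h i) \<sigma> - h i \<sigma>))"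
    unfolding generator_def heat_bath_sum by (simp add: sum_subtractf right_diff_distrib)
  also have "\<dots> = (\<Sum>i\<in>I. c i * generator \<rho> lam L (h i) \<sigma>)"
    unfolding generator_def sum_distrib_left by (rule sum.swap)
  finally show "generator \<rho> lam L (\<lambda>\<eta>. \<Sum>i\<in>I. c i * h i \<eta>) \<sigma> = (\<Sum>i\<in>I. c i * generator \<rho> lam L (h i) \<sigma>)" .
qed

lemma generator_cong:
  assumes "\<And>\<xi>. \<xi> \<in> configs L \<Longrightarrow> f \<xi> = g \<xi>" "\<sigma> \<in> configs L"
  shows "generator \<rho> lam L f \<sigma> = generator \<rho> lam L g \<sigma>"
proof -
  have "heat_bath \<rho> lam L x f \<sigma> = heat_bath \<rho> lam L x g \<sigma>" for x
    unfolding heat_bath_def using assms(1)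
    by (intro arg_cong2[where f = "(/)"] sum.cong refl) (auto simp: agree_off_def)
  then show ?thesis using assms by (simp add: generator_def)
qed

lemma sum_indicator_singleton:
  assumes "\<xi> \<in> configs L"
  shows "(\<Sum>\<eta>\<in>configs L. f \<eta> * indicator {\<eta>} \<xi>) = (f \<xi> :: real)"
proof -
  have "(\<Sum>\<eta>\<in>configs L. f \<eta> * indicator {\<eta>} \<xi>) = (\<Sum>\<eta>\<in>configs L. if \<eta> = \<xi> then f \<eta> else 0)"
    by (intro sum.cong) (auto simp: indicator_def)
  then show ?thesis using assms finite_configs[of L] by simp
qed

lemma generator_expand:
  assumes "\<sigma> \<in> configs L"
  shows "generator \<rho> lam L f \<sigma> = (\<Sum>\<eta>\<in>configs L. f \<eta> * generator \<rho> lam L (indicator {\<eta>}) \<sigma>)"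
proof -
  have "generator \<rho> lam L f \<sigma> = generator \<rho> lam L (\<lambda>\<xi>. \<Sum>\<eta>\<in>configs L. f \<eta> * indicator {\<eta>} \<xi>) \<sigma>"
    by (rule generator_cong[OF _ assms]) (simp add: sum_indicator_singleton)
  then show ?thesis unfolding generator_sum .
qed

text \<open>In the basis of indicators the generator acts as a finite matrix on
  \<open>configs L\<close>, so series in \<open>t\<close> can be exchanged with it and with
  means.\<close>

lemma generator_power_expand:
  assumes "\<sigma> \<in> configs L"
  shows "(generator \<rho> lam L ^^ n) f \<sigma> = (\<Sum>\<eta>\<in>configs L. f \<eta> * (generator \<rho> lam L ^^ n) (indicator {\<eta>}) \<sigma>)"
  using assms
proof (induction n arbitrary: \<sigma>)
  case 0
  then show ?case by (simp add: sum_indicator_singleton)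
next
  case (Suc n)
  have "(generator \<rho> lam L ^^ Suc n) f \<sigma>
      = generator \<rho> lam L (\<lambda>\<xi>. \<Sum>\<eta>\<in>configs L. f \<eta> * (generator \<rho> lam L ^^ n) (indicator {\<eta>}) \<xi>) \<sigma>"
    using Suc by (auto intro!: generator_cong)
  then show ?case unfolding generator_sum by simp
qed

lemma gibbs_mean_cong:
  "(\<And>\<eta>. \<eta> \<in> configs L \<Longrightarrow> f \<eta> = g \<eta>) \<Longrightarrow> gibbs_mean \<rho> lam L f = gibbs_mean \<rho> lam L g"
  by (simp add: gibbs_mean_def)

lemma has_real_derivative_gibbs_mean:
  assumes "\<And>\<eta>. \<eta> \<in> configs L \<Longrightarrow> ((\<lambda>t. F t \<eta>) has_real_derivative F' \<eta>) (at t)"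
  shows "((\<lambda>t. gibbs_mean \<rho> lam L (F t)) has_real_derivative gibbs_mean \<rho> lam L F') (at t)"
  unfolding gibbs_mean_def by (intro DERIV_sum DERIV_cmult assms)

context pinning
begin

abbreviation "gen L \<equiv> generator \<rho> 1 L"

abbreviation "semi L \<equiv> semigroup_op \<rho> 1 L"

abbreviation "mean L \<equiv> gibbs_mean \<rho> 1 L"

lemma semi_summable: "\<sigma> \<in> configs L \<Longrightarrow> summable (\<lambda>n. t ^ n / fact n * (gen L ^^ n) f \<sigma>)"
  using rho_pos by (intro semigroup_op_summable) auto

lemma semi_expand:
  assumes "\<sigma> \<in> configs L"
  shows "semi L t f \<sigma> = (\<Sum>\<eta>\<in>configs L. f \<eta> * chain_law \<rho> 1 L t \<sigma> \<eta>)"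
proof -
  have "semi L t f \<sigma> = (\<Sum>n. \<Sum>\<eta>\<in>configs L. f \<eta> * (t ^ n / fact n * (gen L ^^ n) (indicator {\<eta>}) \<sigma>))"
    unfolding semigroup_op_def generator_power_expand[OF assms, where f = f]
    by (simp add: sum_distrib_left mult_ac)
  also have "\<dots> = (\<Sum>\<eta>\<in>configs L. \<Sum>n. f \<eta> * (t ^ n / fact n * (gen L ^^ n) (indicator {\<eta>}) \<sigma>))"
    by (intro suminf_sum summable_mult semi_summable assms)
  also have "\<dots> = (\<Sum>\<eta>\<in>configs L. f \<eta> * chain_law \<rho> 1 L t \<sigma> \<eta>)"
    unfolding chain_law_def semigroup_op_def
    by (intro sum.cong refl suminf_mult semi_summable assms)
  finally show ?thesis .
qed

lemma gen_semi:
  assumes "\<sigma> \<in> configs L"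
  shows "gen L (semi L t f) \<sigma> = semi L t (gen L f) \<sigma>"
proof -
  have "gen L (semi L t f) \<sigma>
      = (\<Sum>\<eta>\<in>configs L. \<Sum>n. t ^ n / fact n * (gen L ^^ n) f \<eta> * gen L (indicator {\<eta>}) \<sigma>)"
    unfolding generator_expand[OF assms, of \<rho> 1 "semi L t f"] unfolding semigroup_op_def
    by (intro sum.cong refl suminf_mult2 semi_summable)
  also have "\<dots> = (\<Sum>n. \<Sum>\<eta>\<in>configs L. t ^ n / fact n * (gen L ^^ n) f \<eta> * gen L (indicator {\<eta>}) \<sigma>)"
    by (intro suminf_sum[symmetric] summable_mult2 semi_summable)
  also have "\<dots> = (\<Sum>n. t ^ n / fact n * gen L ((gen L ^^ n) f) \<sigma>)"
    by (subst (2) generator_expand[OF assms]) (simp add: sum_distrib_left mult_ac)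
  also have "\<dots> = semi L t (gen L f) \<sigma>"
    by (simp add: semigroup_op_def funpow_swap1)
  finally show ?thesis .
qed

lemma semi_has_derivative:
  assumes "\<sigma> \<in> configs L"
  shows "((\<lambda>t. semi L t f \<sigma>) has_real_derivative gen L (semi L t f) \<sigma>) (at t)"
proof -
  define c where "c n = (gen L ^^ n) f \<sigma> / fact n" for n
  have "((\<lambda>t. \<Sum>n. c n * t ^ n) has_real_derivative (\<Sum>n. diffs c n * t ^ n)) (at t)"
  proof (rule termdiffs_strong_converges_everywhere)
    show "summable (\<lambda>n. c n * y ^ n)" for y
      using semi_summable[OF assms, of y f] by (simp add: c_def mult.commute)
  qed
  moreover have "(\<lambda>t. \<Sum>n. c n * t ^ n) = (\<lambda>t. semi L t f \<sigma>)"
    by (simp add: semigroup_op_def c_def mult.commute)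
  moreover have "diffs c n * t ^ n = t ^ n / fact n * (gen L ^^ n) (gen L f) \<sigma>" for n
    by (simp add: diffs_def c_def funpow_swap1 del: of_nat_Suc)
  ultimately show ?thesis
    using gen_semi[OF assms, of t f] by (simp add: semigroup_op_def)
qed

lemma semi_0: "semi L 0 f \<sigma> = f \<sigma>"
  using powser_zero[of "\<lambda>n. (gen L ^^ n) f \<sigma> / fact n"] by (simp add: semigroup_op_def mult.commute)

section \<open>Variance, energy and correlations along the semigroup\<close>

lemma gibbs_pos: "\<eta> \<in> configs L \<Longrightarrow> 0 < L \<Longrightarrow> 0 < gibbs \<rho> 1 L \<eta>"
  by (simp add: gibbs_eq set_weight_configs_pos renewal_mass_pos)

lemma mean_const: "0 < L \<Longrightarrow> mean L (\<lambda>_. c) = c"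
  using renewal_mass_pos[of L] by (simp add: gibbs_mean_eq sum_set_weight_configs flip: sum_distrib_right)

lemma mean_mono: "0 < L \<Longrightarrow> (\<And>\<eta>. \<eta> \<in> configs L \<Longrightarrow> f \<eta> \<le> g \<eta>) \<Longrightarrow> mean L f \<le> mean L g"
  unfolding gibbs_mean_def by (intro sum_mono mult_left_mono) (auto intro: less_imp_le gibbs_pos)

lemma mean_nonneg: "0 < L \<Longrightarrow> (\<And>\<eta>. \<eta> \<in> configs L \<Longrightarrow> 0 \<le> f \<eta>) \<Longrightarrow> 0 \<le> mean L f"
  using mean_mono[of L "\<lambda>_. 0" f] mean_const[of L 0] by simp

lemma mean_add: "mean L (\<lambda>\<eta>. f \<eta> + g \<eta>) = mean L f + mean L g"
  by (simp add: gibbs_mean_def distrib_left sum.distrib)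

lemma mean_diff: "mean L (\<lambda>\<eta>. f \<eta> - g \<eta>) = mean L f - mean L g"
  by (simp add: gibbs_mean_def right_diff_distrib sum_subtractf)

lemma mean_cmult: "mean L (\<lambda>\<eta>. c * f \<eta>) = c * mean L f"
  by (simp add: gibbs_mean_def sum_distrib_left mult_ac)

lemma energy_nonneg: "energy L f f \<ge> 0"
  unfolding energy_def
  by (intro divide_nonneg_nonneg sum_nonneg renewal_mass_nonneg)
     (simp add: conductance_nonneg mult.assoc)

lemma energy_commute: "energy L f g = energy L g f"
  unfolding energy_def by (simp only: mult.assoc mult.commute[of "f _ - f _"])

lemma energy_add_const: "energy L (\<lambda>\<eta>. f \<eta> - c) g = energy L f g" "energy L (\<lambda>_. c) g = 0"
  by (simp_all add: energy_def)

text \<open>The elementary average replaces Cauchy-Schwarz. It loses nothing in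
  \<open>autocorrelation_ge\<close>, where the energy of \<open>g\<close> is at most that of
  \<open>f\<close>.\<close>

lemma energy_le_average: "energy L f g \<le> (energy L f f + energy L g g) / 2"
proof -
  have mult_le: "a * b * c \<le> (a * b * b + a * c * c) / 2" if "a \<ge> 0" for a b c :: real
  proof -
    have "a * (b - c)\<^sup>2 \<ge> 0" using that by simp
    then show ?thesis by (simp add: power2_eq_square algebra_simps)
  qed
  define d where "d h x A B = h (A \<union> B) - h (insert x (A \<union> B))" for h :: "nat set \<Rightarrow> real" and x A B
  define E where "E f g = (\<Sum>x\<in>{0<..<L}. \<Sum>A\<in>left_parts x. \<Sum>B\<in>right_parts x L.
    conductance x A B * d f x A B * d g x A B)" for f g
  have E: "energy L f g = E f g / renewal_mass L" for f g by (simp add: energy_def E_def d_def)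
  have "E f g \<le> (\<Sum>x\<in>{0<..<L}. \<Sum>A\<in>left_parts x. \<Sum>B\<in>right_parts x L.
    (conductance x A B * d f x A B * d f x A B + conductance x A B * d g x A B * d g x A B) / 2)"
    unfolding E_def by (intro sum_mono mult_le conductance_nonneg)
  also have "\<dots> = (E f f + E g g) / 2"
    by (simp add: E_def sum.distrib flip: sum_divide_distrib)
  finally have "E f g / renewal_mass L \<le> (E f f + E g g) / 2 / renewal_mass L"
    by (intro divide_right_mono renewal_mass_nonneg)
  then show ?thesis by (simp add: E add_divide_distrib)
qed

lemma mean_semi:
  assumes "0 < L"
  shows "mean L (semi L t f) = mean L f"
proof -
  have "((\<lambda>t. mean L (semi L t f)) has_real_derivative 0) (at t)" for t
  proof -
    have "((\<lambda>t. mean L (semi L t f)) has_real_derivative mean L (gen L (semi L t f))) (at t)"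
      by (intro has_real_derivative_gibbs_mean semi_has_derivative)
    moreover have "mean L (gen L (semi L t f)) = 0"
      using gibbs_mean_generator[OF assms, of "\<lambda>_. 1" "semi L t f"] by (simp add: energy_add_const)
    ultimately show ?thesis by simp
  qed
  then have "mean L (semi L t f) = mean L (semi L 0 f)"
    by (intro DERIV_isconst_all) auto
  then show ?thesis by (simp add: semi_0[abs_def])
qed

text \<open>The mean is conserved, so the variance has derivative minus twice the energy;
  \<open>exp (2 * \<gamma> * t)\<close> is the integrating factor.\<close>

lemma var_decay:
  assumes L: "0 < L" and gap: "\<And>f. \<gamma> * gibbs_var \<rho> 1 L f \<le> energy L f f" and t: "0 \<le> t"
  shows "gibbs_var \<rho> 1 L (semi L t f) \<le> exp (- 2 * \<gamma> * t) * gibbs_var \<rho> 1 L f"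
proof -
  define y where "y t = gibbs_var \<rho> 1 L (semi L t f)" for t
  define m where "m = mean L f"
  have y: "y t = mean L (\<lambda>\<eta>. (semi L t f \<eta> - m)\<^sup>2)" for t
    unfolding y_def gibbs_var_def mean_semi[OF L] m_def ..
  have y': "(y has_real_derivative - 2 * energy L (semi L t f) (semi L t f)) (at t)" for t
  proof -
    have "((\<lambda>t. mean L (\<lambda>\<eta>. (semi L t f \<eta> - m)\<^sup>2)) has_real_derivative
        mean L (\<lambda>\<eta>. 2 * ((semi L t f \<eta> - m) * gen L (semi L t f) \<eta>))) (at t)"
      by (rule has_real_derivative_gibbs_mean) (auto intro!: derivative_eq_intros semi_has_derivative)
    moreover have "mean L (\<lambda>\<eta>. 2 * ((semi L t f \<eta> - m) * gen L (semi L t f) \<eta>))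
        = - 2 * energy L (semi L t f) (semi L t f)"
      unfolding mean_cmult gibbs_mean_generator[OF L] energy_add_const by simp
    ultimately show ?thesis by (simp add: y[abs_def])
  qed
  have "exp (2 * \<gamma> * t) * y t \<le> exp (2 * \<gamma> * 0) * y 0"
  proof (rule DERIV_nonpos_imp_nonincreasing[OF t])
    fix s
    have "((\<lambda>t. exp (2 * \<gamma> * t) * y t) has_real_derivative
        2 * exp (2 * \<gamma> * s) * (\<gamma> * y s - energy L (semi L s f) (semi L s f))) (at s)"
      by (auto intro!: derivative_eq_intros y' simp: algebra_simps)
    moreover have "2 * exp (2 * \<gamma> * s) * (\<gamma> * y s - energy L (semi L s f) (semi L s f)) \<le> 0"
      using gap[of "semi L s f"] by (intro mult_nonneg_nonpos) (auto simp: y_def)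
    ultimately show "\<exists>z. ((\<lambda>t. exp (2 * \<gamma> * t) * y t) has_real_derivative z) (at s) \<and> z \<le> 0" by blast
  qed
  then have "exp (- (2 * \<gamma> * t)) * (exp (2 * \<gamma> * t) * y t) \<le> exp (- (2 * \<gamma> * t)) * y 0"
    by (intro mult_left_mono) auto
  then have "y t \<le> exp (- (2 * \<gamma> * t)) * y 0"
    by (simp add: mult.assoc[symmetric] flip: exp_add)
  then show ?thesis by (simp add: y_def semi_0[abs_def])
qed

text \<open>The dissipation of the semigroup decreases in time, so correlations decay at most linearly.\<close>

lemma energy_semi_le:
  assumes L: "0 < L" and t: "0 \<le> t"
  shows "energy L (semi L t f) (semi L t f) \<le> energy L f f"
proof -
  define e where "e t = energy L (semi L t f) (semi L t f)" for t
  have e: "e t = - mean L (\<lambda>\<eta>. semi L t f \<eta> * semi L t (gen L f) \<eta>)" for t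
  proof -
    have "mean L (\<lambda>\<eta>. semi L t f \<eta> * semi L t (gen L f) \<eta>) = mean L (\<lambda>\<eta>. semi L t f \<eta> * gen L (semi L t f) \<eta>)"
      by (intro gibbs_mean_cong) (simp add: gen_semi)
    then show ?thesis unfolding e_def gibbs_mean_generator[OF L] by simp
  qed
  have "e t \<le> e 0"
  proof (rule DERIV_nonpos_imp_nonincreasing[OF t])
    fix s
    define h where "h = semi L s (gen L f)"
    have h: "gen L (semi L s f) \<eta> = h \<eta>" if "\<eta> \<in> configs L" for \<eta>
      using gen_semi[OF that] by (simp add: h_def)
    \<comment> \<open>By reversibility both summands have the same mean, so the derivative is minus
      twice the mean square of \<open>h\<close>.\<close>
    have "(e has_real_derivative - mean L (\<lambda>\<eta>. gen L (semi L s f) \<eta> * h \<eta> + semi L s f \<eta> * gen L h \<eta>)) (at s)"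
      unfolding e[abs_def] h_def
      by (intro DERIV_minus has_real_derivative_gibbs_mean) (auto intro!: derivative_eq_intros semi_has_derivative)
    moreover have "mean L (\<lambda>\<eta>. gen L (semi L s f) \<eta> * h \<eta> + semi L s f \<eta> * gen L h \<eta>)
        = mean L (\<lambda>\<eta>. h \<eta> * gen L (semi L s f) \<eta>) - energy L (semi L s f) h"
      using gibbs_mean_generator[OF L, of "semi L s f" h] by (simp add: mean_add mult.commute)
    moreover have "energy L (semi L s f) h = - mean L (\<lambda>\<eta>. h \<eta> * gen L (semi L s f) \<eta>)"
      using gibbs_mean_generator[OF L, of h "semi L s f"] by (simp add: energy_commute)
    moreover have "mean L (\<lambda>\<eta>. h \<eta> * gen L (semi L s f) \<eta>) \<ge> 0"
      using h by (intro mean_nonneg L) simp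
    ultimately show "\<exists>z. (e has_real_derivative z) (at s) \<and> z \<le> 0"
      by (intro exI conjI) (assumption, simp)
  qed
  then show ?thesis by (simp add: e_def semi_0[abs_def])
qed

text \<open>The slope at time \<open>s\<close> is minus the mixed energy of \<open>f\<close> and
  \<open>semi L s f\<close>, and this mixed energy is at most \<open>energy L f f\<close>.\<close>

lemma autocorrelation_ge:
  assumes L: "0 < L" and t: "0 \<le> t"
  shows "mean L (\<lambda>\<eta>. f \<eta> * f \<eta>) - t * energy L f f \<le> mean L (\<lambda>\<eta>. f \<eta> * semi L t f \<eta>)"
proof -
  define y where "y t = mean L (\<lambda>\<eta>. f \<eta> * semi L t f \<eta>) + t * energy L f f" for t
  have "y 0 \<le> y t"
  proof (rule DERIV_nonneg_imp_nondecreasing[OF t])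
    fix s :: real assume s: "0 \<le> s"
    have "(y has_real_derivative mean L (\<lambda>\<eta>. f \<eta> * gen L (semi L s f) \<eta>) + energy L f f) (at s)"
      unfolding y_def[abs_def]
      by (intro DERIV_add has_real_derivative_gibbs_mean DERIV_cmult semi_has_derivative)
         (auto intro!: derivative_eq_intros)
    moreover have "mean L (\<lambda>\<eta>. f \<eta> * gen L (semi L s f) \<eta>) + energy L f f \<ge> 0"
      unfolding gibbs_mean_generator[OF L]
      using energy_le_average[of L f "semi L s f"] energy_semi_le[OF L s, of f] by simp
    ultimately show "\<exists>z. (y has_real_derivative z) (at s) \<and> 0 \<le> z" by blast
  qed
  then show ?thesis by (simp add: y_def semi_0)
qed

text \<open>One term of the variance. Passing from mean square decay to a fixed starting point thus
  costs the inverse of its probability.\<close>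

lemma sq_deviation_le_var:
  assumes "0 < L" "\<sigma> \<in> configs L"
  shows "gibbs \<rho> 1 L \<sigma> * (f \<sigma> - mean L f)\<^sup>2 \<le> gibbs_var \<rho> 1 L f"
  unfolding gibbs_var_def gibbs_mean_def[of \<rho> 1 L "\<lambda>\<eta>. (f \<eta> - mean L f)\<^sup>2"]
  using assms finite_configs
  by (intro member_le_sum) (auto intro!: mult_nonneg_nonneg less_imp_le[OF gibbs_pos])

lemma gibbs_var_le_1:
  assumes "0 < L" "\<And>\<eta>. \<eta> \<in> configs L \<Longrightarrow> \<bar>f \<eta>\<bar> \<le> 1"
  shows "gibbs_var \<rho> 1 L f \<le> 1"
proof -
  define m where "m = mean L f"
  have "gibbs_var \<rho> 1 L f = mean L (\<lambda>\<eta>. (f \<eta>)\<^sup>2 - 2 * m * f \<eta> + m\<^sup>2)"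
    unfolding gibbs_var_def m_def by (simp add: power2_diff algebra_simps)
  also have "\<dots> = mean L (\<lambda>\<eta>. (f \<eta>)\<^sup>2) - m\<^sup>2"
    unfolding mean_add mean_diff mean_cmult mean_const[OF assms(1)] by (simp add: m_def power2_eq_square)
  also have "\<dots> \<le> mean L (\<lambda>\<eta>. (f \<eta>)\<^sup>2)" by simp
  also have "\<dots> \<le> mean L (\<lambda>_. 1)"
    using assms by (intro mean_mono) (auto simp: abs_square_le_1)
  finally show ?thesis using mean_const[OF assms(1)] by simp
qed

text \<open>The sign of the difference of the two laws is the extremal test function: twice the
  distance is its deviation \<open>semi L t f \<sigma> - mean L f\<close>, and its variance is at
  most 1.\<close>

lemma tv_dist_le:
  assumes L: "0 < L" and gap: "\<And>f. \<gamma> * gibbs_var \<rho> 1 L f \<le> energy L f f" and t: "0 \<le> t"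
    and \<sigma>: "\<sigma> \<in> configs L"
  shows "(2 * tv_dist L (chain_law \<rho> 1 L t \<sigma>) (gibbs \<rho> 1 L))\<^sup>2 * gibbs \<rho> 1 L \<sigma> \<le> exp (- 2 * \<gamma> * t)"
proof -
  define f where "f \<eta> = sgn (chain_law \<rho> 1 L t \<sigma> \<eta> - gibbs \<rho> 1 L \<eta>)" for \<eta>
  have "2 * tv_dist L (chain_law \<rho> 1 L t \<sigma>) (gibbs \<rho> 1 L)
      = (\<Sum>\<eta>\<in>configs L. f \<eta> * chain_law \<rho> 1 L t \<sigma> \<eta> - gibbs \<rho> 1 L \<eta> * f \<eta>)"
    by (simp add: tv_dist_def f_def abs_sgn algebra_simps)
  also have "\<dots> = semi L t f \<sigma> - mean L f"
    by (simp add: sum_subtractf semi_expand[OF \<sigma>] gibbs_mean_def)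
  finally have tv: "2 * tv_dist L (chain_law \<rho> 1 L t \<sigma>) (gibbs \<rho> 1 L) = semi L t f \<sigma> - mean L f" .
  have "gibbs \<rho> 1 L \<sigma> * (semi L t f \<sigma> - mean L (semi L t f))\<^sup>2 \<le> gibbs_var \<rho> 1 L (semi L t f)"
    by (rule sq_deviation_le_var[OF L \<sigma>])
  also have "\<dots> \<le> exp (- 2 * \<gamma> * t) * gibbs_var \<rho> 1 L f"
    by (rule var_decay[OF L gap t])
  also have "\<dots> \<le> exp (- 2 * \<gamma> * t) * 1"
    by (intro mult_left_mono gibbs_var_le_1 L) (auto simp: f_def sgn_if)
  finally show ?thesis unfolding tv mean_semi[OF L] by (simp add: mult.commute)
qed

section \<open>Times at which the chain is mixed\<close>

definition mixed_times :: "nat \<Rightarrow> real set" where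
  "mixed_times L = {t. t \<ge> 0 \<and> (SUP \<sigma>\<in>configs L. tv_dist L (chain_law \<rho> 1 L t \<sigma>) (gibbs \<rho> 1 L)) \<le> 1 / (2 * exp 1)}"

lemma T_mix_eq: "T_mix \<rho> 1 L = Inf (mixed_times L)"
  by (simp add: T_mix_def mixed_times_def)

lemma configs_nonempty: "configs L \<noteq> {}"
proof -
  have "{0..L} \<in> configs L" by (auto simp: configs_def)
  then show ?thesis by blast
qed

lemma gibbs_ge_power:
  assumes "\<sigma> \<in> configs L" "0 < L"
  shows "weight_base ^ L \<le> gibbs \<rho> 1 L \<sigma>"
proof -
  have "weight_base ^ L \<le> set_weight \<sigma>"
    using set_weight_ge_power[of \<sigma> 0 L] assms(1) by (simp add: configs_eq_span_sets)
  also have "\<dots> \<le> set_weight \<sigma> / renewal_mass L"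
    using renewal_mass_antimono[of 0 L] renewal_mass_pos[of L] set_weight_nonneg[of \<sigma>]
    by (simp add: pos_le_divide_eq mult_left_le)
  finally show ?thesis using gibbs_eq[OF assms] by simp
qed

text \<open>The condition \<open>large\<close> makes \<open>exp (- 2 * \<gamma> * t)\<close> at most
  \<open>weight_base ^ L\<close> times e^(-2), the square of twice the threshold in
  \<open>T_mix\<close>.\<close>

lemma mixed_timesI:
  assumes L: "0 < L" and gap: "\<And>f. \<gamma> * gibbs_var \<rho> 1 L f \<le> energy L f f" and t: "0 \<le> t"
    and large: "2 - ln weight_base * real L \<le> 2 * \<gamma> * t"
  shows "t \<in> mixed_times L"
proof -
  have "tv_dist L (chain_law \<rho> 1 L t \<sigma>) (gibbs \<rho> 1 L) \<le> 1 / (2 * exp 1)" if \<sigma>: "\<sigma> \<in> configs L" for \<sigma>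
  proof -
    define d where "d = 2 * tv_dist L (chain_law \<rho> 1 L t \<sigma>) (gibbs \<rho> 1 L)"
    have wb: "weight_base ^ L = exp (ln weight_base * real L)"
      using weight_base(1) by (metis exp_ln exp_of_nat2_mult)
    have "d\<^sup>2 * weight_base ^ L \<le> d\<^sup>2 * gibbs \<rho> 1 L \<sigma>"
      by (intro mult_left_mono gibbs_ge_power \<sigma> L) simp
    also have "\<dots> \<le> exp (- 2 * \<gamma> * t)"
      unfolding d_def by (rule tv_dist_le[OF L gap t \<sigma>])
    also have "\<dots> \<le> exp (- 2 + ln weight_base * real L)"
      using large by simp
    also have "\<dots> = (1 / exp 1)\<^sup>2 * weight_base ^ L"
      unfolding wb by (simp add: exp_add exp_minus power2_eq_square field_simps flip: exp_add)
    finally have "d\<^sup>2 \<le> (1 / exp 1)\<^sup>2"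
      using weight_base(1) by simp
    then have "d \<le> 1 / exp 1" by (rule power2_le_imp_le) simp
    then show ?thesis by (simp add: d_def)
  qed
  then have "(SUP \<sigma>\<in>configs L. tv_dist L (chain_law \<rho> 1 L t \<sigma>) (gibbs \<rho> 1 L)) \<le> 1 / (2 * exp 1)"
    by (intro cSUP_least configs_nonempty)
  then show ?thesis using t by (simp add: mixed_times_def)
qed

text \<open>Let \<open>p\<close> be the mean of the indicator. A mixed chain started in
  \<open>S\<close> is in \<open>S\<close> with probability at most \<open>p + 2/5\<close>, so the
  autocorrelation is at most \<open>9/10 * p\<close>. By \<open>autocorrelation_ge\<close> it is at
  least \<open>p\<close> minus \<open>t\<close> times the energy; the missing tenth gives the factor
  10.\<close>

lemma mixed_times_ge:
  assumes L: "0 < L" and t: "t \<in> mixed_times L" and S: "mean L (indicator S) \<le> 1 / 2"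
  shows "mean L (indicator S) \<le> 10 * t * energy L (indicator S) (indicator S)"
proof -
  define f :: "nat set \<Rightarrow> real" where "f = indicator S"
  define p where "p = mean L f"
  have t0: "t \<ge> 0" and sup: "(SUP \<sigma>\<in>configs L. tv_dist L (chain_law \<rho> 1 L t \<sigma>) (gibbs \<rho> 1 L)) \<le> 1 / (2 * exp 1)"
    using t by (auto simp: mixed_times_def)
  \<comment> \<open>The number 5/2 is the second-order Taylor bound 1 + 1 + 1/2 for e.\<close>
  have e: "1 / exp 1 \<le> (2 / 5 :: real)"
    using exp_lower_Taylor_quadratic[of 1] by (simp add: field_simps)
  have dev: "semi L t f \<sigma> \<le> p + 2 / 5" if \<sigma>: "\<sigma> \<in> configs L" for \<sigma>
  proof -
    have "semi L t f \<sigma> - p = (\<Sum>\<eta>\<in>configs L. f \<eta> * (chain_law \<rho> 1 L t \<sigma> \<eta> - gibbs \<rho> 1 L \<eta>))"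
      unfolding semi_expand[OF \<sigma>] p_def gibbs_mean_def
      by (simp add: right_diff_distrib sum_subtractf mult.commute)
    also have "\<dots> \<le> (\<Sum>\<eta>\<in>configs L. \<bar>chain_law \<rho> 1 L t \<sigma> \<eta> - gibbs \<rho> 1 L \<eta>\<bar>)"
      by (intro sum_mono) (auto simp: f_def indicator_def)
    also have "\<dots> = 2 * tv_dist L (chain_law \<rho> 1 L t \<sigma>) (gibbs \<rho> 1 L)"
      by (simp add: tv_dist_def)
    also have "tv_dist L (chain_law \<rho> 1 L t \<sigma>) (gibbs \<rho> 1 L) \<le> 1 / (2 * exp 1)"
      by (rule order_trans[OF _ sup], rule cSUP_upper[OF \<sigma>])
         (intro bdd_above_finite finite_imageI finite_configs)
    finally show ?thesis using e by simp
  qed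
  have ff: "mean L (\<lambda>\<eta>. f \<eta> * f \<eta>) = p"
    unfolding p_def by (intro gibbs_mean_cong) (simp add: f_def indicator_def)
  have p0: "p \<ge> 0" unfolding p_def f_def by (intro mean_nonneg L) simp
  have "p - t * energy L f f \<le> mean L (\<lambda>\<eta>. f \<eta> * semi L t f \<eta>)"
    using autocorrelation_ge[OF L t0, of f] ff by simp
  also have "\<dots> \<le> mean L (\<lambda>\<eta>. (p + 2 / 5) * f \<eta>)"
    using dev by (intro mean_mono L) (auto simp: f_def indicator_def)
  also have "\<dots> = (p + 2 / 5) * p" by (simp add: mean_cmult p_def)
  also have "\<dots> \<le> (9 / 10) * p" using S p0 by (intro mult_right_mono) (auto simp: p_def f_def)
  finally show ?thesis by (simp add: p_def f_def)
qed

end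

section \<open>Emptiness of the middle half\<close>

text \<open>Symmetric under reflection of the interval, and nonempty already for
  \<open>L = 2\<close>, where the quotient is 0.\<close>

definition middle :: "nat \<Rightarrow> nat set" where
  "middle L = {L div 4<..<L - L div 4}"

definition middle_empty :: "nat \<Rightarrow> nat set set" where
  "middle_empty L = {\<eta>. \<eta> \<inter> middle L = {}}"

lemma finite_middle [simp]: "finite (middle L)"
  by (simp add: middle_def)

lemma middleD:
  assumes "x \<in> middle L"
  shows "L div 4 < x" "x < L - L div 4" "0 < x" "x < L" "L - x \<in> middle L"
  using assms by (auto simp: middle_def)

lemma card_middle:
  assumes "2 \<le> L"
  shows "real L / 4 \<le> real (card (middle L))"
proof -
  define q where "q = L div 4"
  have q: "4 * q \<le> L" by (simp add: q_def)
  have "L \<le> 4 * (L - q - Suc q)"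
  proof (cases "q = 0")
    case False
    then show ?thesis using q by linarith
  qed (use assms in linarith)
  then show ?thesis by (simp add: middle_def q_def)
qed

lemma left_parts_mono: "x \<le> y \<Longrightarrow> left_parts x \<subseteq> left_parts y"
  by (auto simp: left_parts_def)

lemma right_parts_antimono: "x \<le> y \<Longrightarrow> right_parts y L \<subseteq> right_parts x L"
  by (auto simp: right_parts_def)

context pinning
begin

section \<open>Configurations split around the middle, and first entry into it\<close>

definition outer_left :: "nat \<Rightarrow> nat set set" where
  "outer_left L = left_parts (Suc (L div 4))"

definition outer_right :: "nat \<Rightarrow> nat set set" where
  "outer_right L = right_parts (L - L div 4 - 1) L"

text \<open>The bounds in \<open>left_parts\<close> and \<open>right_parts\<close> are strict, so
  the shifts by one admit particles up to \<open>L div 4\<close> on the left and from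
  \<open>L - L div 4\<close> on the right.\<close>

lemma outer_subset:
  assumes "x \<in> middle L"
  shows "outer_left L \<subseteq> left_parts x" "outer_right L \<subseteq> right_parts x L"
  unfolding outer_left_def outer_right_def
  using middleD[OF assms] by (intro left_parts_mono right_parts_antimono; linarith)+

lemma outer_disjoint_middle:
  assumes "A \<in> outer_left L" "B \<in> outer_right L"
  shows "(A \<union> B) \<inter> middle L = {}"
  using assms by (fastforce simp: outer_left_def outer_right_def left_parts_def right_parts_def middle_def)

lemma outer_if_disjoint_middle:
  assumes "A \<in> left_parts x" "B \<in> right_parts x L" "x \<in> middle L" "(A \<union> B) \<inter> middle L = {}"
  shows "A \<in> outer_left L" "B \<in> outer_right L"
proof -
  have "a < Suc (L div 4)" if "a \<in> A" for a
    using left_partsD(5)[OF assms(1) that] assms(3,4) that by (fastforce simp: middle_def)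
  then show "A \<in> outer_left L"
    using assms(1) by (auto simp: outer_left_def left_parts_def)
  have "L - L div 4 - 1 < b" if "b \<in> B" for b
    using right_partsD(6)[OF assms(2) that] assms(3,4) that by (fastforce simp: middle_def)
  then show "B \<in> outer_right L"
    using assms(2) by (auto simp: outer_right_def right_parts_def)
qed

text \<open>For \<open>x\<close> beyond \<open>L div 4\<close>, the probability that the free
  renewal process has its first renewal after \<open>L div 4\<close> at \<open>x\<close>.\<close>

definition entry :: "nat \<Rightarrow> nat \<Rightarrow> real" where
  "entry L x = (\<Sum>a\<le>L div 4. renewal_mass a * K (x - a))"

lemma entry_nonneg: "0 \<le> entry L x"
  by (simp add: entry_def sum_nonneg renewal_mass_nonneg K_nonneg)

lemma sum_outer_left: "(\<Sum>A\<in>outer_left L. set_weight A * K (x - Max A)) = entry L x"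
  unfolding outer_left_def entry_def sum_left_parts_weight[of "\<lambda>a. K (x - a)"] lessThan_Suc_atMost ..

lemma sum_outer_right_general:
  assumes "2 \<le> L"
  shows "(\<Sum>B\<in>outer_right L. F (Min B) * set_weight B) = (\<Sum>a\<le>L div 4. renewal_mass a * F (L - a))"
proof -
  have "(\<Sum>B\<in>outer_right L. F (Min B) * set_weight B)
      = (\<Sum>c\<in>{L - L div 4 - 1<..L}. F c * renewal_mass (L - c))"
    unfolding outer_right_def by (rule sum_right_parts_weight)
  also have "\<dots> = (\<Sum>a\<le>L div 4. renewal_mass a * F (L - a))"
    by (rule sum.reindex_bij_witness[of _ "\<lambda>a. L - a" "\<lambda>c. L - c"]) (use assms in auto)
  finally show ?thesis .
qed

lemma sum_outer_right:
  assumes "2 \<le> L"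
  shows "(\<Sum>B\<in>outer_right L. K (Min B - x) * set_weight B) = entry L (L - x)"
  unfolding sum_outer_right_general[OF assms, of "\<lambda>c. K (c - x)"] entry_def
  by (simp add: add.commute)

text \<open>First entries at different sites are disjoint events. For each last renewal
  \<open>a\<close> up to \<open>l\<close>, the steps into the middle have total probability at most
  \<open>tail (l - a)\<close>.\<close>

lemma sum_entry_le_1: "(\<Sum>x\<in>middle L. entry L x) \<le> 1"
proof -
  define l where "l = L div 4"
  have "(\<Sum>x\<in>middle L. entry L x) = (\<Sum>a\<le>l. \<Sum>x\<in>middle L. renewal_mass a * K (x - a))"
    unfolding entry_def l_def by (rule sum.swap)
  also have "\<dots> \<le> (\<Sum>a\<le>l. renewal_mass a * tail (l - a))"
    unfolding sum_distrib_left[symmetric]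
  proof (intro sum_mono mult_left_mono renewal_mass_nonneg)
    fix a assume a: "a \<in> {..l}"
    have "(\<Sum>x\<in>middle L. K (x - a)) = (\<Sum>j\<in>(\<lambda>x. x - a) ` middle L. K j)"
      by (rule sum.reindex[symmetric, unfolded o_def]) (use a in \<open>auto simp: inj_on_def middle_def l_def\<close>)
    also have "\<dots> \<le> (\<Sum>j=Suc (l - a)..l - a + L. K j)"
      by (intro sum_mono2 K_nonneg) (use a in \<open>auto simp: middle_def l_def\<close>)
    also have "\<dots> \<le> tail (l - a)" by (rule sum_K_le_tail)
    finally show "(\<Sum>x\<in>middle L. K (x - a)) \<le> tail (l - a)" .
  qed
  also have "\<dots> = 1" by (rule renewal_mass_convolution_tail)
  finally show ?thesis .
qed

text \<open>Entering in the far half forces a step of length at least \<open>L / 4\<close>. It costs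
  L^-(1 + rho), and its possible starting points carry mass of order L^rho.\<close>

lemma entry_le: "\<exists>C>0. \<forall>L\<ge>2. \<forall>x. L \<le> 2 * x \<longrightarrow> entry L x \<le> C / real L"
proof -
  obtain C where C: "C > 0" "\<And>n. renewal_fn n \<le> C * real (Suc n) powr \<rho>"
    using renewal_fn_le by blast
  define D where "D = C * cK * (1 / 4) powr - (1 + \<rho>)"
  have "entry L x \<le> D / real L" if L: "2 \<le> L" "L \<le> 2 * x" for L x
  proof -
    have "entry L x \<le> (\<Sum>a\<le>L div 4. renewal_mass a * (cK * (1 / 4 * real L) powr - (1 + \<rho>)))"
      unfolding entry_def
    proof (intro sum_mono mult_left_mono renewal_mass_nonneg)
      fix a assume "a \<in> {..L div 4}"
      then have "L \<le> 4 * (x - a)" using L by auto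
      then show "K (x - a) \<le> cK * (1 / 4 * real L) powr - (1 + \<rho>)"
        unfolding renewal_K_def using cK_pos rho_pos L by (intro mult_left_mono powr_mono2') auto
    qed
    also have "\<dots> = renewal_fn (L div 4) * (cK * (1 / 4 * real L) powr - (1 + \<rho>))"
      by (simp add: renewal_fn_def sum_distrib_right)
    also have "\<dots> \<le> (C * real L powr \<rho>) * (cK * (1 / 4 * real L) powr - (1 + \<rho>))"
    proof (rule mult_right_mono)
      have "real (Suc (L div 4)) powr \<rho> \<le> real L powr \<rho>"
        using L(1) rho_pos by (intro powr_mono2) auto
      then have "C * real (Suc (L div 4)) powr \<rho> \<le> C * real L powr \<rho>"
        using C(1) by (intro mult_left_mono) auto
      then show "renewal_fn (L div 4) \<le> C * real L powr \<rho>" using C(2)[of "L div 4"] by linarith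
    qed (use cK_pos in simp)
    also have "\<dots> = D * (real L powr \<rho> * real L powr - (1 + \<rho>))"
      unfolding D_def by (subst powr_mult) auto
    also have "real L powr \<rho> * real L powr - (1 + \<rho>) = real L powr - 1"
      by (simp flip: powr_add)
    finally show ?thesis using L by (simp add: powr_minus_divide)
  qed
  moreover have "D > 0" using C(1) cK_pos by (simp add: D_def)
  ultimately show ?thesis by blast
qed

text \<open>Only edges that create the sole middle particle at \<open>x\<close> contribute, with
  weight at most \<open>entry L x * entry L (L - x)\<close>. One of \<open>x\<close> and
  \<open>L - x\<close> lies in the far half, so one factor is of order 1/L while the other sums to
  at most 1. Division by \<open>renewal_mass L\<close>, of order L^(rho - 1), leaves
  L^(-rho).\<close>

lemma energy_middle_empty:
  "\<exists>C>0. \<forall>L\<ge>2. energy L (indicator (middle_empty L)) (indicator (middle_empty L)) \<le> C * real L powr - \<rho>"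
proof -
  obtain C where C: "C > 0" "\<And>L x. 2 \<le> L \<Longrightarrow> L \<le> 2 * x \<Longrightarrow> entry L x \<le> C / real L"
    using entry_le by blast
  obtain b where b: "b > 0" "\<And>n. n > 0 \<Longrightarrow> b * real n powr (\<rho> - 1) \<le> renewal_mass n"
    using renewal_mass_ge' by blast
  have "energy L (indicator (middle_empty L)) (indicator (middle_empty L)) \<le> 2 * C / b * real L powr - \<rho>"
    if L: "2 \<le> L" for L
  proof -
    define f :: "nat set \<Rightarrow> real" where "f = indicator (middle_empty L)"
    define T where "T x = (\<Sum>A\<in>left_parts x. \<Sum>B\<in>right_parts x L. conductance x A B
      * (f (A \<union> B) - f (insert x (A \<union> B))) * (f (A \<union> B) - f (insert x (A \<union> B))))" for x
    have cond_le: "conductance x A B \<le> set_weight (insert x (A \<union> B))"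
      if "A \<in> left_parts x" "B \<in> right_parts x L" for x A B
    proof -
      have "0 < set_weight (A \<union> B)" "0 < set_weight (insert x (A \<union> B))"
        using configs_union_parts[OF that] by (auto intro: set_weight_configs_pos)
      then show ?thesis by (simp add: conductance_def field_simps)
    qed
    have T_0: "T x = 0" if "x \<notin> middle L" for x
      unfolding T_def using that
      by (intro sum.neutral ballI) (auto simp: f_def indicator_def middle_empty_def)
    have T_le: "T x \<le> entry L x * entry L (L - x)" if x: "x \<in> middle L" for x
    proof -
      have "T x \<le> (\<Sum>A\<in>left_parts x. \<Sum>B\<in>right_parts x L.
          if A \<in> outer_left L \<and> B \<in> outer_right L then set_weight (insert x (A \<union> B)) else 0)"
        unfolding T_def
      proof (intro sum_mono)
        fix A B assume AB: "A \<in> left_parts x" "B \<in> right_parts x L"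
        have "f (insert x (A \<union> B)) = 0" using x by (auto simp: f_def indicator_def middle_empty_def)
        moreover have "f (A \<union> B) = (if A \<in> outer_left L \<and> B \<in> outer_right L then 1 else 0)"
          using outer_if_disjoint_middle[OF AB x] outer_disjoint_middle[of A L B]
          by (auto simp: f_def indicator_def middle_empty_def)
        ultimately show "conductance x A B * (f (A \<union> B) - f (insert x (A \<union> B))) * (f (A \<union> B) - f (insert x (A \<union> B)))
          \<le> (if A \<in> outer_left L \<and> B \<in> outer_right L then set_weight (insert x (A \<union> B)) else 0)"
          using cond_le[OF AB] by simp
      qed
      also have "\<dots> = (\<Sum>A\<in>left_parts x. if A \<in> outer_left L then
          \<Sum>B\<in>right_parts x L. if B \<in> outer_right L then set_weight (insert x (A \<union> B)) else 0 else 0)"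
        by (intro sum.cong refl) auto
      also have "\<dots> = (\<Sum>A\<in>outer_left L. \<Sum>B\<in>outer_right L. set_weight (insert x (A \<union> B)))"
        using outer_subset[OF x] by (simp add: Int_absorb1 flip: sum.inter_restrict)
      also have "\<dots> = (\<Sum>A\<in>outer_left L. \<Sum>B\<in>outer_right L. (set_weight A * K (x - Max A)) * (K (Min B - x) * set_weight B))"
        using outer_subset[OF x] by (intro sum.cong refl) (auto simp: set_weight_filled_site dest!: subsetD)
      also have "\<dots> = entry L x * entry L (L - x)"
        by (simp add: sum_outer_right[OF L] sum_outer_left flip: sum_product)
      finally show ?thesis .
    qed
    have T_le': "T x \<le> C / real L * (entry L x + entry L (L - x))" if x: "x \<in> middle L" for x
    proof (cases "L \<le> 2 * x")
      case True
      have "entry L x * entry L (L - x) \<le> C / real L * entry L (L - x)"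
        by (intro mult_right_mono C L True entry_nonneg)
      also have "\<dots> \<le> C / real L * (entry L x + entry L (L - x))"
        using C(1) entry_nonneg[of L x] by (intro mult_left_mono) auto
      finally show ?thesis using T_le[OF x] by linarith
    next
      case False
      then have "L \<le> 2 * (L - x)" using middleD[OF x] by linarith
      then have "entry L x * entry L (L - x) \<le> entry L x * (C / real L)"
        by (intro mult_left_mono C L entry_nonneg)
      also have "\<dots> = C / real L * entry L x" by simp
      also have "\<dots> \<le> C / real L * (entry L x + entry L (L - x))"
        using C(1) entry_nonneg[of L "L - x"] by (intro mult_left_mono) auto
      finally show ?thesis using T_le[OF x] by linarith
    qed
    have refl_sum: "(\<Sum>x\<in>middle L. entry L (L - x)) = (\<Sum>x\<in>middle L. entry L x)"
      by (rule sum.reindex_bij_witness[of _ "\<lambda>x. L - x" "\<lambda>x. L - x"]) (auto dest: middleD)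
    have sub: "middle L \<subseteq> {0<..<L}" by (auto dest: middleD)
    have "energy L f f * renewal_mass L = (\<Sum>x\<in>{0<..<L}. T x)"
      using renewal_mass_pos[of L] by (simp add: energy_def T_def)
    also have "\<dots> = (\<Sum>x\<in>middle L. T x)"
      by (rule sum.mono_neutral_right) (use sub T_0 in auto)
    also have "\<dots> \<le> (\<Sum>x\<in>middle L. C / real L * (entry L x + entry L (L - x)))"
      by (intro sum_mono T_le')
    also have "\<dots> = C / real L * (2 * (\<Sum>x\<in>middle L. entry L x))"
      unfolding sum_distrib_left[symmetric] sum.distrib refl_sum by simp
    also have "\<dots> \<le> C / real L * (2 * 1)"
      using C(1) sum_entry_le_1[of L] by (intro mult_left_mono) auto
    finally have "energy L f f * renewal_mass L \<le> 2 * C / real L" by (simp add: mult.commute)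
    moreover have "energy L f f * (b * real L powr (\<rho> - 1)) \<le> energy L f f * renewal_mass L"
      using L by (intro mult_left_mono b energy_nonneg) auto
    ultimately have "energy L f f * (b * real L powr (\<rho> - 1)) \<le> 2 * C / real L" by linarith
    then have "energy L f f * (b * (real L powr \<rho> / real L)) \<le> 2 * C / real L"
      using L by (simp add: powr_diff)
    then have "energy L f f * b * real L powr \<rho> \<le> 2 * C"
      using L by (simp add: divide_le_cancel mult.assoc)
    then have "energy L f f \<le> 2 * C / (b * real L powr \<rho>)"
      using b(1) L by (simp add: pos_le_divide_eq mult.assoc)
    then show ?thesis by (simp add: f_def powr_minus_divide)
  qed
  moreover have "2 * C / b > 0" using C(1) b(1) by simp
  ultimately show ?thesis by blast
qed

lemma renewal_fn_quarter_ge: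
  "\<exists>c>0. \<forall>L\<ge>2. c * real L powr \<rho> \<le> renewal_fn (L div 4)"
proof -
  obtain c where c: "c > 0" "\<And>n. c * real (Suc n) powr \<rho> \<le> renewal_fn n"
    using renewal_fn_ge by blast
  have "c * (1 / 4) powr \<rho> * real L powr \<rho> \<le> renewal_fn (L div 4)" if "2 \<le> L" for L
  proof -
    have "(1 / 4 * real L) powr \<rho> \<le> real (Suc (L div 4)) powr \<rho>"
      using rho_pos by (intro powr_mono2) auto
    then have "c * (1 / 4 * real L) powr \<rho> \<le> c * real (Suc (L div 4)) powr \<rho>"
      using c(1) by (intro mult_left_mono) auto
    moreover have "c * (1 / 4 * real L) powr \<rho> = c * (1 / 4) powr \<rho> * real L powr \<rho>"
      by (subst powr_mult) auto
    ultimately show ?thesis using c(2)[of "L div 4"] by linarith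
  qed
  moreover have "c * (1 / 4) powr \<rho> > 0" using c(1) by simp
  ultimately show ?thesis by blast
qed

text \<open>A gap bridging the middle weighs at least \<open>K L\<close>, and the outer parts sum to
  order L^rho on each side. The product has order L^(rho - 1), the order of the partition
  function.\<close>

lemma mean_middle_empty_ge: "\<exists>c>0. \<forall>L\<ge>2. c \<le> mean L (indicator (middle_empty L))"
proof -
  obtain a where a: "a > 0" "\<And>n. n > 0 \<Longrightarrow> renewal_mass n \<le> a * real n powr (\<rho> - 1)"
    using renewal_mass_le' by blast
  obtain c where c: "c > 0" "\<And>L. 2 \<le> L \<Longrightarrow> c * real L powr \<rho> \<le> renewal_fn (L div 4)"
    using renewal_fn_quarter_ge by blast
  have "cK * c\<^sup>2 / a \<le> mean L (indicator (middle_empty L))" if L: "2 \<le> L" for L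
  proof -
    have "middle L \<noteq> {}" using card_middle[OF L] L by auto
    \<comment> \<open>An arbitrary middle site, used only to enumerate configurations through
      \<open>sum_configs_split\<close>.\<close>
    then obtain x where x: "x \<in> middle L" by blast
    have "K L * (renewal_fn (L div 4) * renewal_fn (L div 4))
        = K L * ((\<Sum>A\<in>outer_left L. set_weight A) * (\<Sum>B\<in>outer_right L. set_weight B))"
      using sum_outer_right_general[OF L, of "\<lambda>_. 1"] sum_left_parts_weight[of "\<lambda>_. 1" "Suc (L div 4)"]
      by (simp add: outer_left_def renewal_fn_def lessThan_Suc_atMost)
    also have "\<dots> = (\<Sum>A\<in>outer_left L. \<Sum>B\<in>outer_right L. set_weight A * K L * set_weight B)"
      unfolding sum_product by (simp add: sum_distrib_left mult_ac)
    also have "\<dots> \<le> (\<Sum>A\<in>outer_left L. \<Sum>B\<in>outer_right L. set_weight (A \<union> B) * indicator (middle_empty L) (A \<union> B))"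
    proof (intro sum_mono)
      fix A B assume AB': "A \<in> outer_left L" "B \<in> outer_right L"
      then have AB: "A \<in> left_parts x" "B \<in> right_parts x L" using outer_subset[OF x] by auto
      have "K L \<le> K (Min B - Max A)"
        using left_partsD(4)[OF AB(1)] right_partsD(4,5)[OF AB(2)] by (intro K_antimono) auto
      then have "set_weight A * K L * set_weight B \<le> set_weight (A \<union> B)"
        unfolding set_weight_empty_site[OF AB] by (intro mult_right_mono mult_left_mono set_weight_nonneg)
      then show "set_weight A * K L * set_weight B \<le> set_weight (A \<union> B) * indicator (middle_empty L) (A \<union> B)"
        using outer_disjoint_middle[OF AB'] by (simp add: middle_empty_def)
    qed
    also have "\<dots> \<le> (\<Sum>A\<in>left_parts x. \<Sum>B\<in>right_parts x L. set_weight (A \<union> B) * indicator (middle_empty L) (A \<union> B))"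
      unfolding sum.cartesian_product using outer_subset[OF x]
      by (intro sum_mono2) (auto simp: set_weight_nonneg)
    also have "\<dots> \<le> (\<Sum>\<eta>\<in>configs L. set_weight \<eta> * indicator (middle_empty L) \<eta>)"
      unfolding sum_configs_split[OF middleD(3,4)[OF x]] by (intro sum_mono) (simp add: set_weight_nonneg)
    also have "\<dots> = mean L (indicator (middle_empty L)) * renewal_mass L"
      using L renewal_mass_pos[of L] by (simp add: gibbs_mean_eq)
    also have "\<dots> \<le> mean L (indicator (middle_empty L)) * (a * real L powr (\<rho> - 1))"
      using L by (intro mult_left_mono a mean_nonneg) auto
    finally have 1: "K L * (renewal_fn (L div 4) * renewal_fn (L div 4))
        \<le> mean L (indicator (middle_empty L)) * (a * real L powr (\<rho> - 1))" .
    have "cK * c\<^sup>2 * real L powr (\<rho> - 1) = K L * ((c * real L powr \<rho>) * (c * real L powr \<rho>))"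
    proof -
      have "real L powr - (1 + \<rho>) * (real L powr \<rho> * real L powr \<rho>) = real L powr (\<rho> - 1)"
        by (simp flip: powr_add)
      then show ?thesis by (simp add: renewal_K_def power2_eq_square mult_ac)
    qed
    also have "\<dots> \<le> K L * (renewal_fn (L div 4) * renewal_fn (L div 4))"
      using c L by (intro mult_left_mono mult_mono K_nonneg) (auto simp: renewal_fn_def sum_nonneg renewal_mass_nonneg)
    finally have "cK * c\<^sup>2 * real L powr (\<rho> - 1) \<le> (mean L (indicator (middle_empty L)) * a) * real L powr (\<rho> - 1)"
      using 1 by (simp add: mult.assoc)
    then have "cK * c\<^sup>2 \<le> mean L (indicator (middle_empty L)) * a"
      using L by (subst (asm) mult_le_cancel_right) auto
    then show ?thesis using a(1) by (simp add: pos_divide_le_eq)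
  qed
  moreover have "cK * c\<^sup>2 / a > 0" using cK_pos c(1) a(1) by simp
  ultimately show ?thesis by blast
qed

text \<open>Decomposition by the first middle particle \<open>x\<close>. Since
  \<open>renewal_mass (L - x)\<close> is at least \<open>renewal_mass L\<close>, each
  \<open>x\<close> has probability at least \<open>entry L x\<close>, which is at least of order
  1/L, and there are at least \<open>L / 4\<close> such sites.\<close>

lemma mean_middle_occupied_ge: "\<exists>c>0. \<forall>L\<ge>2. c \<le> mean L (indicator (- middle_empty L))"
proof -
  obtain c where c: "c > 0" "\<And>L. 2 \<le> L \<Longrightarrow> c * real L powr \<rho> \<le> renewal_fn (L div 4)"
    using renewal_fn_quarter_ge by blast
  have "cK * c / 4 \<le> mean L (indicator (- middle_empty L))" if L: "2 \<le> L" for L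
  proof -
    define first where "first x \<eta> \<longleftrightarrow> x \<in> \<eta> \<and> \<eta> \<inter> {L div 4<..<x} = {}" for x and \<eta> :: "nat set"
    have entry_ge: "c * real L powr \<rho> * K L \<le> entry L x" if x: "x \<in> middle L" for x
    proof -
      have "c * real L powr \<rho> * K L \<le> renewal_fn (L div 4) * K L"
        by (intro mult_right_mono c L K_nonneg)
      also have "\<dots> = (\<Sum>a\<le>L div 4. renewal_mass a * K L)" by (simp add: renewal_fn_def sum_distrib_right)
      also have "\<dots> \<le> entry L x"
        unfolding entry_def using middleD[OF x]
        by (intro sum_mono mult_left_mono K_antimono renewal_mass_nonneg) auto
      finally show ?thesis .
    qed
    have le: "entry L x * renewal_mass L \<le> (\<Sum>\<eta>\<in>configs L. set_weight \<eta> * of_bool (first x \<eta>))"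
      if x: "x \<in> middle L" for x
    proof -
      have "entry L x * renewal_mass L \<le> entry L x * renewal_mass (L - x)"
        by (intro mult_left_mono renewal_mass_antimono entry_nonneg) simp
      also have "\<dots> = (\<Sum>A\<in>outer_left L. \<Sum>B\<in>right_parts x L. (set_weight A * K (x - Max A)) * (K (Min B - x) * set_weight B))"
        using middleD(4)[OF x] by (simp add: sum_outer_left sum_right_renewal_mass flip: sum_product)
      also have "\<dots> = (\<Sum>A\<in>outer_left L. \<Sum>B\<in>right_parts x L. set_weight (insert x (A \<union> B)) * of_bool (first x (insert x (A \<union> B))))"
      proof (intro sum.cong refl)
        fix A B assume AB: "A \<in> outer_left L" "B \<in> right_parts x L"
        then have A: "A \<in> left_parts x" using outer_subset[OF x] by auto
        have "first x (insert x (A \<union> B))"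
          using AB unfolding first_def by (auto simp: outer_left_def left_parts_def right_parts_def)
        then show "(set_weight A * K (x - Max A)) * (K (Min B - x) * set_weight B)
            = set_weight (insert x (A \<union> B)) * of_bool (first x (insert x (A \<union> B)))"
          by (simp add: set_weight_filled_site[OF A AB(2)])
      qed
      also have "\<dots> \<le> (\<Sum>A\<in>left_parts x. \<Sum>B\<in>right_parts x L. set_weight (insert x (A \<union> B)) * of_bool (first x (insert x (A \<union> B))))"
        using outer_subset[OF x] by (intro sum_mono2 sum_nonneg) (auto simp: set_weight_nonneg)
      also have "\<dots> \<le> (\<Sum>\<eta>\<in>configs L. set_weight \<eta> * of_bool (first x \<eta>))"
        unfolding sum_configs_split[OF middleD(3,4)[OF x]] by (intro sum_mono) (simp add: set_weight_nonneg)
      finally show ?thesis .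
    qed
    have count: "(\<Sum>x\<in>middle L. of_bool (first x \<eta>)) \<le> (indicator (- middle_empty L) \<eta> :: real)" for \<eta>
    proof (cases "\<exists>x\<in>middle L. first x \<eta>")
      case True
      then obtain x where x: "x \<in> middle L" "first x \<eta>" by blast
      have uniq: "y = x" if "y \<in> middle L" "first y \<eta>" for y
        using x that by (cases x y rule: linorder_cases) (auto simp: first_def middle_def)
      have "(\<Sum>y\<in>middle L. of_bool (first y \<eta>)) = (\<Sum>y\<in>middle L. if y = x then 1 else 0 :: real)"
      proof (intro sum.cong refl)
        fix y assume "y \<in> middle L"
        then have "first y \<eta> \<longleftrightarrow> y = x" using uniq x by blast
        then show "of_bool (first y \<eta>) = (if y = x then 1 else 0 :: real)" by simp
      qed
      also have "\<dots> = 1" using x by simp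
      finally have "(\<Sum>y\<in>middle L. of_bool (first y \<eta>)) = (1 :: real)" .
      moreover have "indicator (- middle_empty L) \<eta> = (1 :: real)"
        using x by (auto simp: middle_empty_def first_def indicator_def)
      ultimately show ?thesis by (simp only: order.refl)
    qed (auto intro!: sum_nonpos simp: indicator_def)
    have "real L / 4 * (c * real L powr \<rho> * K L) \<le> real (card (middle L)) * (c * real L powr \<rho> * K L)"
      using c(1) by (intro mult_right_mono card_middle L) (simp add: K_nonneg)
    also have "\<dots> = (\<Sum>x\<in>middle L. c * real L powr \<rho> * K L)" by simp
    also have "\<dots> \<le> (\<Sum>x\<in>middle L. entry L x)" by (intro sum_mono entry_ge)
    finally have "real L / 4 * (c * real L powr \<rho> * K L) * renewal_mass L \<le> (\<Sum>x\<in>middle L. entry L x) * renewal_mass L"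
      by (intro mult_right_mono renewal_mass_nonneg)
    also have "\<dots> \<le> (\<Sum>x\<in>middle L. \<Sum>\<eta>\<in>configs L. set_weight \<eta> * of_bool (first x \<eta>))"
      unfolding sum_distrib_right by (intro sum_mono le)
    also have "\<dots> = (\<Sum>\<eta>\<in>configs L. set_weight \<eta> * (\<Sum>x\<in>middle L. of_bool (first x \<eta>)))"
      unfolding sum_distrib_left by (rule sum.swap)
    also have "\<dots> \<le> (\<Sum>\<eta>\<in>configs L. set_weight \<eta> * indicator (- middle_empty L) \<eta>)"
      by (intro sum_mono mult_left_mono count set_weight_nonneg)
    also have "\<dots> = mean L (indicator (- middle_empty L)) * renewal_mass L"
      using L renewal_mass_pos[of L] by (simp add: gibbs_mean_eq)
    finally have "real L / 4 * (c * real L powr \<rho> * K L) \<le> mean L (indicator (- middle_empty L))"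
      using renewal_mass_pos[of L] by simp
    moreover have "real L / 4 * (c * real L powr \<rho> * K L) = cK * c / 4"
    proof -
      have "real L powr 1 * (real L powr \<rho> * real L powr - (1 + \<rho>)) = real L powr 0"
        unfolding powr_add[symmetric] by simp
      then have "real L * (real L powr \<rho> * real L powr - (1 + \<rho>)) = 1" using L by simp
      then show ?thesis by (simp add: renewal_K_def mult_ac)
    qed
    ultimately show ?thesis by linarith
  qed
  moreover have "cK * c / 4 > 0" using cK_pos c(1) by simp
  ultimately show ?thesis by blast
qed


section \<open>Bounds on mixing and relaxation times\<close>

lemma gibbs_var_pos:
  assumes L: "0 < L" and f: "\<not> f constant_on configs L"
  shows "0 < gibbs_var \<rho> 1 L f"
proof -
  obtain \<sigma> where \<sigma>: "\<sigma> \<in> configs L" "f \<sigma> \<noteq> mean L f"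
    using f by (auto simp: constant_on_def)
  then have "0 < gibbs \<rho> 1 L \<sigma> * (f \<sigma> - mean L f)\<^sup>2"
    using L by (simp add: gibbs_pos)
  then show ?thesis using sq_deviation_le_var[OF L \<sigma>(1), of f] by linarith
qed

lemma gibbs_var_indicator:
  assumes "0 < L"
  shows "gibbs_var \<rho> 1 L (indicator S) = mean L (indicator S) * mean L (indicator (- S))"
    and "mean L (indicator (- S)) = 1 - mean L (indicator S)"
proof -
  define p where "p = mean L (indicator S)"
  have "mean L (indicator (- S)) = mean L (\<lambda>\<eta>. 1 - indicator S \<eta>)"
    by (intro gibbs_mean_cong) (simp add: indicator_compl)
  then show compl: "mean L (indicator (- S)) = 1 - mean L (indicator S)"
    unfolding mean_diff mean_const[OF assms] .
  have "gibbs_var \<rho> 1 L (indicator S) = mean L (\<lambda>\<eta>. (1 - 2 * p) * indicator S \<eta> + p\<^sup>2)"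
    unfolding gibbs_var_def p_def[symmetric]
    by (intro gibbs_mean_cong) (auto simp: indicator_def power2_eq_square algebra_simps)
  also have "\<dots> = (1 - 2 * p) * p + p\<^sup>2"
    unfolding mean_add mean_cmult mean_const[OF assms] p_def[symmetric] ..
  also have "\<dots> = p * (1 - p)" by (simp add: power2_eq_square algebra_simps)
  finally show "gibbs_var \<rho> 1 L (indicator S) = mean L (indicator S) * mean L (indicator (- S))"
    unfolding compl p_def .
qed

text \<open>An event and its complement have the same boundary, so the bound on mixed times can be
  applied to whichever has probability at most 1/2.\<close>

lemma energy_indicator_compl: "energy L (indicator (- S)) (indicator (- S)) = energy L (indicator S) (indicator S)"
  unfolding energy_def indicator_compl
  by (intro arg_cong2[where f = "(/)"] sum.cong refl) (simp add: algebra_simps)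

lemma gap_quotient_nonneg:
  assumes "0 < L"
  shows "0 \<le> dirichlet_form \<rho> 1 L f / gibbs_var \<rho> 1 L f"
  using assms by (auto simp: dirichlet_form_eq gibbs_var_def intro!: divide_nonneg_nonneg energy_nonneg mean_nonneg)

lemma spectral_gap_le:
  assumes "0 < L" "\<not> f constant_on configs L"
  shows "spectral_gap \<rho> 1 L \<le> energy L f f / gibbs_var \<rho> 1 L f"
proof -
  have "spectral_gap \<rho> 1 L \<le> dirichlet_form \<rho> 1 L f / gibbs_var \<rho> 1 L f"
    unfolding spectral_gap_def using assms
    by (intro cINF_lower) (auto intro!: bdd_belowI[of _ 0] gap_quotient_nonneg)
  then show ?thesis using assms(1) by (simp add: dirichlet_form_eq)
qed

text \<open>A pointwise bound on the Rayleigh quotients; the nonconstant \<open>f\<close> ensures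
  that the infimum is over a nonempty set.\<close>

lemma spectral_gap_ge:
  fixes f :: "nat set \<Rightarrow> real"
  assumes L: "0 < L" and gap: "\<And>f. \<gamma> * gibbs_var \<rho> 1 L f \<le> energy L f f"
    and ex: "\<not> f constant_on configs L"
  shows "\<gamma> \<le> spectral_gap \<rho> 1 L"
  unfolding spectral_gap_def
proof (rule cINF_greatest)
  fix g :: "nat set \<Rightarrow> real" assume "g \<in> {f. \<not> f constant_on configs L}"
  then have "0 < gibbs_var \<rho> 1 L g" by (simp add: gibbs_var_pos L)
  then show "\<gamma> \<le> dirichlet_form \<rho> 1 L g / gibbs_var \<rho> 1 L g"
    using gap[of g] by (simp add: dirichlet_form_eq L pos_le_divide_eq)
qed (use ex in blast)

lemma not_constant_if_var_pos:
  assumes "0 < L" "0 < gibbs_var \<rho> 1 L f"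
  shows "\<not> f constant_on configs L"
proof
  assume "f constant_on configs L"
  then obtain c where c: "\<And>\<eta>. \<eta> \<in> configs L \<Longrightarrow> f \<eta> = c" by (auto simp: constant_on_def)
  then have "mean L f = mean L (\<lambda>_. c)" by (intro gibbs_mean_cong)
  then have "mean L f = c" by (simp add: mean_const assms(1))
  then have "gibbs_var \<rho> 1 L f = mean L (\<lambda>_. 0)"
    unfolding gibbs_var_def using c by (intro gibbs_mean_cong) simp
  then show False using assms by (simp add: mean_const)
qed

end

theorem mainTheorem3:
  fixes \<rho> :: real
  assumes "0 < \<rho>" and "\<rho> < 1"
  shows "\<exists>C5 C6 :: real. C5 > 0 \<and> C6 > 0 \<and>
    (\<forall>L::nat. L \<ge> 2 \<longrightarrow>
      (C5 * real L powr \<rho> \<le> T_mix \<rho> 1 L \<and> T_mix \<rho> 1 L \<le> C6 * real L powr (2 + \<rho>)) \<and>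
      (C5 * real L powr \<rho> \<le> T_rel \<rho> 1 L \<and> T_rel \<rho> 1 L \<le> C6 * real L powr (1 + \<rho>)))"
proof -
  interpret pinning \<rho> by unfold_locales (use assms in auto)
  obtain C where C: "C > 0" "\<And>L f. L > 0 \<Longrightarrow> gibbs_var \<rho> 1 L f \<le> C * real L powr (1 + \<rho>) * energy L f f"
    using poincare by blast
  obtain e where e: "e > 0" "\<And>L. 2 \<le> L \<Longrightarrow>
      energy L (indicator (middle_empty L)) (indicator (middle_empty L)) \<le> e * real L powr - \<rho>"
    using energy_middle_empty by blast
  obtain c1 where c1: "c1 > 0" "\<And>L. 2 \<le> L \<Longrightarrow> c1 \<le> mean L (indicator (middle_empty L))"
    using mean_middle_empty_ge by blast
  obtain c2 where c2: "c2 > 0" "\<And>L. 2 \<le> L \<Longrightarrow> c2 \<le> mean L (indicator (- middle_empty L))"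
    using mean_middle_occupied_ge by blast
  define c where "c = min c1 c2"
  define \<kappa> where "\<kappa> = - ln weight_base"
  have c: "c > 0" using c1(1) c2(1) by (simp add: c_def)
  have \<kappa>: "\<kappa> \<ge> 0" using weight_base by (simp add: \<kappa>_def)
  \<comment> \<open>The first entry serves the mixing time, with the 10 of
    \<open>mixed_times_ge\<close>; the second serves the relaxation time, where
    \<open>c1 * c2\<close> bounds the variance of the indicator from below.\<close>
  define C5 where "C5 = min (c / (10 * e)) (c1 * c2 / e)"
  define C6 where "C6 = C * (1 + \<kappa>)"
  have "C5 > 0" using c c1(1) c2(1) e(1) by (simp add: C5_def)
  moreover have "C6 > 0" using C(1) \<kappa> by (simp add: C6_def add_pos_nonneg)
  moreover have "(C5 * real L powr \<rho> \<le> T_mix \<rho> 1 L \<and> T_mix \<rho> 1 L \<le> C6 * real L powr (2 + \<rho>)) \<and>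
      (C5 * real L powr \<rho> \<le> T_rel \<rho> 1 L \<and> T_rel \<rho> 1 L \<le> C6 * real L powr (1 + \<rho>))"
    if L: "2 \<le> L" for L
  proof -
    have L0: "0 < L" using L by simp
    define S where "S = middle_empty L"
    define E where "E = energy L (indicator S) (indicator S)"
    define N where "N = real L powr (1 + \<rho>)"
    have N: "N > 0" using L by (simp add: N_def)
    define \<gamma> where "\<gamma> = 1 / (C * N)"
    have \<gamma>: "\<gamma> > 0" using C(1) N by (simp add: \<gamma>_def)
    have gap: "\<gamma> * gibbs_var \<rho> 1 L f \<le> energy L f f" for f
      using C(2)[OF L0, of f] C(1) N by (simp add: \<gamma>_def N_def pos_divide_le_eq mult.commute)
    have E: "E * real L powr \<rho> \<le> e"
    proof -
      have "E * real L powr \<rho> \<le> e * real L powr - \<rho> * real L powr \<rho>"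
        using e(2)[OF L] by (intro mult_right_mono) (auto simp: E_def S_def)
      also have "\<dots> = e" using L by (simp add: powr_minus)
      finally show ?thesis .
    qed
    have p: "c1 \<le> mean L (indicator S)" "c2 \<le> mean L (indicator (- S))"
      using c1(2)[OF L] c2(2)[OF L] by (simp_all add: S_def)
    define v where "v = gibbs_var \<rho> 1 L (indicator S)"
    have v: "c1 * c2 \<le> v"
      unfolding v_def gibbs_var_indicator(1)[OF L0] using p c1(1) c2(1) by (intro mult_mono) auto
    have v0: "v > 0" using v c1(1) c2(1) by (meson less_le_trans mult_pos_pos)
    have nonconst: "\<not> (indicator S :: nat set \<Rightarrow> real) constant_on configs L"
      by (rule not_constant_if_var_pos[OF L0 v0[unfolded v_def]])

    define t where "t = C6 * real L powr (2 + \<rho>)"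
    have t: "t \<in> mixed_times L"
    proof (rule mixed_timesI[OF L0 gap])
      show "0 \<le> t" using C(1) \<kappa> by (simp add: t_def C6_def)
      \<comment> \<open>The extra factor \<open>L\<close> in \<open>t\<close> pays for the exponent
        \<open>\<kappa> * L\<close> of the least likely configuration; the summand 1 in
        \<open>C6\<close> covers the constant 2 because \<open>L\<close> is at least 1.\<close>
      have "\<gamma> * t = (1 + \<kappa>) * (real L powr (2 + \<rho>) / N)"
        using C(1) by (simp add: \<gamma>_def t_def C6_def)
      also have "real L powr (2 + \<rho>) / N = real L"
        using L by (simp add: N_def flip: powr_diff)
      finally have "\<gamma> * t = (1 + \<kappa>) * real L" .
      moreover have "1 * 1 + \<kappa> * real L \<le> real L + \<kappa> * real L" using L by simp
      moreover have "0 \<le> \<kappa> * real L" using \<kappa> by simp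
      ultimately show "2 - ln weight_base * real L \<le> 2 * \<gamma> * t"
        by (simp add: \<kappa>_def algebra_simps)
    qed
    have T_mix_upper: "T_mix \<rho> 1 L \<le> C6 * real L powr (2 + \<rho>)"
      unfolding T_mix_eq t_def[symmetric]
      by (rule cInf_lower[OF t]) (auto simp: mixed_times_def intro!: bdd_belowI[of _ 0])
    have T_mix_lower: "C5 * real L powr \<rho> \<le> T_mix \<rho> 1 L"
      unfolding T_mix_eq
    proof (rule cInf_greatest)
      fix s assume s: "s \<in> mixed_times L"
      then have s0: "s \<ge> 0" by (simp add: mixed_times_def)
      have "c \<le> 10 * s * E"
      \<comment> \<open>Which of the two events has probability at most 1/2 may depend on
        \<open>L\<close>; \<open>c\<close> is a lower bound for both.\<close>
      proof (cases "mean L (indicator S) \<le> 1 / 2")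
        case True
        then show ?thesis using mixed_times_ge[OF L0 s True] p by (simp add: E_def c_def)
      next
        case False
        then have "mean L (indicator (- S)) \<le> 1 / 2" using gibbs_var_indicator(2)[OF L0, of S] by simp
        then show ?thesis
          using mixed_times_ge[OF L0 s, of "- S"] p by (simp add: E_def c_def energy_indicator_compl)
      qed
      then have "c * real L powr \<rho> \<le> 10 * s * (E * real L powr \<rho>)"
        by (metis mult.assoc mult_right_mono powr_ge_zero)
      also have "\<dots> \<le> 10 * s * e" using E s0 by (intro mult_left_mono) auto
      finally have "c / (10 * e) * real L powr \<rho> \<le> s"
        using e(1) by (simp add: pos_divide_le_eq mult_ac)
      moreover have "C5 * real L powr \<rho> \<le> c / (10 * e) * real L powr \<rho>"
        by (intro mult_right_mono) (auto simp: C5_def)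
      ultimately show "C5 * real L powr \<rho> \<le> s" by linarith
    qed (use t in auto)

    define g where "g = spectral_gap \<rho> 1 L"
    have g_lower: "\<gamma> \<le> g" unfolding g_def by (rule spectral_gap_ge[OF L0 gap nonconst])
    have g0: "g > 0" using g_lower \<gamma> by linarith
    have "g \<le> E / v"
      unfolding g_def E_def v_def by (rule spectral_gap_le[OF L0 nonconst])
    then have "g * v \<le> E" using v0 by (simp add: pos_le_divide_eq)
    moreover have "g * (c1 * c2) \<le> g * v" using v g0 by (intro mult_left_mono) auto
    ultimately have "g * (c1 * c2) \<le> E" by linarith
    then have "g * (c1 * c2) * real L powr \<rho> \<le> E * real L powr \<rho>" by (intro mult_right_mono) auto
    with E have "g * (c1 * c2) * real L powr \<rho> \<le> e" by linarith
    then have "c1 * c2 / e * real L powr \<rho> \<le> 1 / g"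
      using e(1) g0 by (simp add: field_simps)
    moreover have "C5 * real L powr \<rho> \<le> c1 * c2 / e * real L powr \<rho>"
      by (intro mult_right_mono) (auto simp: C5_def)
    ultimately have T_rel_lower: "C5 * real L powr \<rho> \<le> T_rel \<rho> 1 L"
      unfolding T_rel_def g_def[symmetric] by linarith
    have "1 / g \<le> 1 / \<gamma>" using g_lower \<gamma> by (simp add: frac_le)
    also have "\<dots> = C * N" by (simp add: \<gamma>_def)
    also have "\<dots> \<le> C6 * N" using C(1) \<kappa> N by (intro mult_right_mono) (auto simp: C6_def)
    finally have "T_rel \<rho> 1 L \<le> C6 * real L powr (1 + \<rho>)"
      by (simp add: T_rel_def g_def N_def)
    then show ?thesis using T_mix_upper T_mix_lower T_rel_lower by blast
  qed
  ultimately show ?thesis by blast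
qed

end
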